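(* Consider a flat F-manifold given by a vector potential $\overline F=(F^1,\ldots,F^N)$, $F^\alpha\in\mathbb C[[t^1,\ldots,t^N]]$, with unit $A^\alpha\frac{\partial}{\partial t^\alpha}$, that is semisimple at the origin. Let $\mathcal C$ be its ancestor cone and let $\mathcal C^{\mathrm{const}}$ be the ancestor cone of its constant part, i.e. of the constant flat F-manifold whose structure constants are $c^\alpha_{\beta\gamma}=\frac{\partial^2F^\alpha}{\partial t^\beta\partial t^\gamma}\big|_{t^*=0}$ (with the same unit). Then there exists an element $R(z)\in G_+$ such that $\mathcal C=R(z)\mathcal C^{\mathrm{const}}$.
   Context: Repeated Greek indices are summed from $1$ to $N$; the lower index $0$ in $\Omega^{\alpha,d}_{\beta,0}$ is part of the notation. Flat F-manifolds. For $\bar t_{\mathrm{orig}}\in\mathbb C^N$ let $\mathcal R^{\bar t_{\mathrm{orig}}}$ be the ring of formal power series in $t^\alpha-t^\alpha_{\mathrm{orig}}$. A flat F-manifold on the formal neighbourhood of $\bar t_{\mathrm{orig}}$ is given by $F^\alpha\in\mathcal R^{\bar t_{\mathrm{orig}}}$ and $A^\alpha\in\mathbb C$ with $A^\mu\frac{\partial^2F^\alpha}{\partial t^\mu\partial t^\beta}=\delta^\alpha_\beta$ and $\frac{\partial^2F^\alpha}{\partial t^\beta\partial t^\mu}\frac{\partial^2F^\mu}{\partial t^\gamma\partial t^\delta}=\frac{\partial^2F^\alpha}{\partial t^\gamma\partial t^\mu}\frac{\partial^2F^\mu}{\partial t^\beta\partial t^\delta}$; structure constants $c^\alpha_{\beta\gamma}=\frac{\partial^2F^\alpha}{\partial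 t^\beta\partial t^\gamma}$. It is constant if all $c^\alpha_{\beta\gamma}$ are constant. It is semisimple at a point if the algebra with structure constants $c^\alpha_{\beta\gamma}$ at this point has a basis $\pi_1,\ldots,\pi_N$ with $\pi_k\circ\pi_l=\delta_{k,l}\pi_k$. Calibrations and descendant vector potentials. A calibration is a collection $\Omega^{\alpha,d}_{\beta,0}\in\mathcal R^{\bar t_{\mathrm{orig}}}$, $d\ge-1$, with $\Omega^{\alpha,-1}_{\beta,0}=\delta^\alpha_\beta$ and $\frac{\partial\Omega^{\alpha,d}_{\beta,0}}{\partial t^\gamma}=c^\mu_{\gamma\beta}\Omega^{\alpha,d-1}_{\mu,0}$, $d\ge0$. Put $\Omega^d_0=(\Omega^{\alpha,d}_{\beta,0})$, define $\Omega^0_d$, $d\ge 0$, by $(\mathrm{Id}+\sum_{d\ge1}(-1)^d\Omega^0_{d-1}z^d)(\mathrm{Id}+\sum_{d\ge1}\Omega^{d-1}_0z^d)=\mathrm{Id}$, $\Omega^0_{-1}=\mathrm{Id}$, and $\Omega^p_q=(\Omega^{\alpha,p}_{\beta,q})=\sum_{i=0}^q(-1)^{q-i}\Omega^{p+q-i}_0\Omega^0_{i-1}$. Then $A^\beta\Omega^{\alpha,0}_{\beta,0}=t^\alpha+c^\alpha$ for constants $\bar c=(c^\alpha)$; let $(\Omega^{\bar c})^{\alpha,p}_{\beta,q}=\Omega^{\alpha,p}_{\beta,q}|_{t^\gamma\mapsto t^\gamma-c^\gamma}$. Let $t^\alpha_0,t^\alpha_1,\ldots$ be variables (with $t^\alpha_0$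 in the role of $t^\alpha$) and let $v^\alpha\in\mathcal R^{\bar t_{\mathrm{orig}}+\bar c}[[t^*_{\ge1}]]$ be the solution of $\frac{\partial v^\alpha}{\partial t^\beta_d}=A^\gamma\frac{\partial}{\partial t^\gamma_0}\big((\Omega^{\bar c})^{\alpha,0}_{\beta,d}|_{t^*=v^*}\big)$ with $v^\alpha|_{t^*_{\ge1}=0}=t^\alpha_0$. With $q^\beta_b=t^\beta_b-A^\beta\delta_{b,1}$, the descendant vector potentials are $\mathcal F^{\alpha,a}=\sum_{b\ge0}\big((\Omega^{\bar c})^{\alpha,a}_{\beta,b}|_{t^*=v^*}\big)q^\beta_b$, $a\ge0$. Cones. Let $\mathcal H=\mathbb C^N[[z,z^{-1}]]$, with elements written $\sum_{d\ge0}\frac{(-1)^{d+1}p^\alpha_d\phi_\alpha}{z^{d+1}}+\sum_{d\ge0}q^\alpha_d\phi_\alpha z^d$, $\phi_\alpha$ the standard basis of $\mathbb C^N$. The cone of a calibrated flat F-manifold is the (formal germ of the) graph $\mathcal C=\{p^\alpha_a=\mathcal F^{\alpha,a}\}\subset\mathcal H$. If $F^\alpha\in\mathbb C[[t^1,\ldots,t^N]]$, there is a unique calibration with $\bar c=0$ and $\Omega^{\alpha,d}_{\beta,0}|_{t^*=0}=0$ for all $d\ge 0$ (equivalently $\frac{\partial\mathcal F^{\alpha,a}}{\partial t^\beta_b}|_{t^*_*=0}=0$ for all $a,b\ge 0$); the corresponding cone is the ancestor cone of the flat F-manifold. Group action. $G_+$ is the group of $R(z)=\mathrm{Id}+\sum_{i\ge1}R_iz^i\in\mathrm{End}(\mathbb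 C^N)[[z]]$; it acts on ancestor cones by left multiplication, $R(z)\mathcal C=\{R(z)f\mid f\in\mathcal C\}$. This is well defined: with $\deg t^\beta_b=b-1$ ancestor potentials satisfy $\deg\mathcal F^{\alpha,a}\le-a-2$ (every monomial), so the infinite sums in $R(z)f$ make sense, they give an invertible change of the variables $q^\alpha_a$, and the resulting potentials can be re-expanded around $q=-A^\alpha\phi_\alpha z$ and define an ancestor cone again. *)

theory Defs
  imports "HOL-Analysis.Analysis" "HOL-Library.Multiset" "HOL-Library.Groups_Big_Fun"
begin

section \<open>Formal power series in arbitrarily many variables\<close>

text \<open>
  Formal power series over the complex numbers in variables indexed by \<^typ>\<open>'v\<close>
  (possibly infinitely many). A monomial is a finite multiset of variables, and every function from
  monomials to coefficients is a series.
\<close>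

typedef 'v mseries = "UNIV :: ('v multiset \<Rightarrow> complex) set"
  morphisms mcoeff Mseries ..

lemma mcoeff_Mseries [simp]: "mcoeff (Mseries f) = f"
  by (simp add: Mseries_inverse)

lemma mseries_eqI: "(\<And>m. mcoeff f m = mcoeff g m) \<Longrightarrow> f = g"
  by (metis ext mcoeff_inverse)

definition splits :: "'v multiset \<Rightarrow> ('v multiset \<times> 'v multiset) set" where
  "splits m = {(a, b). a + b = m}"

lemma finite_splits [simp]: "finite (splits m)"
proof (induction m)
  case empty
  have "splits {#} \<subseteq> {({#}, {#} :: 'a multiset)}" by (auto simp: splits_def)
  then show ?case by (rule finite_subset) simp
next
  case (add x m)
  let ?f = "\<lambda>(a, b). (add_mset x a, b)" and ?g = "\<lambda>(a, b). (a, add_mset x b)"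
  have "splits (add_mset x m) \<subseteq> ?f ` splits m \<union> ?g ` splits m"
  proof
    fix p assume "p \<in> splits (add_mset x m)"
    then obtain a b where p: "p = (a, b)" and ab: "a + b = add_mset x m"
      by (auto simp: splits_def)
    then consider "x \<in># a" | "x \<in># b"
      by (metis union_iff union_single_eq_member)
    then show "p \<in> ?f ` splits m \<union> ?g ` splits m"
    proof cases
      case 1
      then obtain a' where a': "a = add_mset x a'" by (meson multi_member_split)
      then have "(a', b) \<in> splits m" using ab by (simp add: splits_def)
      then show ?thesis using p a' by force
    next
      case 2
      then obtain b' where b': "b = add_mset x b'" by (meson multi_member_split)
      then have "(a, b') \<in> splits m" using ab by (simp add: splits_def)
      then show ?thesis using p b' by force
    qed
  qed
  then show ?case using add by (meson finite_UnI finite_imageI finite_subset)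
qed

instantiation mseries :: (type) comm_ring_1
begin

definition "0 = Mseries (\<lambda>_. 0)"
definition "1 = Mseries (\<lambda>m. if m = {#} then 1 else 0)"
definition "f + g = Mseries (\<lambda>m. mcoeff f m + mcoeff g m)"
definition "f - g = Mseries (\<lambda>m. mcoeff f m - mcoeff g m)"
definition "- f = Mseries (\<lambda>m. - mcoeff f m)"
definition "f * g = Mseries (\<lambda>m. \<Sum>(a, b)\<in>splits m. mcoeff f a * mcoeff g b)"

instance
proof
  fix f g h :: "'a mseries"
  show "f * g * h = f * (g * h)"
  proof (rule mseries_eqI)
    fix m
    have "mcoeff (f * g * h) m =
        (\<Sum>(p, c)\<in>splits m. \<Sum>(a, b)\<in>splits p. mcoeff f a * mcoeff g b * mcoeff h c)"
      by (simp add: times_mseries_def sum_distrib_right case_prod_unfold)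
    also have "\<dots> = (\<Sum>((p, c), (a, b))\<in>(SIGMA q:splits m. splits (fst q)).
        mcoeff f a * mcoeff g b * mcoeff h c)"
      by (subst sum.Sigma[symmetric]) (auto simp: case_prod_unfold)
    also have "\<dots> = (\<Sum>((a, p), (b, c))\<in>(SIGMA q:splits m. splits (snd q)).
        mcoeff f a * mcoeff g b * mcoeff h c)"
      by (rule sum.reindex_bij_witness[where
            i = "\<lambda>((a, p), (b, c)). ((a + b, c), (a, b))" and
            j = "\<lambda>((p, c), (a, b)). ((a, b + c), (b, c))"])
         (auto simp: splits_def ac_simps)
    also have "\<dots> =
        (\<Sum>(a, p)\<in>splits m. \<Sum>(b, c)\<in>splits p. mcoeff f a * (mcoeff g b * mcoeff h c))"
      by (subst sum.Sigma[symmetric]) (auto simp: case_prod_unfold mult.assoc)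
    also have "\<dots> = mcoeff (f * (g * h)) m"
      by (simp add: times_mseries_def sum_distrib_left case_prod_unfold)
    finally show "mcoeff (f * g * h) m = mcoeff (f * (g * h)) m" .
  qed
  show "f * g = g * f"
  proof (rule mseries_eqI)
    fix m
    show "mcoeff (f * g) m = mcoeff (g * f) m"
      unfolding times_mseries_def mcoeff_Mseries
      by (rule sum.reindex_bij_witness[where i = prod.swap and j = prod.swap])
         (auto simp: splits_def ac_simps)
  qed
  show "1 * f = f"
  proof (rule mseries_eqI)
    fix m
    have "mcoeff (1 * f) m = (\<Sum>(a, b)\<in>splits m. if a = {#} then mcoeff f b else 0)"
      unfolding times_mseries_def one_mseries_def mcoeff_Mseries
      by (rule sum.cong) auto
    also have "\<dots> = (\<Sum>(a, b)\<in>{({#} :: 'a multiset, m)}. if a = {#} then mcoeff f b else 0)"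
      by (rule sum.mono_neutral_right[OF finite_splits]) (auto simp: splits_def split: if_splits)
    finally show "mcoeff (1 * f) m = mcoeff f m" by simp
  qed
  show "(f + g) * h = f * h + g * h"
    by (rule mseries_eqI)
       (simp add: times_mseries_def plus_mseries_def distrib_right sum.distrib case_prod_unfold)
  show "(0::'a mseries) \<noteq> 1"
  proof
    assume "(0::'a mseries) = 1"
    then have "mcoeff (0::'a mseries) {#} = mcoeff 1 {#}" by (rule arg_cong)
    then show False by (simp add: zero_mseries_def one_mseries_def)
  qed
qed (rule mseries_eqI, simp add: plus_mseries_def minus_mseries_def uminus_mseries_def zero_mseries_def)+

end

definition mconst :: "complex \<Rightarrow> 'v mseries" where
  "mconst c = Mseries (\<lambda>m. if m = {#} then c else 0)"

definition mvar :: "'v \<Rightarrow> 'v mseries" where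
  "mvar x = Mseries (\<lambda>m. if m = {#x#} then 1 else 0)"

text \<open>Partial derivative with respect to the variable \<^term>\<open>x\<close>.\<close>

definition mderiv :: "'v \<Rightarrow> 'v mseries \<Rightarrow> 'v mseries" where
  "mderiv x f = Mseries (\<lambda>m. of_nat (count m x + 1) * mcoeff f (add_mset x m))"

text \<open>
  Sum of a family of series, coefficient by coefficient. It is meaningful when each monomial occurs
  in only finitely many members of the family; \<^const>\<open>Sum_any\<close> yields 0 otherwise.
\<close>

definition msum :: "('i \<Rightarrow> 'v mseries) \<Rightarrow> 'v mseries" where
  "msum g = Mseries (\<lambda>m. Sum_any (\<lambda>i. mcoeff (g i) m))"

text \<open>Substitution of \<^term>\<open>s x\<close> for each variable \<^term>\<open>x\<close> of \<^term>\<open>f\<close>.\<close>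

definition msubst :: "('u \<Rightarrow> 'v mseries) \<Rightarrow> 'u mseries \<Rightarrow> 'v mseries" where
  "msubst s f = msum (\<lambda>k. mconst (mcoeff f k) * (\<Prod>x\<in>#k. s x))"


section \<open>Flat F-manifolds around the origin\<close>

text \<open>
  The finite type \<^typ>\<open>'n\<close> is the range of the Greek indices, and an element of
  \<^typ>\<open>'n mseries\<close> is a power series in the flat coordinates at the origin.
  \<open>str_const F \<alpha> \<beta> \<gamma>\<close> is the structure constant with upper index \<open>\<alpha>\<close> and lower
  indices \<open>\<beta>\<close>, \<open>\<gamma>\<close>.
\<close>

definition str_const :: "('n \<Rightarrow> 'n mseries) \<Rightarrow> 'n \<Rightarrow> 'n \<Rightarrow> 'n \<Rightarrow> 'n mseries" where
  "str_const F \<alpha> \<beta> \<gamma> = mderiv \<beta> (mderiv \<gamma> (F \<alpha>))"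

definition flat_F_manifold :: "('n::finite \<Rightarrow> 'n mseries) \<Rightarrow> complex ^ 'n \<Rightarrow> bool" where
  "flat_F_manifold F A \<longleftrightarrow>
     (\<forall>\<alpha> \<beta>. (\<Sum>\<mu>\<in>UNIV. mconst (A $ \<mu>) * str_const F \<alpha> \<mu> \<beta>) = (if \<alpha> = \<beta> then 1 else 0)) \<and>
     (\<forall>\<alpha> \<beta> \<gamma> \<delta>. (\<Sum>\<mu>\<in>UNIV. str_const F \<alpha> \<beta> \<mu> * str_const F \<mu> \<gamma> \<delta>) =
                 (\<Sum>\<mu>\<in>UNIV. str_const F \<alpha> \<gamma> \<mu> * str_const F \<mu> \<beta> \<delta>))"

definition origin_mult ::
    "('n::finite \<Rightarrow> 'n mseries) \<Rightarrow> complex ^ 'n \<Rightarrow> complex ^ 'n \<Rightarrow> complex ^ 'n" where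
  "origin_mult F x y =
     (\<chi> \<alpha>. \<Sum>\<beta>\<in>UNIV. \<Sum>\<gamma>\<in>UNIV. mcoeff (str_const F \<alpha> \<beta> \<gamma>) {#} * x $ \<beta> * y $ \<gamma>)"

definition semisimple_at_origin :: "('n::finite \<Rightarrow> 'n mseries) \<Rightarrow> bool" where
  "semisimple_at_origin F \<longleftrightarrow>
     (\<exists>\<pi> :: 'n \<Rightarrow> complex ^ 'n.
        inj \<pi> \<and> vec.independent (range \<pi>) \<and> vec.span (range \<pi>) = UNIV \<and>
        (\<forall>k l. origin_mult F (\<pi> k) (\<pi> l) = (if k = l then \<pi> k else 0)))"

text \<open>
  A vector potential of the constant part: it is determined up to terms of degree at most one, which
  affect neither the structure constants nor anything built from them below.
\<close>

definition constant_part ::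
    "('n::finite \<Rightarrow> 'n mseries) \<Rightarrow> complex ^ 'n \<Rightarrow> ('n \<Rightarrow> 'n mseries) \<Rightarrow> bool" where
  "constant_part F A F0 \<longleftrightarrow>
     flat_F_manifold F0 A \<and>
     (\<forall>\<alpha> \<beta> \<gamma>. str_const F0 \<alpha> \<beta> \<gamma> = mconst (mcoeff (str_const F \<alpha> \<beta> \<gamma>) {#}))"


section \<open>Ancestor calibration and ancestor vector potentials\<close>

text \<open>
  \<open>\<Omega> d \<alpha> \<beta>\<close> stands for \<open>\<Omega>\<close> with upper indices \<open>\<alpha>\<close>, \<open>d\<close> and lower indices \<open>\<beta>\<close>, \<open>0\<close>. Only
  \<open>d \<ge> -1\<close> matters. The ancestor calibration is the one that vanishes at the origin for \<open>d \<ge> 0\<close>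
  and has \<open>c = 0\<close> in the relation between \<open>\<Omega> 0\<close> and the flat coordinates; hence no shift of
  variables by \<open>c\<close> occurs below.
\<close>

definition calibration ::
    "('n::finite \<Rightarrow> 'n mseries) \<Rightarrow> (int \<Rightarrow> 'n \<Rightarrow> 'n \<Rightarrow> 'n mseries) \<Rightarrow> bool" where
  "calibration F \<Omega> \<longleftrightarrow>
     (\<forall>\<alpha> \<beta>. \<Omega> (-1) \<alpha> \<beta> = (if \<alpha> = \<beta> then 1 else 0)) \<and>
     (\<forall>d\<ge>0. \<forall>\<alpha> \<beta> \<gamma>. mderiv \<gamma> (\<Omega> d \<alpha> \<beta>) = (\<Sum>\<mu>\<in>UNIV. str_const F \<mu> \<gamma> \<beta> * \<Omega> (d - 1) \<alpha> \<mu>))"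

definition ancestor_calibration ::
    "('n::finite \<Rightarrow> 'n mseries) \<Rightarrow> complex ^ 'n \<Rightarrow> (int \<Rightarrow> 'n \<Rightarrow> 'n \<Rightarrow> 'n mseries) \<Rightarrow> bool" where
  "ancestor_calibration F A \<Omega> \<longleftrightarrow>
     calibration F \<Omega> \<and>
     (\<forall>\<alpha>. (\<Sum>\<beta>\<in>UNIV. mconst (A $ \<beta>) * \<Omega> 0 \<alpha> \<beta>) = mvar \<alpha>) \<and>
     (\<forall>d\<ge>0. \<forall>\<alpha> \<beta>. mcoeff (\<Omega> d \<alpha> \<beta>) {#} = 0)"

text \<open>
  \<open>\<Theta> d \<alpha> \<beta>\<close> stands for \<open>\<Omega>\<close> with upper indices \<open>\<alpha>\<close>, \<open>0\<close> and lower indices \<open>\<beta>\<close>, \<open>d\<close>. The second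
  condition compares the coefficients of \<open>z ^ n\<close> in
  \<open>(\<Sum>i. (-1) ^ i * \<Theta> (i - 1) * z ^ i) * (\<Sum>j. \<Omega> (j - 1) * z ^ j) = Id\<close>.
\<close>

definition dual_calibration ::
    "(int \<Rightarrow> 'n::finite \<Rightarrow> 'n \<Rightarrow> 'n mseries) \<Rightarrow> (int \<Rightarrow> 'n \<Rightarrow> 'n \<Rightarrow> 'n mseries) \<Rightarrow> bool" where
  "dual_calibration \<Omega> \<Theta> \<longleftrightarrow>
     (\<forall>\<alpha> \<beta>. \<Theta> (-1) \<alpha> \<beta> = (if \<alpha> = \<beta> then 1 else 0)) \<and>
     (\<forall>n \<alpha> \<beta>. (\<Sum>i\<le>n. (-1) ^ i * (\<Sum>\<mu>\<in>UNIV. \<Theta> (int i - 1) \<alpha> \<mu> * \<Omega> (int (n - i) - 1) \<mu> \<beta>)) =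
              (if n = 0 \<and> \<alpha> = \<beta> then 1 else 0))"

text \<open>\<open>Omega2 \<Omega> \<Theta> p q \<alpha> \<beta>\<close>: upper indices \<open>\<alpha>\<close>, \<open>p\<close>, lower indices \<open>\<beta>\<close>, \<open>q\<close>.\<close>

definition Omega2 ::
    "(int \<Rightarrow> 'n::finite \<Rightarrow> 'n \<Rightarrow> 'n mseries) \<Rightarrow> (int \<Rightarrow> 'n \<Rightarrow> 'n \<Rightarrow> 'n mseries) \<Rightarrow>
     nat \<Rightarrow> nat \<Rightarrow> 'n \<Rightarrow> 'n \<Rightarrow> 'n mseries" where
  "Omega2 \<Omega> \<Theta> p q \<alpha> \<beta> =
     (\<Sum>i\<le>q. (-1) ^ (q - i) *
        (\<Sum>\<mu>\<in>UNIV. \<Omega> (int p + int q - int i) \<alpha> \<mu> * \<Theta> (int i - 1) \<mu> \<beta>))"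

text \<open>The variable \<open>(\<beta>, d)\<close> is \<open>t\<close> with upper index \<open>\<beta>\<close> and lower index \<open>d\<close>.\<close>

definition topological_solution ::
    "complex ^ 'n \<Rightarrow> (int \<Rightarrow> 'n::finite \<Rightarrow> 'n \<Rightarrow> 'n mseries) \<Rightarrow> (int \<Rightarrow> 'n \<Rightarrow> 'n \<Rightarrow> 'n mseries) \<Rightarrow>
     ('n \<Rightarrow> ('n \<times> nat) mseries) \<Rightarrow> bool" where
  "topological_solution A \<Omega> \<Theta> v \<longleftrightarrow>
     (\<forall>\<alpha> \<beta> d. mderiv (\<beta>, d) (v \<alpha>) =
        (\<Sum>\<gamma>\<in>UNIV. mconst (A $ \<gamma>) * mderiv (\<gamma>, 0) (msubst v (Omega2 \<Omega> \<Theta> 0 d \<alpha> \<beta>)))) \<and>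
     (\<forall>\<alpha> m. (\<forall>x\<in>#m. snd x = 0) \<longrightarrow> mcoeff (v \<alpha>) m = mcoeff (mvar (\<alpha>, 0)) m)"

definition descendant_potential ::
    "complex ^ 'n \<Rightarrow> (int \<Rightarrow> 'n::finite \<Rightarrow> 'n \<Rightarrow> 'n mseries) \<Rightarrow> (int \<Rightarrow> 'n \<Rightarrow> 'n \<Rightarrow> 'n mseries) \<Rightarrow>
     ('n \<Rightarrow> ('n \<times> nat) mseries) \<Rightarrow> nat \<Rightarrow> 'n \<Rightarrow> ('n \<times> nat) mseries" where
  "descendant_potential A \<Omega> \<Theta> v a \<alpha> =
     msum (\<lambda>b. \<Sum>\<beta>\<in>UNIV. msubst v (Omega2 \<Omega> \<Theta> a b \<alpha> \<beta>) *
                        (mvar (\<beta>, b) - mconst (if b = 1 then A $ \<beta> else 0)))"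

definition ancestor_potentials ::
    "('n::finite \<Rightarrow> 'n mseries) \<Rightarrow> complex ^ 'n \<Rightarrow> (nat \<Rightarrow> 'n \<Rightarrow> ('n \<times> nat) mseries) \<Rightarrow> bool" where
  "ancestor_potentials F A P \<longleftrightarrow>
     (\<exists>\<Omega> \<Theta> v. ancestor_calibration F A \<Omega> \<and> dual_calibration \<Omega> \<Theta> \<and>
        topological_solution A \<Omega> \<Theta> v \<and> P = descendant_potential A \<Omega> \<Theta> v)"


section \<open>Cones and the group action\<close>

text \<open>
  A formal germ of a subset of the space of series in \<open>z\<close>, infinite in both directions, is
  represented by its formal points: families of elements \<open>f\<close> (\<open>f k \<alpha>\<close> being the coefficient of \<open>\<phi>\<^sub>\<alpha> z ^ k\<close>) that depend on
  formal parameters. The parameters are again indexed by \<^typ>\<open>'n \<times> nat\<close>, so that the tautological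
  point, whose coordinates are the variables themselves, is among the formal points; the equality
  of two germs is then an equality of power series identities in the coordinates. The
  parameter \<open>(\<beta>, b)\<close> has degree \<open>b - 1\<close>.
\<close>

type_synonym 'n loop_point = "int \<Rightarrow> 'n \<Rightarrow> ('n \<times> nat) mseries"

definition mon_deg :: "('n \<times> nat) multiset \<Rightarrow> int" where
  "mon_deg m = (\<Sum>(\<beta>, b)\<in>#m. int b - 1)"

definition deg_le :: "('n \<times> nat) mseries \<Rightarrow> int \<Rightarrow> bool" where
  "deg_le f n \<longleftrightarrow> (\<forall>m. mcoeff f m \<noteq> 0 \<longrightarrow> mon_deg m \<le> n)"

definition q_coord :: "'n loop_point \<Rightarrow> nat \<Rightarrow> 'n \<Rightarrow> ('n \<times> nat) mseries" where
  "q_coord f d \<alpha> = f (int d) \<alpha>"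

definition p_coord :: "'n loop_point \<Rightarrow> nat \<Rightarrow> 'n \<Rightarrow> ('n \<times> nat) mseries" where
  "p_coord f d \<alpha> = (-1) ^ (d + 1) * f (- int d - 1) \<alpha>"

definition t_coord :: "complex ^ 'n \<Rightarrow> 'n loop_point \<Rightarrow> 'n \<times> nat \<Rightarrow> ('n \<times> nat) mseries" where
  "t_coord A f = (\<lambda>(\<beta>, b). q_coord f b \<beta> + mconst (if b = 1 then A $ \<beta> else 0))"

text \<open>
  The formal points near \<open>q = - A z\<close>. The degree bounds hold for the tautological point, and they
  are what makes it possible to substitute the point into potentials \<open>P a \<alpha>\<close> of degree at most
  \<open>- a - 2\<close> and to apply \<open>R(z)\<close> to it. No condition is put on the constant terms of the coordinates
  with \<open>b \<ge> 2\<close>: \<open>R(z)\<close> moves the base point in these directions. For \<open>b = 0\<close> the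
  constant terms vanish by the degree bound.
\<close>

definition near_base :: "complex ^ 'n \<Rightarrow> 'n loop_point \<Rightarrow> bool" where
  "near_base A f \<longleftrightarrow>
     (\<forall>\<beta> b. deg_le (t_coord A f (\<beta>, b)) (int b - 1)) \<and>
     (\<forall>\<beta>. mcoeff (t_coord A f (\<beta>, 1)) {#} = 0)"

definition graph_cone ::
    "complex ^ 'n \<Rightarrow> (nat \<Rightarrow> 'n \<Rightarrow> ('n \<times> nat) mseries) \<Rightarrow> 'n loop_point set" where
  "graph_cone A P =
     {f. near_base A f \<and> (\<forall>a \<alpha>. p_coord f a \<alpha> = msubst (t_coord A f) (P a \<alpha>))}"

definition ancestor_cone ::
    "('n::finite \<Rightarrow> 'n mseries) \<Rightarrow> complex ^ 'n \<Rightarrow> 'n loop_point set \<Rightarrow> bool" where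
  "ancestor_cone F A C \<longleftrightarrow> (\<exists>P. ancestor_potentials F A P \<and> C = graph_cone A P)"

text \<open>\<open>R i\<close> is the coefficient of \<open>z ^ i\<close> in \<open>R(z)\<close>.\<close>

definition G_plus :: "(nat \<Rightarrow> complex ^ 'n ^ 'n) set" where
  "G_plus = {R. R 0 = mat 1}"

definition loop_act :: "(nat \<Rightarrow> complex ^ 'n ^ 'n) \<Rightarrow> 'n::finite loop_point \<Rightarrow> 'n loop_point" where
  "loop_act R f k \<alpha> = msum (\<lambda>i. \<Sum>\<mu>\<in>UNIV. mconst (R i $ \<alpha> $ \<mu>) * f (k - int i) \<mu>)"

end

theory Submission
  imports Defs
begin

text \<open>
  The ancestor cone of a flat F-manifold is ruled. Let \<open>\<Theta>\<^sub>V(1/z)\<close> be the dual calibration, a power series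
  in \<open>1/z\<close>, evaluated at a formal point \<open>V\<close> of the manifold. Then a point \<open>f\<close> of the loop space lies on the
  cone exactly if \<open>\<Theta>\<^sub>V(1/z) f\<close> is a power series in \<open>z\<close> without constant term for some \<open>V\<close> (lemma
  \<open>cone_iff\<close>). Necessarily \<open>V\<close> is the value at \<open>f\<close> of the topological solution: the constant term of
  \<open>\<Theta>\<^sub>V(1/z) f\<close> is the left-hand side of the genus-zero Euler--Lagrange equation, which the topological
  solution satisfies (lemma \<open>topological_EL\<close>) and which determines \<open>V\<close> by a contraction argument. The
  vanishing of the coefficients at negative powers is the formula for the potentials.

  The matrix \<open>\<Theta>\<^sub>V(1/z)\<close> solves the linear system \<open>z \<partial>\<^sub>\<gamma> S = C\<^sub>\<gamma> S\<close> of the flat connection, where \<open>C\<^sub>\<gamma>\<close> are the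
  matrices of structure constants. Semisimplicity provides a second kind of solution. In the basis of
  idempotents at the origin the \<open>C\<^sub>\<gamma>\<close> become a closed commuting family that is diagonal at the origin, and
  to each idempotent there belongs a formal solution \<open>exp (u/z) (r\<^sub>0 + r\<^sub>1 z + \<dots>)\<close>, constructed order by order
  (\<open>formal_asymptotic_solution\<close>). The functions \<open>u\<close> are canonical coordinates, and the vectors form a matrix
  \<open>R\<^sub>V(z)\<close> that intertwines the connection of \<open>F\<close> in flat coordinates with that of its constant part in
  canonical coordinates (lemma \<open>canonical_frame\<close>).

  Let \<open>R(z)\<close> be the value of \<open>R\<^sub>V(z)\<close> at the origin, which belongs to \<open>G_plus\<close>. Then
  \<open>\<Theta>\<^sub>V(1/z) R(z) = R\<^sub>V(z) \<Theta>\<^sup>0\<^sub>U(1/z)\<close>, where \<open>\<Theta>\<^sup>0\<close> belongs to the constant part and \<open>U\<close> is the point \<open>V\<close> in canonical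
  coordinates, because both sides solve the same system and agree at the origin (lemma
  \<open>frame_comparison\<close>). Multiplication by \<open>R\<^sub>V(z)\<close> preserves and reflects the vanishing of the coefficients at
  nonpositive powers of \<open>z\<close>. So \<open>f\<close> satisfies the criterion for the constant cone with \<open>U\<close> if and only if
  \<open>R(z) f\<close> satisfies the criterion for the cone of \<open>F\<close> with \<open>V\<close>. Since \<open>U\<close> is tangent to the identity as a
  function of \<open>V\<close>, each of the two points determines the other, and the theorem follows.

  All infinite sums are locally finite. In one direction this is due to the order of vanishing of the
  calibration, in the other to the bounds on the degree of the coordinates of formal points.
\<close>

section \<open>Coefficients, order and derivatives of power series\<close>

lemma mcoeff_0 [simp]: "mcoeff 0 m = 0"
  and mcoeff_add [simp]: "mcoeff (f + g) m = mcoeff f m + mcoeff g m"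
  and mcoeff_diff [simp]: "mcoeff (f - g) m = mcoeff f m - mcoeff g m"
  and mcoeff_uminus [simp]: "mcoeff (- f) m = - mcoeff f m"
  by (simp_all add: zero_mseries_def plus_mseries_def minus_mseries_def uminus_mseries_def)

lemma mcoeff_1: "mcoeff 1 m = (if m = {#} then 1 else 0)"
  by (simp add: one_mseries_def)

lemma mcoeff_mult: "mcoeff (f * g) m = (\<Sum>(a, b)\<in>splits m. mcoeff f a * mcoeff g b)"
  by (simp add: times_mseries_def)

lemma mcoeff_mconst: "mcoeff (mconst c) m = (if m = {#} then c else 0)"
  by (simp add: mconst_def)

lemma mcoeff_mvar: "mcoeff (mvar x) m = (if m = {#x#} then 1 else 0)"
  by (simp add: mvar_def)

lemma mcoeff_mderiv: "mcoeff (mderiv x f) m = of_nat (count m x + 1) * mcoeff f (add_mset x m)"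
  by (simp add: mderiv_def)

lemma mcoeff_sum [simp]: "mcoeff (sum f S) m = (\<Sum>i\<in>S. mcoeff (f i) m)"
  by (induction S rule: infinite_finite_induct) auto

lemma splits_empty [simp]: "splits {#} = {({#}, {#})}"
  by (auto simp: splits_def)

lemma mcoeff_mult_empty [simp]: "mcoeff (f * g) {#} = mcoeff f {#} * mcoeff g {#}"
  by (simp add: mcoeff_mult)

lemma mcoeff_mult_nonzeroE:
  assumes "mcoeff (f * g) m \<noteq> 0"
  obtains a b where "m = a + b" "mcoeff f a \<noteq> 0" "mcoeff g b \<noteq> 0"
proof -
  obtain p where "p \<in> splits m" "(case p of (a, b) \<Rightarrow> mcoeff f a * mcoeff g b) \<noteq> 0"
    using assms unfolding mcoeff_mult by (meson sum.not_neutral_contains_not_neutral)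
  then show thesis using that by (cases p) (auto simp: splits_def)
qed

lemma mcoeff_mconst_mult [simp]: "mcoeff (mconst c * f) m = c * mcoeff f m"
proof -
  have "mcoeff (mconst c * f) m = (\<Sum>(a, b)\<in>splits m. if a = {#} then c * mcoeff f b else 0)"
    unfolding mcoeff_mult by (rule sum.cong) (auto simp: mcoeff_mconst)
  also have "\<dots> = (\<Sum>(a, b)\<in>{({#} :: 'a multiset, m)}. if a = {#} then c * mcoeff f b else 0)"
    by (rule sum.mono_neutral_right[OF finite_splits]) (auto simp: splits_def split: if_splits)
  finally show ?thesis by simp
qed

lemma mcoeff_mult_mvar:
  "mcoeff (f * mvar x) m = (if x \<in># m then mcoeff f (m - {#x#}) else 0)"
proof -
  have "mcoeff (f * mvar x) m = (\<Sum>(a, b)\<in>splits m. if b = {#x#} then mcoeff f a else 0)"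
    unfolding mcoeff_mult by (rule sum.cong) (auto simp: mcoeff_mvar)
  also have "\<dots> = (\<Sum>(a, b)\<in>(if x \<in># m then {(m - {#x#}, {#x#})} else {}).
      if b = {#x#} then mcoeff f a else 0)"
    by (rule sum.mono_neutral_right[OF finite_splits])
      (auto simp: splits_def split: if_splits)
  finally show ?thesis by simp
qed

lemma mconst_0 [simp]: "mconst 0 = 0"
  and mconst_1 [simp]: "mconst 1 = 1"
  and mconst_add: "mconst (a + b) = mconst a + mconst b"
  and mconst_uminus: "mconst (- a) = - mconst a"
  and mconst_diff: "mconst (a - b) = mconst a - mconst b"
  and mconst_mult: "mconst (a * b) = mconst a * mconst b"
  by (rule mseries_eqI; simp add: mcoeff_mconst mcoeff_1)+

lemma mconst_sum: "mconst (sum f S) = (\<Sum>i\<in>S. mconst (f i))"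
  by (induction S rule: infinite_finite_induct) (auto simp: mconst_add)

definition ord_ge :: "'v mseries \<Rightarrow> nat \<Rightarrow> bool" where
  "ord_ge f r \<longleftrightarrow> (\<forall>m. mcoeff f m \<noteq> 0 \<longrightarrow> r \<le> size m)"

lemma ord_geD: "ord_ge f r \<Longrightarrow> size m < r \<Longrightarrow> mcoeff f m = 0"
  by (auto simp: ord_ge_def)

lemma ord_ge_0 [simp]: "ord_ge f 0"
  and ord_ge_zero [simp]: "ord_ge 0 r"
  by (simp_all add: ord_ge_def)

lemma ord_ge_mono: "ord_ge f r \<Longrightarrow> s \<le> r \<Longrightarrow> ord_ge f s"
  by (force simp: ord_ge_def)

lemma ord_ge_add: "ord_ge f r \<Longrightarrow> ord_ge g r \<Longrightarrow> ord_ge (f + g) r"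
  and ord_ge_diff: "ord_ge f r \<Longrightarrow> ord_ge g r \<Longrightarrow> ord_ge (f - g) r"
  and ord_ge_uminus [simp]: "ord_ge (- f) r = ord_ge f r"
  by (auto simp: ord_ge_def) (metis add.right_neutral diff_zero)+

lemma ord_ge_sum: "(\<And>i. i \<in> S \<Longrightarrow> ord_ge (f i) r) \<Longrightarrow> ord_ge (sum f S) r"
  by (induction S rule: infinite_finite_induct) (auto intro: ord_ge_add)

lemma ord_ge_mult:
  assumes "ord_ge f r" "ord_ge g s"
  shows "ord_ge (f * g) (r + s)"
  unfolding ord_ge_def
proof safe
  fix m assume "mcoeff (f * g) m \<noteq> 0"
  then obtain a b where "m = a + b" "mcoeff f a \<noteq> 0" "mcoeff g b \<noteq> 0"
    by (rule mcoeff_mult_nonzeroE)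
  then show "r + s \<le> size m" using assms by (force simp: ord_ge_def)
qed

lemma ord_ge_mult1: "ord_ge f r \<Longrightarrow> ord_ge (f * g) r"
  and ord_ge_mult2: "ord_ge g r \<Longrightarrow> ord_ge (f * g) r"
  using ord_ge_mult[of f r g 0] ord_ge_mult[of f 0 g r] by auto

lemma ord_ge_1_iff: "ord_ge f 1 \<longleftrightarrow> mcoeff f {#} = 0"
  unfolding ord_ge_def by (metis One_nat_def Suc_leI not_one_le_zero nonempty_has_size size_empty)

lemma ord_ge_all_eq_0: "(\<And>r. ord_ge f r) \<Longrightarrow> f = 0"
  by (rule mseries_eqI) (metis lessI mcoeff_0 ord_geD)

lemma ord_ge_Suc_iff_mderiv:
  "ord_ge f (Suc r) \<longleftrightarrow> mcoeff f {#} = 0 \<and> (\<forall>x. ord_ge (mderiv x f) r)"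
proof safe
  assume f: "ord_ge f (Suc r)"
  show "mcoeff f {#} = 0" using ord_geD[OF f, of "{#}"] by simp
  show "ord_ge (mderiv x f) r" for x
    using f by (fastforce simp: ord_ge_def mcoeff_mderiv)
next
  assume *: "mcoeff f {#} = 0" "\<forall>x. ord_ge (mderiv x f) r"
  show "ord_ge f (Suc r)"
    unfolding ord_ge_def
  proof safe
    fix m assume m: "mcoeff f m \<noteq> 0"
    with *(1) obtain x k where "m = add_mset x k" by (cases m) auto
    then show "Suc r \<le> size m" using *(2) m
      by (auto simp: ord_ge_def mcoeff_mderiv simp del: of_nat_Suc)
  qed
qed

lemma mderiv_0 [simp]: "mderiv x 0 = 0"
  and mderiv_1 [simp]: "mderiv x 1 = 0"
  and mderiv_mconst [simp]: "mderiv x (mconst c) = 0"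
  and mderiv_add: "mderiv x (f + g) = mderiv x f + mderiv x g"
  and mderiv_diff: "mderiv x (f - g) = mderiv x f - mderiv x g"
  and mderiv_uminus: "mderiv x (- f) = - mderiv x f"
  by (rule mseries_eqI; simp add: mcoeff_mderiv mcoeff_1 mcoeff_mconst algebra_simps)+

lemma mderiv_sum: "mderiv x (sum f S) = (\<Sum>i\<in>S. mderiv x (f i))"
  by (induction S rule: infinite_finite_induct) (auto simp: mderiv_add)

lemma mderiv_mvar: "mderiv x (mvar y) = (if x = y then 1 else 0)"
  by (rule mseries_eqI) (auto simp: mcoeff_mderiv mcoeff_mvar mcoeff_1)

lemma mderiv_commute: "mderiv x (mderiv y f) = mderiv y (mderiv x f)"
  by (rule mseries_eqI) (simp add: mcoeff_mderiv add_mset_commute)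

lemma mderiv_mult: "mderiv x (f * g) = mderiv x f * g + f * mderiv x g"
proof (rule mseries_eqI)
  fix m
  have count: "count (fst p) x + count (snd p) x = count m x + 1" if "p \<in> splits (add_mset x m)" for p
  proof -
    have "count (fst p + snd p) x = count (add_mset x m) x"
      using that unfolding splits_def by (metis (mono_tags) case_prodD mem_Collect_eq prod.collapse)
    then show ?thesis by simp
  qed
  let ?S = "splits (add_mset x m)"
  have 1: "(\<Sum>p\<in>?S. of_nat (count (fst p) x) * (mcoeff f (fst p) * mcoeff g (snd p)))
      = (\<Sum>p\<in>splits m. of_nat (count (fst p) x + 1) * (mcoeff f (add_mset x (fst p)) * mcoeff g (snd p)))"
    (is "?L = ?R")
  proof -
    have "?L = (\<Sum>p\<in>{p\<in>?S. x \<in># fst p}. of_nat (count (fst p) x) * (mcoeff f (fst p) * mcoeff g (snd p)))"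
      by (rule sum.mono_neutral_right) (auto simp: not_in_iff)
    also have "\<dots> = ?R"
      by (rule sum.reindex_bij_witness[where i = "\<lambda>(a, b). (add_mset x a, b)"
            and j = "\<lambda>(a, b). (a - {#x#}, b)"])
        (auto simp: splits_def dest!: multi_member_split)
    finally show ?thesis .
  qed
  have 2: "(\<Sum>p\<in>?S. of_nat (count (snd p) x) * (mcoeff f (fst p) * mcoeff g (snd p)))
      = (\<Sum>p\<in>splits m. of_nat (count (snd p) x + 1) * (mcoeff f (fst p) * mcoeff g (add_mset x (snd p))))"
    (is "?L = ?R")
  proof -
    have "?L = (\<Sum>p\<in>{p\<in>?S. x \<in># snd p}. of_nat (count (snd p) x) * (mcoeff f (fst p) * mcoeff g (snd p)))"
      by (rule sum.mono_neutral_right) (auto simp: not_in_iff)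
    also have "\<dots> = ?R"
      by (rule sum.reindex_bij_witness[where i = "\<lambda>(a, b). (a, add_mset x b)"
            and j = "\<lambda>(a, b). (a, b - {#x#})"])
        (auto simp: splits_def dest!: multi_member_split)
    finally show ?thesis .
  qed
  have "mcoeff (mderiv x (f * g)) m
      = (\<Sum>p\<in>?S. of_nat (count m x + 1) * (mcoeff f (fst p) * mcoeff g (snd p)))"
    by (simp add: mcoeff_mderiv mcoeff_mult sum_distrib_left case_prod_unfold del: of_nat_Suc of_nat_add)
  also have "\<dots> = (\<Sum>p\<in>?S. of_nat (count (fst p) x) * (mcoeff f (fst p) * mcoeff g (snd p))
      + of_nat (count (snd p) x) * (mcoeff f (fst p) * mcoeff g (snd p)))"
    by (rule sum.cong[OF refl]) (simp only: count[symmetric] of_nat_add distrib_right)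
  also have "\<dots> = mcoeff (mderiv x f * g + f * mderiv x g) m"
    unfolding sum.distrib 1 2
    unfolding mcoeff_add mcoeff_mult mcoeff_mderiv case_prod_unfold
    by (intro arg_cong2[where f = "(+)"] sum.cong refl) (simp_all only: mult.assoc mult.left_commute)
  finally show "mcoeff (mderiv x (f * g)) m = mcoeff (mderiv x f * g + f * mderiv x g) m" .
qed

lemma mderiv_mconst_mult: "mderiv x (mconst c * f) = mconst c * mderiv x f"
  by (simp add: mderiv_mult)

text \<open>The coefficient at a nonempty monomial may be read off along any variable that occurs in it;
  closedness of the form makes the answer independent of that variable.\<close>

lemma formal_poincare:
  assumes "\<And>x y. mderiv x (w y) = mderiv y (w x)"
  obtains a where "mcoeff a {#} = 0" "\<And>x. mderiv x a = w x"
proof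
  define pick where "pick m = (SOME x. x \<in># m)" for m :: "'a multiset"
  define a where "a = Mseries (\<lambda>m. if m = {#} then 0
    else mcoeff (w (pick m)) (m - {#pick m#}) / of_nat (count m (pick m)))"
  show "mcoeff a {#} = 0" by (simp add: a_def)
  show "mderiv x a = w x" for x
  proof (rule mseries_eqI)
    fix m
    let ?M = "add_mset x m"
    define y where "y = pick ?M"
    have y: "y \<in># ?M" unfolding y_def pick_def by (rule someI[of _ x]) simp
    then have nz: "of_nat (count ?M y) \<noteq> (0 :: complex)" by (auto simp del: count_add_mset)
    have a: "mcoeff a ?M = mcoeff (w y) (?M - {#y#}) / of_nat (count ?M y)"
      by (simp add: a_def y_def)
    show "mcoeff (mderiv x a) m = mcoeff (w x) m"
    proof (cases "y = x")
      case True
      then show ?thesis using nz a by (simp add: mcoeff_mderiv del: of_nat_Suc)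
    next
      case False
      then obtain k where k: "m = add_mset y k" using y by (auto dest: multi_member_split)
      have "mcoeff (mderiv y (w x)) k = mcoeff (mderiv x (w y)) k" using assms by simp
      then have "of_nat (Suc (count k y)) * mcoeff (w x) m
          = of_nat (Suc (count k y)) * (of_nat (Suc (count m x)) * mcoeff a ?M)"
        using nz a False unfolding k
        by (simp add: mcoeff_mderiv field_simps add_mset_commute del: of_nat_Suc)
      then show ?thesis by (simp add: mcoeff_mderiv del: of_nat_Suc)
    qed
  qed
qed


section \<open>Fixed points of contractions\<close>

text \<open>The iterates of \<open>0\<close> agree with each other to growing order, so that every coefficient
  stabilises. A restriction on the monomials that the map preserves holds for all iterates and
  therefore for the limit.\<close>

lemma contraction_fixpoint:
  fixes T :: "('i \<Rightarrow> 'v mseries) \<Rightarrow> 'i \<Rightarrow> 'v mseries"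
  defines "S \<equiv> \<lambda>Q. {f. \<forall>i m. mcoeff (f i) m \<noteq> 0 \<longrightarrow> Q m}"
  assumes pres: "\<And>f. f \<in> S Q \<Longrightarrow> T f \<in> S Q"
    and contr: "\<And>f g n. f \<in> S Q \<Longrightarrow> g \<in> S Q \<Longrightarrow> (\<And>i. ord_ge (f i - g i) n)
      \<Longrightarrow> (\<And>i. ord_ge (T f i - T g i) (Suc n))"
  obtains f where "\<And>i m. mcoeff (f i) m \<noteq> 0 \<Longrightarrow> Q m" "T f = f"
proof -
  define X where "X n = (T ^^ n) (\<lambda>_. 0)" for n
  have X_Suc: "X (Suc n) = T (X n)" for n by (simp add: X_def)
  have X: "X n \<in> S Q" for n
  proof (induction n)
    case 0 then show ?case by (simp add: X_def S_def)
  next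
    case (Suc n) then show ?case using pres by (simp add: X_Suc)
  qed
  have step: "ord_ge (X (Suc n) i - X n i) n" for n i
  proof (induction n arbitrary: i)
    case (Suc n)
    show ?case unfolding X_Suc[of "Suc n"] X_Suc[of n] using Suc
      by (intro contr[OF _ X]) (auto simp: X_Suc[symmetric] X)
  qed simp
  have far: "ord_ge (X (n + k) i - X n i) n" for n k i
  proof (induction k)
    case (Suc k)
    have "ord_ge ((X (Suc (n + k)) i - X (n + k) i) + (X (n + k) i - X n i)) n"
      by (rule ord_ge_add[OF ord_ge_mono[OF step] Suc]) simp
    then show ?case by simp
  qed simp
  define x where "x i = Mseries (\<lambda>m. mcoeff (X (Suc (size m)) i) m)" for i
  have x: "ord_ge (x i - X n i) n" for i n
    unfolding ord_ge_def
  proof safe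
    fix m assume *: "mcoeff (x i - X n i) m \<noteq> 0"
    show "n \<le> size m"
    proof (rule ccontr)
      assume "\<not> n \<le> size m"
      then obtain k where k: "n = Suc (size m) + k" by (metis less_eq_Suc_le le_Suc_ex not_le)
      show False using ord_geD[OF far, of m "Suc (size m)" k i] * unfolding k by (simp add: x_def)
    qed
  qed
  have xS: "x \<in> S Q" using X by (auto simp: S_def x_def)
  have "T x i = x i" for i
  proof -
    have "ord_ge (T x i - x i) n" for n
    proof -
      have "ord_ge ((T x i - T (X n) i) + (X (Suc n) i - X n i) - (x i - X n i)) n"
        by (intro ord_ge_add ord_ge_diff x step ord_ge_mono[OF contr[OF xS X x]]) simp
      then show ?thesis by (simp add: X_Suc)
    qed
    then show ?thesis using ord_ge_all_eq_0 by (metis eq_iff_diff_eq_0)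
  qed
  then have "T x = x" by blast
  with xS show thesis using that unfolding S_def by blast
qed

lemma contraction_unique:
  assumes contr: "\<And>n i. (\<And>i. ord_ge (f i - g i) n) \<Longrightarrow> ord_ge (T f i - T g i) (Suc n)"
    and "T f = f" "T g = g"
  shows "f = g"
proof
  fix i
  have "ord_ge (f i - g i) n" for n i
  proof (induction n arbitrary: i)
    case (Suc n) then show ?case using contr assms(2,3) by metis
  qed simp
  then show "f i = g i" using ord_ge_all_eq_0 by (metis eq_iff_diff_eq_0)
qed


section \<open>Locally finite sums of power series\<close>

text \<open>The condition under which \<^const>\<open>msum\<close> adds up finitely many numbers in each coefficient.\<close>

definition lfin :: "('i \<Rightarrow> 'v mseries) \<Rightarrow> bool" where
  "lfin g \<longleftrightarrow> (\<forall>m. finite {i. mcoeff (g i) m \<noteq> 0})"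

lemma lfinD: "lfin g \<Longrightarrow> finite {i. mcoeff (g i) m \<noteq> 0}"
  by (simp add: lfin_def)

lemma lfin_comp_inj:
  assumes "lfin g" "inj h"
  shows "lfin (\<lambda>i. g (h i))"
  unfolding lfin_def
proof
  fix m
  have "{i. mcoeff (g (h i)) m \<noteq> 0} = h -` {i. mcoeff (g i) m \<noteq> 0}" by auto
  then show "finite {i. mcoeff (g (h i)) m \<noteq> 0}"
    using finite_vimageI[OF lfinD[OF assms(1)] assms(2)] by simp
qed

lemma lfin_finite_support: "finite {i. g i \<noteq> 0} \<Longrightarrow> lfin g"
  unfolding lfin_def by (metis (mono_tags, lifting) finite_subset mem_Collect_eq mcoeff_0 subsetI)

lemma lfin_zero [simp]: "lfin (\<lambda>_. 0)"
  by (simp add: lfin_def)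

lemma lfin_finite_type [simp]: "lfin (g :: 'i::finite \<Rightarrow> _)"
  by (simp add: lfin_def)

lemma lfin_add: "lfin f \<Longrightarrow> lfin g \<Longrightarrow> lfin (\<lambda>i. f i + g i)"
  unfolding lfin_def
proof
  fix m assume *: "\<forall>m. finite {i. mcoeff (f i) m \<noteq> 0}" "\<forall>m. finite {i. mcoeff (g i) m \<noteq> 0}"
  then have "finite ({i. mcoeff (f i) m \<noteq> 0} \<union> {i. mcoeff (g i) m \<noteq> 0})" by auto
  then show "finite {i. mcoeff (f i + g i) m \<noteq> 0}" by (rule rev_finite_subset) auto
qed

lemma lfin_uminus [simp]: "lfin (\<lambda>i. - g i) = lfin g"
  by (simp add: lfin_def)

lemma lfin_diff: "lfin f \<Longrightarrow> lfin g \<Longrightarrow> lfin (\<lambda>i. f i - g i)"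
  using lfin_add[of f "\<lambda>i. - g i"] by simp

lemma lfin_sum: "(\<And>j. j \<in> S \<Longrightarrow> lfin (g j)) \<Longrightarrow> lfin (\<lambda>i. \<Sum>j\<in>S. g j i)"
  by (induction S rule: infinite_finite_induct) (auto intro: lfin_add)

lemma lfin_product:
  assumes "lfin f" "lfin g"
  shows "lfin (\<lambda>(i, j). f i * g j)"
  unfolding lfin_def
proof
  fix m
  let ?F = "\<Union>(a, b)\<in>splits m. {i. mcoeff (f i) a \<noteq> 0} \<times> {j. mcoeff (g j) b \<noteq> 0}"
  have "finite ?F"
    using assms by (intro finite_UN_I) (auto simp: lfin_def)
  moreover have "{p. mcoeff (case p of (i, j) \<Rightarrow> f i * g j) m \<noteq> 0} \<subseteq> ?F"
    by (auto elim!: mcoeff_mult_nonzeroE simp: splits_def)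
  ultimately show "finite {p. mcoeff (case p of (i, j) \<Rightarrow> f i * g j) m \<noteq> 0}"
    by (rule rev_finite_subset)
qed

lemma lfin_mult_left: "lfin g \<Longrightarrow> lfin (\<lambda>i. f * g i)"
  using lfin_comp_inj[OF lfin_product[of "\<lambda>_::unit. f" g], of "\<lambda>i. ((), i)"]
  by (simp add: inj_def)

lemma lfin_mult_right: "lfin g \<Longrightarrow> lfin (\<lambda>i. g i * f)"
  using lfin_mult_left[of g f] by (simp add: mult.commute)

text \<open>The usual reason for local finiteness: orders that tend to infinity.\<close>

lemma lfin_ord:
  assumes "\<And>i. ord_ge (g i) (r i)" "\<And>n. finite {i. r i \<le> n}"
  shows "lfin g"
  unfolding lfin_def
proof
  fix m
  show "finite {i. mcoeff (g i) m \<noteq> 0}"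
    by (rule finite_subset[OF _ assms(2)[of "size m"]]) (use assms(1) in \<open>auto simp: ord_ge_def\<close>)
qed

lemma lfin_ord_nat:
  assumes "\<And>i. ord_ge (g i) i" shows "lfin g"
  using assms by (rule lfin_ord) simp

lemma mcoeff_msum: "mcoeff (msum g) m = Sum_any (\<lambda>i. mcoeff (g i) m)"
  by (simp add: msum_def)

lemma mcoeff_msum_superset:
  assumes "finite A" "\<And>i. i \<notin> A \<Longrightarrow> mcoeff (g i) m = 0"
  shows "mcoeff (msum g) m = (\<Sum>i\<in>A. mcoeff (g i) m)"
  unfolding mcoeff_msum by (rule Sum_any.expand_superset) (use assms in auto)

lemma mcoeff_msum_nonzeroE:
  assumes "mcoeff (msum g) m \<noteq> 0"
  obtains i where "mcoeff (g i) m \<noteq> 0"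
  using assms unfolding mcoeff_msum by (metis Sum_any.not_neutral_obtains_not_neutral)

lemma ord_ge_msum: "(\<And>i. ord_ge (g i) r) \<Longrightarrow> ord_ge (msum g) r"
  unfolding ord_ge_def by (metis mcoeff_msum_nonzeroE)

lemma msum_finite:
  assumes "finite A" "\<And>i. i \<notin> A \<Longrightarrow> g i = 0"
  shows "msum g = sum g A"
  by (rule mseries_eqI) (simp add: mcoeff_msum_superset assms)

lemma msum_zero [simp]: "msum (\<lambda>_. 0) = 0"
  by (subst msum_finite[of "{}"]) auto

lemma msum_add: "lfin f \<Longrightarrow> lfin g \<Longrightarrow> msum (\<lambda>i. f i + g i) = msum f + msum g"
  by (rule mseries_eqI) (simp add: mcoeff_msum Sum_any.distrib lfinD)

lemma msum_uminus: "lfin g \<Longrightarrow> msum (\<lambda>i. - g i) = - msum g"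
  using msum_add[of g "\<lambda>i. - g i"] by (simp add: eq_neg_iff_add_eq_0 add.commute)

lemma msum_diff: "lfin f \<Longrightarrow> lfin g \<Longrightarrow> msum (\<lambda>i. f i - g i) = msum f - msum g"
  using msum_add[of f "\<lambda>i. - g i"] by (simp add: msum_uminus)

lemma msum_sum: "(\<And>j. j \<in> S \<Longrightarrow> lfin (g j)) \<Longrightarrow> msum (\<lambda>i. \<Sum>j\<in>S. g j i) = (\<Sum>j\<in>S. msum (g j))"
  by (induction S rule: infinite_finite_induct) (auto simp: msum_add lfin_sum)

lemma msum_mult_left:
  assumes "lfin g" shows "msum (\<lambda>i. f * g i) = f * msum g"
proof (rule mseries_eqI)
  fix m
  let ?I = "\<Union>(a, b)\<in>splits m. {i. mcoeff (g i) b \<noteq> 0}"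
  have fin: "finite ?I" using assms by (intro finite_UN_I) (auto simp: lfin_def)
  have I: "mcoeff (g i) (snd p) = 0" if "p \<in> splits m" "i \<notin> ?I" for i p
    using that by (cases p) auto
  have "mcoeff (msum (\<lambda>i. f * g i)) m = (\<Sum>i\<in>?I. mcoeff (f * g i) m)"
    by (rule mcoeff_msum_superset[OF fin]) (auto simp: mcoeff_mult intro!: sum.neutral)
  also have "\<dots> = (\<Sum>p\<in>splits m. \<Sum>i\<in>?I. mcoeff f (fst p) * mcoeff (g i) (snd p))"
    unfolding mcoeff_mult case_prod_unfold by (rule sum.swap)
  also have "\<dots> = mcoeff (f * msum g) m"
  proof -
    have "mcoeff (msum g) (snd p) = (\<Sum>i\<in>?I. mcoeff (g i) (snd p))" if "p \<in> splits m" for p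
      by (rule mcoeff_msum_superset[OF fin I[OF that]])
    then show ?thesis
      by (simp add: mcoeff_mult case_prod_unfold sum_distrib_left)
  qed
  finally show "mcoeff (msum (\<lambda>i. f * g i)) m = mcoeff (f * msum g) m" .
qed

lemma msum_mult_right: "lfin g \<Longrightarrow> msum (\<lambda>i. g i * f) = msum g * f"
  using msum_mult_left[of g f] by (simp add: mult.commute)

lemma msum_Fubini:
  assumes "lfin (\<lambda>(i, j). g i j)"
  shows "msum (\<lambda>i. msum (g i)) = msum (\<lambda>(i, j). g i j)"
proof (rule mseries_eqI)
  fix m
  let ?D = "{p. mcoeff (case p of (i, j) \<Rightarrow> g i j) m \<noteq> 0}"
  have fin: "finite (fst ` ?D \<times> snd ` ?D)" using lfinD[OF assms, of m] by simp
  have sub: "{a. \<exists>b. mcoeff (g a b) m \<noteq> 0} \<times> {b. \<exists>a. mcoeff (g a b) m \<noteq> 0} \<subseteq> fst ` ?D \<times> snd ` ?D"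
    by (auto simp: image_iff)
  show "mcoeff (msum (\<lambda>i. msum (g i))) m = mcoeff (msum (\<lambda>(i, j). g i j)) m"
    using Sum_any.cartesian_product[OF fin sub]
    by (simp add: mcoeff_msum case_prod_unfold)
qed

lemma msum_reindex:
  assumes "bij h" shows "msum (\<lambda>i. g (h i)) = msum g"
  by (rule mseries_eqI, unfold mcoeff_msum, rule sym, rule Sum_any.reindex_cong[OF assms]) auto

lemma msum_swap:
  assumes "lfin (\<lambda>(i, j). g i j)"
  shows "msum (\<lambda>i. msum (g i)) = msum (\<lambda>j. msum (\<lambda>i. g i j))"
proof -
  have bij: "bij prod.swap" by (rule bij_swap)
  have "lfin (\<lambda>p. (case prod.swap p of (i, j) \<Rightarrow> g i j))"
    by (rule lfin_comp_inj[OF assms]) (simp add: bij_is_inj[OF bij_swap])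
  then have "lfin (\<lambda>(j, i). g i j)" by (simp add: case_prod_unfold)
  then have "msum (\<lambda>j. msum (\<lambda>i. g i j)) = msum (\<lambda>(j, i). g i j)"
    by (rule msum_Fubini)
  also have "\<dots> = msum (\<lambda>(i, j). g i j)"
    using msum_reindex[OF bij, of "\<lambda>(i, j). g i j"] by (simp add: case_prod_unfold)
  finally show ?thesis using msum_Fubini[OF assms] by simp
qed

lemma msum_product:
  assumes "lfin f" "lfin g"
  shows "msum f * msum g = msum (\<lambda>(i, j). f i * g j)"
  using msum_Fubini[OF lfin_product[OF assms]] assms
  by (simp add: msum_mult_left msum_mult_right)

lemma mderiv_msum:
  assumes "lfin g" shows "mderiv x (msum g) = msum (\<lambda>i. mderiv x (g i))"
  by (rule mseries_eqI)
    (simp only: mcoeff_mderiv mcoeff_msum Sum_any_right_distrib[OF lfinD[OF assms]])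

text \<open>Regrouping along the fibres of \<open>h\<close>. For \<open>h p = fst p + snd p\<close> it collects the pairs of
  monomials with a given product, which is how substitution becomes multiplicative.\<close>

lemma lfin_fibre:
  assumes "lfin g"
  shows "lfin (\<lambda>(k, p). if h p = k then g p else 0)"
  unfolding lfin_def
proof
  fix m
  have "{(k, p). h p = k \<and> mcoeff (g p) m \<noteq> 0} = (\<lambda>p. (h p, p)) ` {p. mcoeff (g p) m \<noteq> 0}"
    by auto
  moreover have "{q. mcoeff (case q of (k, p) \<Rightarrow> if h p = k then g p else 0) m \<noteq> 0}
      = {(k, p). h p = k \<and> mcoeff (g p) m \<noteq> 0}" by (auto split: if_splits)
  ultimately show "finite {q. mcoeff (case q of (k, p) \<Rightarrow> if h p = k then g p else 0) m \<noteq> 0}"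
    using lfinD[OF assms] by simp
qed

lemma msum_fibre:
  assumes "lfin g"
  shows "msum g = msum (\<lambda>k. msum (\<lambda>p. if h p = k then g p else 0))"
proof -
  have "msum (\<lambda>k. msum (\<lambda>p. if h p = k then g p else 0))
      = msum (\<lambda>p. msum (\<lambda>k. if h p = k then g p else 0))"
    by (rule msum_swap[OF lfin_fibre[OF assms]])
  also have "\<dots> = msum g"
  proof (rule arg_cong[where f = msum], rule ext)
    fix p show "msum (\<lambda>k. if h p = k then g p else 0) = g p"
      by (subst msum_finite[of "{h p}"]) auto
  qed
  finally show ?thesis by simp
qed


section \<open>Substitution\<close>

abbreviation mon :: "('u \<Rightarrow> 'v mseries) \<Rightarrow> 'u multiset \<Rightarrow> 'v mseries" where
  "mon s k \<equiv> (\<Prod>x\<in>#k. s x)"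

definition sub_ok :: "('u \<Rightarrow> 'v mseries) \<Rightarrow> 'u mseries \<Rightarrow> bool" where
  "sub_ok s f \<longleftrightarrow> lfin (\<lambda>k. mconst (mcoeff f k) * mon s k)"

lemma sub_ok_add: "sub_ok s f \<Longrightarrow> sub_ok s g \<Longrightarrow> sub_ok s (f + g)"
  and sub_ok_diff: "sub_ok s f \<Longrightarrow> sub_ok s g \<Longrightarrow> sub_ok s (f - g)"
  by (auto simp: sub_ok_def mconst_add mconst_diff distrib_right left_diff_distrib
      intro: lfin_add lfin_diff)

lemma sub_ok_finite: "finite {k. mcoeff f k \<noteq> 0} \<Longrightarrow> sub_ok s f"
  unfolding sub_ok_def by (rule lfin_finite_support, erule rev_finite_subset) auto

lemma sub_ok_simple [simp]: "sub_ok s 0" "sub_ok s 1" "sub_ok s (mconst c)" "sub_ok s (mvar x)"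
  by (rule sub_ok_finite; auto simp: mcoeff_1 mcoeff_mconst mcoeff_mvar)+

lemma msubst_add: "sub_ok s f \<Longrightarrow> sub_ok s g \<Longrightarrow> msubst s (f + g) = msubst s f + msubst s g"
  and msubst_diff: "sub_ok s f \<Longrightarrow> sub_ok s g \<Longrightarrow> msubst s (f - g) = msubst s f - msubst s g"
  by (auto simp: sub_ok_def msubst_def mconst_add mconst_diff distrib_right left_diff_distrib
      msum_add msum_diff)

lemma msubst_mconst [simp]: "msubst s (mconst c) = mconst c"
  unfolding msubst_def
  by (subst msum_finite[of "{{#}}"]) (auto simp: mcoeff_mconst)

lemma msubst_0 [simp]: "msubst s 0 = 0" and msubst_1 [simp]: "msubst s 1 = 1"
  using msubst_mconst[of s 0] msubst_mconst[of s 1] by simp_all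

lemma msubst_mvar [simp]: "msubst s (mvar x) = s x"
  unfolding msubst_def
  by (subst msum_finite[of "{{#x#}}"]) (auto simp: mcoeff_mvar)

lemma sub_ok_mult_aux:
  assumes "sub_ok s f" "sub_ok s g"
  defines "t \<equiv> \<lambda>(a, b). (mconst (mcoeff f a) * mon s a) * (mconst (mcoeff g b) * mon s b)"
  shows "lfin t" "mconst (mcoeff (f * g) k) * mon s k = msum (\<lambda>p. if fst p + snd p = k then t p else 0)"
proof -
  show "lfin t" unfolding t_def by (rule lfin_product) (use assms in \<open>auto simp: sub_ok_def\<close>)
  have "msum (\<lambda>p. if fst p + snd p = k then t p else 0)
      = (\<Sum>p\<in>splits k. if fst p + snd p = k then t p else 0)"
    by (rule msum_finite[OF finite_splits]) (auto simp: splits_def)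
  also have "\<dots> = (\<Sum>p\<in>splits k. mconst (mcoeff f (fst p)) * mconst (mcoeff g (snd p)) * mon s k)"
    by (rule sum.cong) (auto simp: splits_def t_def mult_ac)
  also have "\<dots> = mconst (mcoeff (f * g) k) * mon s k"
    by (simp add: mcoeff_mult mconst_sum mconst_mult sum_distrib_right case_prod_unfold)
  finally show "mconst (mcoeff (f * g) k) * mon s k
      = msum (\<lambda>p. if fst p + snd p = k then t p else 0)" by simp
qed

lemma lfin_msum_fibre:
  assumes "lfin g"
  shows "lfin (\<lambda>k. msum (\<lambda>p. if h p = k then g p else 0))"
  unfolding lfin_def
proof
  fix m
  have "{k. mcoeff (msum (\<lambda>p. if h p = k then g p else 0)) m \<noteq> 0} \<subseteq> h ` {p. mcoeff (g p) m \<noteq> 0}"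
    by (auto elim!: mcoeff_msum_nonzeroE split: if_splits)
  then show "finite {k. mcoeff (msum (\<lambda>p. if h p = k then g p else 0)) m \<noteq> 0}"
    using lfinD[OF assms] finite_subset by blast
qed

lemma sub_ok_mult: "sub_ok s f \<Longrightarrow> sub_ok s g \<Longrightarrow> sub_ok s (f * g)"
  unfolding sub_ok_def[of s "f * g"] sub_ok_mult_aux(2)
  by (rule lfin_msum_fibre) (rule sub_ok_mult_aux(1))

lemma msubst_mult:
  assumes "sub_ok s f" "sub_ok s g"
  shows "msubst s (f * g) = msubst s f * msubst s g"
  unfolding msubst_def sub_ok_mult_aux(2)[OF assms]
  using assms
  by (simp add: msum_product sub_ok_def
      msum_fibre[OF sub_ok_mult_aux(1)[OF assms], symmetric])

lemma sub_ok_sum: "(\<And>i. i \<in> S \<Longrightarrow> sub_ok s (f i)) \<Longrightarrow> sub_ok s (sum f S)"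
  by (induction S rule: infinite_finite_induct) (auto intro: sub_ok_add)

lemma msubst_sum:
  "(\<And>i. i \<in> S \<Longrightarrow> sub_ok s (f i)) \<Longrightarrow> msubst s (sum f S) = (\<Sum>i\<in>S. msubst s (f i))"
  by (induction S rule: infinite_finite_induct) (auto simp: msubst_add sub_ok_sum)

lemma msubst_mon:
  assumes "\<And>x. x \<in># k \<Longrightarrow> sub_ok s (f x)"
  shows "sub_ok s (mon f k)" "msubst s (mon f k) = mon (\<lambda>x. msubst s (f x)) k"
  using assms by (induction k) (auto simp: msubst_mult sub_ok_mult)

text \<open>Continuity of substitution. A fixed monomial of the result sees only finitely many monomials of
  the common set \<open>S\<close>, so that both sides are finite double sums in each coefficient.\<close>

lemma sub_ok_support:
  assumes "\<And>m. finite {k\<in>S. mcoeff (mon s k) m \<noteq> 0}" "\<And>k. mcoeff f k \<noteq> 0 \<Longrightarrow> k \<in> S"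
  shows "sub_ok s f"
  unfolding sub_ok_def lfin_def
  by (rule allI, rule finite_subset[OF _ assms(1)]) (use assms(2) in auto)

lemma msubst_msum:
  fixes s :: "'u \<Rightarrow> 'v mseries"
  assumes S: "\<And>m. finite {k\<in>S. mcoeff (mon s k) m \<noteq> 0}"
    and f: "\<And>i k. mcoeff (f i) k \<noteq> 0 \<Longrightarrow> k \<in> S" and lf: "lfin f"
  shows "lfin (\<lambda>i. msubst s (f i))" "msubst s (msum f) = msum (\<lambda>i. msubst s (f i))"
proof -
  let ?g = "\<lambda>i k. mconst (mcoeff (f i) k) * mon s k"
  have lf2: "lfin (\<lambda>(i, k). ?g i k)"
    unfolding lfin_def
  proof
    fix m
    let ?K = "{k\<in>S. mcoeff (mon s k) m \<noteq> 0}"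
    have "finite (\<Union>k\<in>?K. {i. mcoeff (f i) k \<noteq> 0} \<times> {k})"
      using S[of m] lf by (intro finite_UN_I) (auto simp: lfin_def)
    then show "finite {p. mcoeff (case p of (i, k) \<Rightarrow> ?g i k) m \<noteq> 0}"
      by (rule rev_finite_subset) (use f in auto)
  qed
  show "lfin (\<lambda>i. msubst s (f i))"
    unfolding lfin_def
  proof
    fix m
    have "{i. mcoeff (msubst s (f i)) m \<noteq> 0} \<subseteq> fst ` {p. mcoeff (case p of (i, k) \<Rightarrow> ?g i k) m \<noteq> 0}"
      unfolding msubst_def by (auto elim!: mcoeff_msum_nonzeroE simp: image_iff)
    then show "finite {i. mcoeff (msubst s (f i)) m \<noteq> 0}"
      using lfinD[OF lf2, of m] finite_subset by blast
  qed
  have "msum (\<lambda>i. msubst s (f i)) = msum (\<lambda>k. msum (\<lambda>i. ?g i k))"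
    unfolding msubst_def by (rule msum_swap[OF lf2])
  also have "\<dots> = msubst s (msum f)"
    unfolding msubst_def
  proof (rule arg_cong[where f = msum], rule ext)
    fix k
    have "(mconst (mcoeff (msum f) k) :: 'v mseries) = msum (\<lambda>i. mconst (mcoeff (f i) k))"
      by (rule mseries_eqI) (simp add: mcoeff_mconst mcoeff_msum)
    moreover have "lfin (\<lambda>i. mconst (mcoeff (f i) k) :: 'v mseries)"
      using lfinD[OF lf, of k] by (auto simp: lfin_def mcoeff_mconst)
    ultimately show "msum (\<lambda>i. ?g i k) = mconst (mcoeff (msum f) k) * mon s k"
      by (simp add: msum_mult_right)
  qed
  finally show "msubst s (msum f) = msum (\<lambda>i. msubst s (f i))" by simp
qed

lemma ord_ge_mon:
  assumes "\<And>x. x \<in># k \<Longrightarrow> mcoeff (s x) {#} = 0" shows "ord_ge (mon s k) (size k)"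
  using assms
proof (induction k)
  case (add x k)
  have "ord_ge (s x * mon s k) (1 + size k)"
    by (rule ord_ge_mult) (use add in \<open>auto simp: ord_ge_1_iff[symmetric]\<close>)
  then show ?case by simp
qed simp

lemma finite_msets_bounded:
  assumes "finite A" shows "finite {k. set_mset k \<subseteq> A \<and> size k \<le> n}"
proof -
  have "{k. set_mset k \<subseteq> A \<and> size k \<le> n} \<subseteq> mset ` {xs. set xs \<subseteq> A \<and> length xs \<le> n}"
  proof
    fix k assume k: "k \<in> {k. set_mset k \<subseteq> A \<and> size k \<le> n}"
    obtain xs where "mset xs = k" using ex_mset by blast
    then show "k \<in> mset ` {xs. set xs \<subseteq> A \<and> length xs \<le> n}" using k by auto
  qed
  then show ?thesis using finite_lists_length_le[OF assms] finite_subset by blast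
qed


lemma msum_inj_support:
  assumes "inj h" "\<And>i. i \<notin> range h \<Longrightarrow> g i = 0"
  shows "msum (\<lambda>i. g (h i)) = msum g"
proof (rule mseries_eqI)
  fix m
  have "{i. mcoeff (g i) m \<noteq> 0} = h ` {j. mcoeff (g (h j)) m \<noteq> 0}"
    using assms(2) by (auto simp: image_iff) (metis mcoeff_0 rangeE)
  moreover have "inj_on h {j. mcoeff (g (h j)) m \<noteq> 0}" using assms(1) by (rule inj_on_subset) simp
  ultimately show "mcoeff (msum (\<lambda>i. g (h i))) m = mcoeff (msum g) m"
    by (simp add: mcoeff_msum Sum_any.expand_set sum.reindex)
qed

subsection \<open>Substitution of series without constant term\<close>

definition small :: "('u \<Rightarrow> 'v mseries) \<Rightarrow> bool" where
  "small s \<longleftrightarrow> (\<forall>x. mcoeff (s x) {#} = 0)"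

lemma small_finite:
  fixes s :: "'u::finite \<Rightarrow> 'v mseries"
  assumes "small s" shows "finite {k. mcoeff (mon s k) m \<noteq> 0}"
proof (rule finite_subset)
  show "{k. mcoeff (mon s k) m \<noteq> 0} \<subseteq> {k. set_mset k \<subseteq> UNIV \<and> size k \<le> size m}"
    using ord_ge_mon[of _ s] assms by (auto simp: small_def ord_ge_def)
qed (rule finite_msets_bounded, simp)

lemma sub_ok_small [simp]:
  fixes s :: "'u::finite \<Rightarrow> 'v mseries"
  shows "small s \<Longrightarrow> sub_ok s f"
  by (rule sub_ok_support[of UNIV]) (simp_all add: small_finite)

lemma ord_ge_msubst:
  fixes s :: "'u::finite \<Rightarrow> 'v mseries"
  assumes "small s" "ord_ge f r" shows "ord_ge (msubst s f) r"
  unfolding msubst_def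
proof (rule ord_ge_msum)
  fix k
  have "ord_ge (mon s k) (size k)" using assms(1) by (intro ord_ge_mon) (auto simp: small_def)
  then show "ord_ge (mconst (mcoeff f k) * mon s k) r"
    by (cases "r \<le> size k") (auto simp: ord_geD[OF assms(2)] intro: ord_ge_mult2 ord_ge_mono)
qed

lemma mcoeff_msubst_empty [simp]:
  fixes s :: "'u::finite \<Rightarrow> 'v mseries"
  assumes "small s" shows "mcoeff (msubst s f) {#} = mcoeff f {#}"
proof -
  have "mcoeff (f - mconst (mcoeff f {#})) {#} = 0" by (simp add: mcoeff_mconst)
  then have "ord_ge (msubst s (f - mconst (mcoeff f {#}))) 1"
    by (intro ord_ge_msubst assms) (simp add: ord_ge_1_iff[simplified])
  then show ?thesis using assms by (simp add: msubst_diff ord_ge_1_iff[simplified] mcoeff_mconst)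
qed

lemma mderiv_mon:
  fixes s :: "'u::finite \<Rightarrow> 'v mseries"
  shows "mderiv x (mon s k)
    = (\<Sum>y\<in>UNIV. mconst (of_nat (count k y)) * mon s (k - {#y#}) * mderiv x (s y))"
proof (induction k)
  case (add z k)
  let ?c = "\<lambda>k y. mconst (of_nat (count k y)) :: 'v mseries"
  have *: "s z * (?c k y * mon s (k - {#y#}) * mderiv x (s y))
      = ?c k y * mon s (add_mset z k - {#y#}) * mderiv x (s y)" for y
  proof (cases "y \<in># k")
    case True
    then show ?thesis
      by (metis (no_types, lifting) image_mset_add_mset mult.assoc mult.left_commute
          multi_self_add_other_not_self prod_mset.add_mset diff_union_swap add_mset_remove_trivial
          insert_DiffM)
  qed (simp add: not_in_iff)
  have "mderiv x (mon s (add_mset z k))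
      = mderiv x (s z) * mon s k + (\<Sum>y\<in>UNIV. s z * (?c k y * mon s (k - {#y#}) * mderiv x (s y)))"
    by (simp add: mderiv_mult add sum_distrib_left)
  also have "mderiv x (s z) * mon s k
      = (\<Sum>y\<in>UNIV. if y = z then mon s (add_mset z k - {#y#}) * mderiv x (s y) else 0)"
    by simp
  also have "\<dots> + (\<Sum>y\<in>UNIV. s z * (?c k y * mon s (k - {#y#}) * mderiv x (s y)))
      = (\<Sum>y\<in>UNIV. ?c (add_mset z k) y * mon s (add_mset z k - {#y#}) * mderiv x (s y))"
    unfolding sum.distrib[symmetric] *
    by (rule sum.cong) (auto simp: mconst_add distrib_right)
  finally show ?case .
qed simp

lemma mderiv_msubst:
  fixes s :: "'u::finite \<Rightarrow> 'v mseries"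
  assumes "small s"
  shows "mderiv x (msubst s f) = (\<Sum>y\<in>UNIV. msubst s (mderiv y f) * mderiv x (s y))"
proof -
  let ?g = "\<lambda>y k. mconst (mcoeff f k * of_nat (count k y)) * mon s (k - {#y#})"
  have ok: "lfin (\<lambda>k. mconst (mcoeff g k) * mon s k)" for g
    using sub_ok_small[OF assms, of g] by (simp add: sub_ok_def)
  have sup: "?g y k = 0" if "k \<notin> range (add_mset y)" for y k
  proof -
    have "y \<notin># k" using that by (metis insert_DiffM rangeI)
    then show ?thesis by (simp add: not_in_iff)
  qed
  have g_add: "?g y (add_mset y k) = mconst (mcoeff (mderiv y f) k) * mon s k" for y k
    by (simp add: mcoeff_mderiv mult.commute)
  have lf: "lfin (?g y)" for y
    unfolding lfin_def
  proof
    fix m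
    have "{k. mcoeff (?g y k) m \<noteq> 0}
        \<subseteq> add_mset y ` {k. mcoeff (mconst (mcoeff (mderiv y f) k) * mon s k) m \<noteq> 0}"
    proof
      fix k assume k: "k \<in> {k. mcoeff (?g y k) m \<noteq> 0}"
      then have "k \<in> range (add_mset y)" using sup by (metis (mono_tags, lifting) mcoeff_0 mem_Collect_eq)
      then obtain j where "k = add_mset y j" by blast
      then have "mcoeff (mconst (mcoeff (mderiv y f) j) * mon s j) m \<noteq> 0"
        using k by (simp only: g_add mem_Collect_eq not_False_eq_True)
      then show "k \<in> add_mset y ` {k. mcoeff (mconst (mcoeff (mderiv y f) k) * mon s k) m \<noteq> 0}"
        using \<open>k = add_mset y j\<close> by blast
    qed
    then show "finite {k. mcoeff (?g y k) m \<noteq> 0}"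
      using lfinD[OF ok] finite_subset by blast
  qed
  have "mderiv x (msubst s f) = msum (\<lambda>k. mderiv x (mconst (mcoeff f k) * mon s k))"
    unfolding msubst_def by (rule mderiv_msum[OF ok])
  also have "\<dots> = msum (\<lambda>k. \<Sum>y\<in>UNIV. ?g y k * mderiv x (s y))"
    by (simp add: mderiv_mconst_mult mderiv_mon sum_distrib_left mconst_mult mult.assoc)
  also have "\<dots> = (\<Sum>y\<in>UNIV. msum (?g y) * mderiv x (s y))"
    by (simp add: msum_sum lfin_mult_right lf msum_mult_right)
  also have "\<dots> = (\<Sum>y\<in>UNIV. msubst s (mderiv y f) * mderiv x (s y))"
  proof (rule sum.cong[OF refl])
    fix y
    have "msum (?g y) = msum (\<lambda>k. ?g y (add_mset y k))"
      by (rule msum_inj_support[symmetric]) (auto simp: inj_def sup)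
    then show "msum (?g y) * mderiv x (s y) = msubst s (mderiv y f) * mderiv x (s y)"
      by (simp only: g_add msubst_def)
  qed
  finally show ?thesis .
qed

text \<open>In a product of series without constant term, exchanging one factor leaves the others, each of
  which contributes one order.\<close>

lemma ord_ge_mon_diff:
  assumes "small s" "small s'" "\<And>x. ord_ge (s x - s' x) n"
  shows "ord_ge (mon s k - mon s' k) (n + (size k - 1))"
proof (induction k)
  case (add x k)
  have "mon s (add_mset x k) - mon s' (add_mset x k)
      = (s x - s' x) * mon s k + s' x * (mon s k - mon s' k)"
    by (simp add: algebra_simps)
  moreover have "ord_ge ((s x - s' x) * mon s k) (n + size k)"
    using assms by (intro ord_ge_mult ord_ge_mon) (auto simp: small_def)
  moreover have "ord_ge (s' x * (mon s k - mon s' k)) (1 + (n + (size k - 1)))"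
    using assms(2) add by (intro ord_ge_mult) (auto simp: small_def ord_ge_1_iff[simplified])
  moreover have "k = {#} \<Longrightarrow> mon s k - mon s' k = 0" by simp
  ultimately show ?case
    by (cases "k = {#}") (auto intro!: ord_ge_add elim: ord_ge_mono dest: ord_ge_mono)
qed simp

lemma ord_ge_msubst_diff:
  fixes s s' :: "'u::finite \<Rightarrow> 'v mseries"
  assumes "small s" "small s'" "\<And>x. ord_ge (s x - s' x) n" "ord_ge f (Suc r)"
  shows "ord_ge (msubst s f - msubst s' f) (n + r)"
proof -
  have ok: "lfin (\<lambda>k. mconst (mcoeff f k) * mon s k)" "lfin (\<lambda>k. mconst (mcoeff f k) * mon s' k)"
    using sub_ok_small[OF assms(1), of f] sub_ok_small[OF assms(2), of f] by (simp_all add: sub_ok_def)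
  have "msubst s f - msubst s' f = msum (\<lambda>k. mconst (mcoeff f k) * (mon s k - mon s' k))"
    unfolding msubst_def by (simp add: msum_diff[OF ok, symmetric] right_diff_distrib)
  moreover have "ord_ge \<dots> (n + r)"
  proof (rule ord_ge_msum)
    fix k
    show "ord_ge (mconst (mcoeff f k) * (mon s k - mon s' k)) (n + r)"
    proof (cases "Suc r \<le> size k")
      case True
      then show ?thesis
        by (intro ord_ge_mult2 ord_ge_mono[OF ord_ge_mon_diff[OF assms(1-3)]]) auto
    qed (simp add: ord_geD[OF assms(4)])
  qed
  ultimately show ?thesis by simp
qed


subsection \<open>The grading on the variables of the loop space\<close>

lemma mon_deg_empty [simp]: "mon_deg {#} = 0"
  and mon_deg_add_mset [simp]: "mon_deg (add_mset x m) = int (snd x) - 1 + mon_deg m"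
  and mon_deg_union [simp]: "mon_deg (a + b) = mon_deg a + mon_deg b"
  by (simp_all add: mon_deg_def case_prod_unfold)

lemma mon_deg_ge: "- int (size m) \<le> mon_deg m"
  by (induction m) auto

lemma deg_leD: "deg_le f n \<Longrightarrow> mcoeff f m \<noteq> 0 \<Longrightarrow> mon_deg m \<le> n"
  by (simp add: deg_le_def)

lemma deg_le_mono: "deg_le f n \<Longrightarrow> n \<le> n' \<Longrightarrow> deg_le f n'"
  by (force simp: deg_le_def)

lemma deg_le_zero [simp]: "deg_le 0 n"
  by (simp add: deg_le_def)

lemma deg_le_mconst: "0 \<le> n \<Longrightarrow> deg_le (mconst c) n"
  and deg_le_1: "0 \<le> n \<Longrightarrow> deg_le 1 n"
  and deg_le_mvar: "int (snd x) - 1 \<le> n \<Longrightarrow> deg_le (mvar x) n"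
  by (auto simp: deg_le_def mcoeff_mconst mcoeff_1 mcoeff_mvar)

lemma deg_le_add: "deg_le f n \<Longrightarrow> deg_le g n \<Longrightarrow> deg_le (f + g) n"
  and deg_le_diff: "deg_le f n \<Longrightarrow> deg_le g n \<Longrightarrow> deg_le (f - g) n"
  and deg_le_uminus [simp]: "deg_le (- f) n = deg_le f n"
  by (auto simp: deg_le_def) (metis add.right_neutral diff_zero)+

lemma deg_le_sum: "(\<And>i. i \<in> S \<Longrightarrow> deg_le (f i) n) \<Longrightarrow> deg_le (sum f S) n"
  by (induction S rule: infinite_finite_induct) (auto intro: deg_le_add)

lemma deg_le_msum: "(\<And>i. deg_le (g i) n) \<Longrightarrow> deg_le (msum g) n"
  unfolding deg_le_def by (metis mcoeff_msum_nonzeroE)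

lemma deg_le_mult:
  assumes "deg_le f r" "deg_le g s" "r + s \<le> n" shows "deg_le (f * g) n"
  unfolding deg_le_def
proof safe
  fix m assume "mcoeff (f * g) m \<noteq> 0"
  then obtain a b where "m = a + b" "mcoeff f a \<noteq> 0" "mcoeff g b \<noteq> 0"
    by (rule mcoeff_mult_nonzeroE)
  then show "mon_deg m \<le> n" using assms by (force simp: deg_le_def)
qed

lemma deg_le_mconst_mult: "deg_le f n \<Longrightarrow> deg_le (mconst c * f) n"
  by (rule deg_le_mult[OF deg_le_mconst[of 0]]) auto

lemma deg_le_mon_neg:
  assumes "\<And>x. deg_le (s x) (-1)" shows "deg_le (mon s k) (- int (size k))"
proof (induction k)
  case (add x k)
  show ?case using deg_le_mult[OF assms add] by simp
qed (simp add: deg_le_1)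

lemma small_of_deg:
  assumes "\<And>x. deg_le (s x) (-1)" shows "small s"
  using assms deg_leD[of _ "-1" "{#}"] by (force simp: small_def)

text \<open>Fixed points among the families of degree at most \<open>-1\<close>, such as the values of flat and
  canonical coordinates at a formal point.\<close>

lemma deg_contraction_fixpoint:
  fixes T :: "('i \<Rightarrow> ('n \<times> nat) mseries) \<Rightarrow> 'i \<Rightarrow> ('n \<times> nat) mseries"
  assumes pres: "\<And>f i. (\<And>i. deg_le (f i) (-1)) \<Longrightarrow> deg_le (T f i) (-1)"
    and contr: "\<And>f g n i. small f \<Longrightarrow> small g \<Longrightarrow> (\<And>i. ord_ge (f i - g i) n)
      \<Longrightarrow> ord_ge (T f i - T g i) (Suc n)"
  obtains f where "\<And>i. deg_le (f i) (-1)" "T f = f"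
proof -
  let ?S = "{f. \<forall>i m. mcoeff (f i) m \<noteq> 0 \<longrightarrow> mon_deg m \<le> -1}"
  have iff: "f \<in> ?S \<longleftrightarrow> (\<forall>i. deg_le (f i) (-1))" for f :: "'i \<Rightarrow> ('n \<times> nat) mseries"
    by (auto simp: deg_le_def)
  have sm: "small f" if "f \<in> ?S" for f :: "'i \<Rightarrow> ('n \<times> nat) mseries"
    using that unfolding iff by (auto intro: small_of_deg)
  obtain f where "\<And>i m. mcoeff (f i) m \<noteq> 0 \<Longrightarrow> mon_deg m \<le> -1" "T f = f"
  proof (rule contraction_fixpoint[of "\<lambda>m. mon_deg m \<le> -1" T])
    show "T f \<in> ?S" if "f \<in> ?S" for f using pres that unfolding iff by blast
    show "ord_ge (T f i - T g i) (Suc n)"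
      if "f \<in> ?S" "g \<in> ?S" "\<And>i. ord_ge (f i - g i) n" for f g n i
      using contr sm that by blast
  qed blast
  then show thesis using that by (auto simp: deg_le_def)
qed

lemma deg_le_msubst_neg:
  fixes s :: "'u::finite \<Rightarrow> ('n \<times> nat) mseries"
  assumes "\<And>x. deg_le (s x) (-1)" "ord_ge f r" "- int r \<le> n"
  shows "deg_le (msubst s f) n"
  unfolding msubst_def
proof (rule deg_le_msum)
  fix k
  show "deg_le (mconst (mcoeff f k) * mon s k) n"
  proof (cases "r \<le> size k")
    case True
    then show ?thesis using assms(3)
      by (intro deg_le_mconst_mult deg_le_mono[OF deg_le_mon_neg[OF assms(1)]]) auto
  qed (simp add: ord_geD[OF assms(2)])
qed


subsection \<open>Substitution of the coordinates of a formal point\<close>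

text \<open>The coordinates of a formal point near the base point. They may have constant terms for
  \<open>b \<ge> 2\<close>, so that only series of bounded degree can be evaluated on them.\<close>

definition admissible :: "('n \<times> nat \<Rightarrow> ('n \<times> nat) mseries) \<Rightarrow> bool" where
  "admissible s \<longleftrightarrow> (\<forall>\<beta> b. deg_le (s (\<beta>, b)) (int b - 1)) \<and> (\<forall>\<beta>. mcoeff (s (\<beta>, 1)) {#} = 0)"

lemma admissible_deg: "admissible s \<Longrightarrow> deg_le (s x) (int (snd x) - 1)"
  by (cases x) (simp add: admissible_def)

lemma admissible_const:
  assumes "admissible s" "snd x \<le> 1" shows "mcoeff (s x) {#} = 0"
proof (cases "snd x = 1")
  case True
  then show ?thesis using assms by (cases x) (simp add: admissible_def)
next
  case False
  then have "snd x = 0" using assms(2) by simp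
  then have "deg_le (s x) (-1)" using admissible_deg[OF assms(1), of x] by simp
  then show ?thesis using deg_leD by fastforce
qed

lemma deg_le_mon:
  assumes "admissible s" shows "deg_le (mon s k) (mon_deg k)"
proof (induction k)
  case (add x k)
  show ?case using deg_le_mult[OF admissible_deg[OF assms] add] by simp
qed (simp add: deg_le_1)

text \<open>A monomial that contributes to a fixed coefficient has few factors \<open>t\<^sub>0\<close> and \<open>t\<^sub>1\<close>, since these
  have no constant term; a bound on the degree then bounds the other factors.\<close>

lemma admissible_finite:
  fixes s :: "'n::finite \<times> nat \<Rightarrow> ('n \<times> nat) mseries"
  assumes "admissible s"
  shows "finite {k \<in> {k. mon_deg k \<le> n}. mcoeff (mon s k) m \<noteq> 0}"
proof -
  have ord: "ord_ge (mon s k) (size (filter_mset (\<lambda>x. snd x \<le> 1) k))" for k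
  proof (induction k)
    case (add x k)
    show ?case
    proof (cases "snd x \<le> 1")
      case True
      then have "ord_ge (s x) 1" using admissible_const[OF assms] by (simp add: ord_ge_1_iff[simplified])
      then show ?thesis using True ord_ge_mult[OF _ add, of "s x" 1] by simp
    qed (use ord_ge_mult2[OF add] in simp)
  qed simp
  define N where "N = size m + nat (n + int (size m))"
  have deg: "int (size k) - 2 * int (size (filter_mset (\<lambda>x. snd x \<le> 1) k)) \<le> mon_deg k" for k :: "('n \<times> nat) multiset"
    by (induction k) auto
  have deg2: "int (snd x) - 1 - int (size (filter_mset (\<lambda>x. snd x \<le> 1) k)) \<le> mon_deg k"
    if "x \<in># k" for k :: "('n \<times> nat) multiset" and x
    using that
  proof (induction k)
    case (add y k)
    have "- int (size (filter_mset (\<lambda>x. snd x \<le> 1) k)) \<le> mon_deg k" for k :: "('n \<times> nat) multiset"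
      by (induction k) auto
    from this[of k] show ?case using add by (cases "x = y"; cases "snd y \<le> 1") simp_all
  qed simp
  have "{k \<in> {k. mon_deg k \<le> n}. mcoeff (mon s k) m \<noteq> 0}
      \<subseteq> {k. set_mset k \<subseteq> UNIV \<times> {..N + 1} \<and> size k \<le> nat (n + 2 * int (size m))}"
  proof safe
    fix k assume k: "mon_deg k \<le> n" "mcoeff (mon s k) m \<noteq> 0"
    have sz: "size (filter_mset (\<lambda>x. snd x \<le> 1) k) \<le> size m"
      using ord[of k] k(2) by (auto simp: ord_ge_def)
    show "size k \<le> nat (n + 2 * int (size m))" using deg[of k] sz k(1) by linarith
    fix a b assume "(a, b) \<in># k"
    then show "b \<le> N + 1" using deg2[of "(a, b)" k] sz k(1) unfolding N_def by simp
  qed auto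
  moreover have "finite {k. set_mset k \<subseteq> (UNIV :: 'n set) \<times> {..N + 1} \<and> size k \<le> nat (n + 2 * int (size m))}"
    by (rule finite_msets_bounded) simp
  ultimately show ?thesis by (rule finite_subset)
qed

lemma sub_ok_admissible:
  fixes s :: "'n::finite \<times> nat \<Rightarrow> ('n \<times> nat) mseries"
  shows "admissible s \<Longrightarrow> deg_le f n \<Longrightarrow> sub_ok s f"
  by (rule sub_ok_support[OF admissible_finite]) (auto dest: deg_leD)

lemma deg_le_msubst:
  assumes "admissible s" "deg_le f n" shows "deg_le (msubst s f) n"
  unfolding msubst_def
proof (rule deg_le_msum)
  fix k
  show "deg_le (mconst (mcoeff f k) * mon s k) n"
    using deg_leD[OF assms(2), of k]
    by (cases "mcoeff f k = 0") (auto intro: deg_le_mconst_mult deg_le_mono[OF deg_le_mon[OF assms(1)]])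
qed

lemma msubst_msum_admissible:
  fixes s :: "'n::finite \<times> nat \<Rightarrow> ('n \<times> nat) mseries"
  assumes "admissible s" "\<And>i. deg_le (f i) n" "lfin f"
  shows "msubst s (msum f) = msum (\<lambda>i. msubst s (f i))"
  by (rule msubst_msum(2)[OF admissible_finite[OF assms(1)] _ assms(3)])
    (use assms(2) in \<open>auto dest: deg_leD\<close>)

lemma msubst_msubst:
  fixes s :: "'n::finite \<times> nat \<Rightarrow> ('n \<times> nat) mseries" and v :: "'u::finite \<Rightarrow> ('n \<times> nat) mseries"
  assumes "admissible s" "\<And>x. deg_le (v x) (-1)"
  shows "msubst s (msubst v f) = msubst (\<lambda>x. msubst s (v x)) f"
proof -
  have small: "small v" using assms(2) by (rule small_of_deg)
  have deg: "deg_le (mon v k) 0" for k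
    using deg_le_mono[OF deg_le_mon_neg[of v, OF assms(2)]] by simp
  have "msubst s (msubst v f) = msum (\<lambda>k. msubst s (mconst (mcoeff f k) * mon v k))"
    unfolding msubst_def[of v]
    by (rule msubst_msum_admissible[OF assms(1), of _ 0])
      (use sub_ok_small[OF small, of f] deg in \<open>auto intro: deg_le_mconst_mult simp: sub_ok_def\<close>)
  also have "\<dots> = msum (\<lambda>k. mconst (mcoeff f k) * mon (\<lambda>x. msubst s (v x)) k)"
  proof (rule arg_cong[where f = msum], rule ext)
    fix k
    have ok: "sub_ok s (v x)" for x using assms by (rule sub_ok_admissible)
    show "msubst s (mconst (mcoeff f k) * mon v k) = mconst (mcoeff f k) * mon (\<lambda>x. msubst s (v x)) k"
      using ok by (simp add: msubst_mult msubst_mon)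
  qed
  finally show ?thesis by (simp add: msubst_def[of _ f])
qed


section \<open>Formal asymptotic solutions of a closed commuting system\<close>

lemma mseries_inverse:
  assumes "mcoeff f {#} \<noteq> 0" obtains g where "f * g = 1"
proof -
  define c where "c = mcoeff f {#}"
  define T where "T g = (\<lambda>_::unit. mconst (1 / c) * (1 - (f - mconst c) * g ()))" for g
  have small: "ord_ge (f - mconst c) 1" by (simp add: ord_ge_1_iff[simplified] mcoeff_mconst c_def)
  obtain g where g: "T g = g"
  proof (rule contraction_fixpoint[of "\<lambda>_. True" T])
    fix g h :: "unit \<Rightarrow> 'a mseries" and n i
    assume *: "\<And>i. ord_ge (g i - h i) n"
    have "T g i - T h i = - (mconst (1 / c) * ((f - mconst c) * (g () - h ())))"
      by (simp add: T_def algebra_simps)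
    then show "ord_ge (T g i - T h i) (Suc n)"
      using ord_ge_mult2[OF ord_ge_mult[OF small *]] by (simp add: numeral_2_eq_2)
  qed auto
  have "mconst c * g () = mconst c * T g ()" using g by simp
  also have "\<dots> = 1 - (f - mconst c) * g ()"
    unfolding T_def mult.assoc[symmetric] mconst_mult[symmetric] using assms by (simp add: c_def)
  finally have "f * g () = 1" by (simp add: algebra_simps)
  then show thesis by (rule that)
qed

lemma mseries_constant:
  assumes "\<And>x. mderiv x f = 0" "mcoeff f {#} = c" shows "f = mconst c"
proof -
  have "ord_ge (f - mconst c) r" for r
  proof (induction r)
    case (Suc r)
    show ?case using assms by (simp add: ord_ge_Suc_iff_mderiv mderiv_diff mcoeff_mconst)
  qed simp
  then show ?thesis using ord_ge_all_eq_0 by (metis eq_iff_diff_eq_0)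
qed

text \<open>Substitution into the exponential series in one variable, so that the chain rule yields the
  derivative.\<close>

definition mexp :: "'v mseries \<Rightarrow> 'v mseries" where
  "mexp f = msubst (\<lambda>_::unit. f) (Mseries (\<lambda>m. 1 / fact (size m)))"

lemma mderiv_mexp:
  assumes "mcoeff f {#} = 0" shows "mderiv x (mexp f) = mexp f * mderiv x f"
proof -
  let ?e = "Mseries (\<lambda>m. 1 / fact (size m)) :: unit mseries"
  have count: "count m () = size m" for m :: "unit multiset" by (induction m) auto
  have "mderiv () ?e = ?e"
    by (rule mseries_eqI) (simp add: mcoeff_mderiv count del: of_nat_Suc)
  then show ?thesis using assms
    by (simp add: mexp_def mderiv_msubst small_def UNIV_unit)
qed

lemma mcoeff_mexp [simp]: "mcoeff f {#} = 0 \<Longrightarrow> mcoeff (mexp f) {#} = 1"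
  by (simp add: mexp_def small_def)

lemma mexp_uminus:
  assumes "mcoeff f {#} = 0" shows "mexp (- f) * mexp f = 1"
proof -
  have "mexp (- f) * mexp f = mconst 1"
    by (rule mseries_constant)
      (use assms in \<open>simp_all add: mderiv_mult mderiv_mexp mderiv_uminus algebra_simps\<close>)
  then show ?thesis by simp
qed

definition vderiv :: "'v \<Rightarrow> 'v mseries ^ 'n \<Rightarrow> 'v mseries ^ 'n" where
  "vderiv x w = (\<chi> i. mderiv x (w $ i))"

definition mat_deriv :: "'v \<Rightarrow> 'v mseries ^ 'm ^ 'n \<Rightarrow> 'v mseries ^ 'm ^ 'n" where
  "mat_deriv x M = (\<chi> i j. mderiv x (M $ i $ j))"

definition dotp :: "'a::comm_ring_1 ^ 'n \<Rightarrow> 'a ^ 'n \<Rightarrow> 'a" where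
  "dotp l w = (\<Sum>i\<in>UNIV. l $ i * w $ i)"

lemma dotp_add: "dotp l (u + w) = dotp l u + dotp l w"
  and dotp_diff: "dotp l (u - w) = dotp l u - dotp l w"
  and dotp_scale: "dotp l (c *s w) = c * dotp l w"
  and dotp_scale_left: "dotp (c *s l) w = c * dotp l w"
  and dotp_zero [simp]: "dotp l 0 = 0"
  by (simp_all add: dotp_def distrib_left right_diff_distrib sum.distrib sum_subtractf
      sum_distrib_left mult_ac)

lemma dotp_matrix: "dotp l (M *v w) = dotp (l v* M) w"
  unfolding dotp_def matrix_vector_mult_def vector_matrix_mult_def
  by (simp add: sum_distrib_left sum_distrib_right mult_ac) (rule sum.swap)

lemma vderiv_diff: "vderiv x (u - w) = vderiv x u - vderiv x w"
  and vderiv_add: "vderiv x (u + w) = vderiv x u + vderiv x w"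
  and vderiv_zero [simp]: "vderiv x 0 = 0"
  and vderiv_scale: "vderiv x (c *s w) = mderiv x c *s w + c *s vderiv x w"
  and vderiv_mult: "vderiv x (M *v w) = mat_deriv x M *v w + M *v vderiv x w"
  and vderiv_commute: "vderiv x (vderiv y w) = vderiv y (vderiv x w)"
  and mderiv_dotp: "mderiv x (dotp l w) = dotp (vderiv x l) w + dotp l (vderiv x w)"
  by (simp_all add: vderiv_def mat_deriv_def vec_eq_iff mderiv_diff mderiv_add mderiv_mult mderiv_sum
      matrix_vector_mult_def sum.distrib dotp_def mderiv_commute[of x y])

lemma matrix_vector_scale: "M *v (c *s w) = c *s (M *v (w :: 'a::comm_ring_1 ^ 'n))"
  by (simp add: matrix_vector_mult_def vec_eq_iff sum_distrib_left mult_ac)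

lemma vector_matrix_scale: "(c *s l) v* M = c *s ((l :: 'a::comm_ring_1 ^ 'n) v* M)"
  by (simp add: vector_matrix_mult_def vec_eq_iff sum_distrib_left mult_ac)

lemma vec_scale_diff: "c *s (u - w) = c *s u - c *s (w :: 'a::comm_ring_1 ^ 'n)"
  and vec_scale_one [simp]: "1 *s w = (w :: 'a::comm_ring_1 ^ 'n)"
  and vec_scale_zero [simp]: "c *s 0 = (0 :: 'a::comm_ring_1 ^ 'n)"
  and vec_zero_scale [simp]: "0 *s w = (0 :: 'a::comm_ring_1 ^ 'n)"
  by (simp_all add: vec_eq_iff algebra_simps)


subsection \<open>Perturbation of a simple eigenvalue\<close>

context
  fixes M :: "'v mseries ^ 'n ^ 'n::finite" and d :: "'n \<Rightarrow> complex" and k :: 'n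
  assumes diag: "\<And>i j. mcoeff (M $ i $ j) {#} = (if i = j then d i else 0)"
    and inj: "inj d"
begin

text \<open>The part of \<open>M\<close> that vanishes at the origin; applying it gains one order.\<close>

definition offd :: "'v mseries ^ 'n \<Rightarrow> 'n \<Rightarrow> 'v mseries" where
  "offd w l = (\<Sum>j\<in>UNIV. (M $ l $ j - mconst (if l = j then d l else 0)) * w $ j)"

lemma split_diag: "(M *v w) $ l = mconst (d l) * w $ l + offd w l"
proof -
  have *: "(\<Sum>j\<in>UNIV. mconst (if l = j then d l else 0) * w $ j) = mconst (d l) * w $ l"
    by (subst sum.mono_neutral_right[of _ "{l}"]) auto
  show ?thesis
    by (simp add: offd_def matrix_vector_mult_def left_diff_distrib sum_subtractf *)
qed

lemma offd_diff: "offd (u - w) l = offd u l - offd w l"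
  by (simp add: offd_def right_diff_distrib sum_subtractf)

lemma ord_offd:
  assumes "\<And>j. ord_ge (w $ j) n" shows "ord_ge (offd w l) (Suc n)"
  unfolding offd_def
proof (rule ord_ge_sum)
  fix j
  have "ord_ge (M $ l $ j - mconst (if l = j then d l else 0)) 1"
    by (simp add: ord_ge_1_iff[simplified] mcoeff_mconst diag)
  from ord_ge_mult[OF this assms]
  show "ord_ge ((M $ l $ j - mconst (if l = j then d l else 0)) * w $ j) (Suc n)" by simp
qed

lemma offd_const: "mcoeff (offd w l) {#} = 0"
  using ord_offd[of w 0 l] by (simp add: ord_ge_1_iff[simplified])

lemma mconst_cancel: "l \<noteq> k \<Longrightarrow> mconst (1 / (d l - d k)) * (mconst (d l - d k) * f) = f"
  by (simp add: mult.assoc[symmetric] mconst_mult[symmetric] inj_eq[OF inj])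

lemma mconst_cancel': "l \<noteq> k \<Longrightarrow> mconst (d l - d k) * (mconst (1 / (d l - d k)) * f) = f"
  using mconst_cancel[of l f] by (simp add: mult.left_commute)

text \<open>With the \<open>k\<close>-th component normalised to 1, row \<open>k\<close> of the eigenvalue equation gives the eigenvalue,
  and the other rows become a fixed point equation in which \<open>d l - d k \<noteq> 0\<close> is divided out.\<close>

lemma eigenvector_perturb:
  obtains w \<mu> where "M *v w = \<mu> *s w" "mcoeff \<mu> {#} = d k"
    "\<And>l. mcoeff (w $ l) {#} = (if l = k then 1 else 0)"
proof -
  define T where "T f l = (if l = k then 1 else
    mconst (1 / (d l - d k)) * (f l * offd (\<chi> i. f i) k - offd (\<chi> i. f i) l))" for f l
  obtain f where f: "T f = f"
  proof (rule contraction_fixpoint[of "\<lambda>_. True" T])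
    fix f g :: "'n \<Rightarrow> 'v mseries" and n l
    assume *: "\<And>i. ord_ge (f i - g i) n"
    let ?f = "\<chi> i. f i" and ?g = "\<chi> i. g i"
    have off: "ord_ge (offd ?f j - offd ?g j) (Suc n)" for j
      unfolding offd_diff[symmetric] by (rule ord_offd) (simp add: *)
    have "ord_ge (f l * offd ?f k - g l * offd ?g k) (Suc n)"
    proof -
      have "f l * offd ?f k - g l * offd ?g k
          = (f l - g l) * offd ?f k + g l * (offd ?f k - offd ?g k)"
        by (simp add: algebra_simps)
      moreover have "ord_ge ((f l - g l) * offd ?f k) (n + 1)"
        by (rule ord_ge_mult[OF *]) (simp add: ord_ge_1_iff[simplified] offd_const)
      ultimately show ?thesis using off by (auto intro: ord_ge_add ord_ge_mult2)
    qed
    then have "ord_ge (mconst (1 / (d l - d k)) * ((f l * offd ?f k - g l * offd ?g k)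
        - (offd ?f l - offd ?g l))) (Suc n)"
      using off by (auto intro!: ord_ge_mult2 intro: ord_ge_diff)
    then show "ord_ge (T f l - T g l) (Suc n)"
      by (simp add: T_def algebra_simps)
  qed auto
  define w where "w = (\<chi> i. f i)"
  have wk: "w $ k = 1" using fun_cong[OF f, of k] by (simp add: w_def T_def)
  have wl: "w $ l = mconst (1 / (d l - d k)) * (w $ l * offd w k - offd w l)" if "l \<noteq> k" for l
    using fun_cong[OF f, of l] that by (simp add: w_def T_def)
  show thesis
  proof (rule that[of w "mconst (d k) + offd w k"])
    have "(M *v w) $ l = (mconst (d k) + offd w k) * w $ l" for l
    proof (cases "l = k")
      case False
      have "mconst (d l - d k) * w $ l = w $ l * offd w k - offd w l"
        using wl[OF False] mconst_cancel'[OF False] by metis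
      then show ?thesis by (simp add: split_diag mconst_diff algebra_simps)
    qed (simp add: split_diag wk)
    then show "M *v w = (mconst (d k) + offd w k) *s w" by (simp add: vec_eq_iff distrib_right)
    show "mcoeff (mconst (d k) + offd w k) {#} = d k" by (simp add: mcoeff_mconst offd_const)
    show "mcoeff (w $ l) {#} = (if l = k then 1 else 0)" for l
    proof (cases "l = k")
      case False
      then show ?thesis by (subst wl) (simp_all add: offd_const)
    qed (simp add: wk mcoeff_1)
  qed
qed

lemma shifted_component:
  "(M *v s - \<mu> *s s) $ l = mconst (d l - d k) * s $ l + offd s l - (\<mu> - mconst (d k)) * s $ l"
  by (simp add: split_diag mconst_diff algebra_simps)

text \<open>At the origin the shifted matrix is diagonal with its only zero in position \<open>k\<close>, so the remaining
  rows can be solved order by order with \<open>s $ k = 0\<close>.\<close>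

lemma shifted_solve:
  assumes "mcoeff \<mu> {#} = d k"
  obtains s where "\<And>l. l \<noteq> k \<Longrightarrow> (M *v s - \<mu> *s s) $ l = y $ l"
proof -
  have \<mu>: "ord_ge (\<mu> - mconst (d k)) 1"
    using assms by (simp add: ord_ge_1_iff[simplified] mcoeff_mconst)
  define T where "T f l = (if l = k then 0 else
    mconst (1 / (d l - d k)) * (y $ l - offd (\<chi> i. f i) l + (\<mu> - mconst (d k)) * f l))" for f l
  obtain f where f: "T f = f"
  proof (rule contraction_fixpoint[of "\<lambda>_. True" T])
    fix f g :: "'n \<Rightarrow> 'v mseries" and n l
    assume *: "\<And>i. ord_ge (f i - g i) n"
    let ?f = "\<chi> i. f i" and ?g = "\<chi> i. g i"
    have off: "ord_ge (offd ?f l - offd ?g l) (Suc n)"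
      unfolding offd_diff[symmetric] by (rule ord_offd) (simp add: *)
    have "ord_ge (mconst (1 / (d l - d k)) * ((\<mu> - mconst (d k)) * (f l - g l)
        - (offd ?f l - offd ?g l))) (Suc n)"
      using ord_ge_mult[OF \<mu> *[of l]] off by (auto intro!: ord_ge_mult2 intro: ord_ge_diff)
    then show "ord_ge (T f l - T g l) (Suc n)"
      by (simp add: T_def algebra_simps)
  qed auto
  show thesis
  proof (rule that)
    fix l assume l: "l \<noteq> k"
    have "f l = mconst (1 / (d l - d k)) * (y $ l - offd (\<chi> i. f i) l + (\<mu> - mconst (d k)) * f l)"
      using fun_cong[OF f, of l] l by (simp add: T_def)
    then have "mconst (d l - d k) * f l = y $ l - offd (\<chi> i. f i) l + (\<mu> - mconst (d k)) * f l"
      using mconst_cancel'[OF l] by metis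
    then show "(M *v (\<chi> i. f i) - \<mu> *s (\<chi> i. f i)) $ l = y $ l"
      unfolding shifted_component by simp
  qed
qed

text \<open>The rows other than \<open>k\<close> of the kernel equation, together with the covector, have an invertible
  diagonal matrix at the origin; each use of them raises the order of \<open>u\<close> by one.\<close>

lemma shifted_kernel:
  assumes \<mu>: "mcoeff \<mu> {#} = d k" and ker: "M *v u = \<mu> *s u" and lu: "dotp l u = 0"
    and l: "\<And>i. mcoeff (l $ i) {#} = (if i = k then 1 else 0)"
  shows "u = 0"
proof -
  have \<mu>': "ord_ge (\<mu> - mconst (d k)) 1"
    using \<mu> by (simp add: ord_ge_1_iff[simplified] mcoeff_mconst)
  have "ord_ge (u $ i) n" for i n
  proof (induction n arbitrary: i)
    case (Suc n)
    show ?case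
    proof (cases "i = k")
      case False
      have "mconst (d i - d k) * u $ i = (\<mu> - mconst (d k)) * u $ i - offd u i"
        using shifted_component[of u \<mu> i] ker by (simp add: algebra_simps)
      moreover have "ord_ge ((\<mu> - mconst (d k)) * u $ i) (Suc n)"
        using ord_ge_mult[OF \<mu>' Suc] by simp
      ultimately have "ord_ge (mconst (1 / (d i - d k)) * (mconst (d i - d k) * u $ i)) (Suc n)"
        using ord_offd[OF Suc] by (auto intro: ord_ge_mult2 ord_ge_diff)
      then show ?thesis by (simp add: mconst_cancel[OF False])
    next
      case True
      have "u $ k = dotp l u - (\<Sum>j\<in>UNIV. (l $ j - mconst (if j = k then 1 else 0)) * u $ j)"
        by (simp add: dotp_def left_diff_distrib sum_subtractf if_distrib[of mconst] if_distribR
            if_distrib[of "\<lambda>x. x * _"] cong: if_cong)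
      moreover have "ord_ge (\<Sum>j\<in>UNIV. (l $ j - mconst (if j = k then 1 else 0)) * u $ j) (Suc n)"
      proof (rule ord_ge_sum)
        fix j
        have "ord_ge (l $ j - mconst (if j = k then 1 else 0)) 1"
          by (simp add: ord_ge_1_iff[simplified] l mcoeff_mconst)
        from ord_ge_mult[OF this Suc]
        show "ord_ge ((l $ j - mconst (if j = k then 1 else 0)) * u $ j) (Suc n)" by simp
      qed
      ultimately show ?thesis using True lu by simp
    qed
  qed simp
  then show ?thesis by (simp add: vec_eq_iff ord_ge_all_eq_0)
qed

end


subsection \<open>Closed commuting families\<close>

lemma linear_sum_mv: "M *v (\<Sum>i\<in>S. f i) = (\<Sum>i\<in>S. M *v (f i :: 'a::comm_ring_1 ^ 'n))"
  by (induction S rule: infinite_finite_induct) (auto simp: matrix_vector_right_distrib)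

text \<open>These are the conditions for \<open>\<partial>\<^sub>\<gamma> - M \<gamma> / z\<close> to be a flat connection for every \<open>z\<close>, together with
  diagonality at the origin and a direction \<open>x\<close> in which the eigenvalues there are distinct.\<close>

locale closed_commuting_family =
  fixes M :: "'n::finite \<Rightarrow> 'n mseries ^ 'n ^ 'n" and d :: "'n \<Rightarrow> 'n \<Rightarrow> complex"
    and x :: "'n \<Rightarrow> complex"
  assumes comm: "M \<gamma> ** M \<delta> = M \<delta> ** M \<gamma>"
    and closed: "mat_deriv \<delta> (M \<gamma>) = mat_deriv \<gamma> (M \<delta>)"
    and diag: "mcoeff (M \<gamma> $ i $ j) {#} = (if i = j then d \<gamma> i else 0)"
    and sep: "inj (\<lambda>i. \<Sum>\<gamma>\<in>UNIV. x \<gamma> * d \<gamma> i)"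
begin

definition MX :: "'n mseries ^ 'n ^ 'n" where
  "MX = (\<chi> i j. \<Sum>\<gamma>\<in>UNIV. mconst (x \<gamma>) * M \<gamma> $ i $ j)"

abbreviation dX :: "'n \<Rightarrow> complex" where
  "dX i \<equiv> \<Sum>\<gamma>\<in>UNIV. x \<gamma> * d \<gamma> i"

lemma diagX: "mcoeff (MX $ i $ j) {#} = (if i = j then dX i else 0)"
  by (simp add: MX_def diag mcoeff_mconst)

lemma MX_mult: "MX *v w = (\<Sum>\<gamma>\<in>UNIV. mconst (x \<gamma>) *s (M \<gamma> *v w))"
  unfolding MX_def
  by (simp add: vec_eq_iff matrix_vector_mult_def sum_distrib_left sum_distrib_right mult_ac,
      rule allI, rule sum.swap)

lemma MX_commute: "MX *v (M \<gamma> *v w) = M \<gamma> *v (MX *v w)"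
proof -
  have "M \<gamma> *v (MX *v w) = (\<Sum>\<delta>\<in>UNIV. M \<gamma> *v (mconst (x \<delta>) *s (M \<delta> *v w)))"
    unfolding MX_mult by (rule linear_sum_mv)
  also have "\<dots> = MX *v (M \<gamma> *v w)"
    unfolding MX_mult by (simp add: matrix_vector_scale matrix_vector_mul_assoc comm)
  finally show ?thesis by simp
qed

text \<open>All members of the family commute with the member in the direction \<open>x\<close>, whose eigenspaces are
  lines.\<close>

lemma joint_eigenvector:
  obtains w \<mu> where "\<And>\<gamma>. M \<gamma> *v w = \<mu> \<gamma> *s w" "\<And>\<gamma>. mcoeff (\<mu> \<gamma>) {#} = d \<gamma> k"
    "\<And>l. mcoeff (w $ l) {#} = (if l = k then 1 else 0)"
proof -
  obtain w0 \<mu>X where w0: "MX *v w0 = \<mu>X *s w0" and \<mu>X: "mcoeff \<mu>X {#} = dX k"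
    and w0c: "\<And>l. mcoeff (w0 $ l) {#} = (if l = k then 1 else 0)"
    using eigenvector_perturb[OF diagX sep] by metis
  have "mcoeff (w0 $ k) {#} \<noteq> 0" using w0c by simp
  then obtain g where g: "w0 $ k * g = 1" using mseries_inverse by blast
  have gc: "mcoeff g {#} = 1" using arg_cong[OF g, of "\<lambda>f. mcoeff f {#}"] w0c by (simp add: mcoeff_1)
  define w where "w = g *s w0"
  have w: "MX *v w = \<mu>X *s w" by (simp add: w_def matrix_vector_scale w0 mult.commute)
  have wk: "w $ k = 1" using g by (simp add: w_def mult.commute)
  have wc: "mcoeff (w $ l) {#} = (if l = k then 1 else 0)" for l
    by (simp add: w_def w0c gc)
  have eig: "M \<gamma> *v w = ((M \<gamma> *v w) $ k) *s w" for \<gamma>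
  proof -
    define y where "y = M \<gamma> *v w"
    have y: "MX *v y = \<mu>X *s y"
      unfolding y_def by (simp add: MX_commute w matrix_vector_scale)
    have "y - y $ k *s w = 0"
    proof (rule shifted_kernel[OF diagX sep \<mu>X])
      show "MX *v (y - y $ k *s w) = \<mu>X *s (y - y $ k *s w)"
        by (simp add: matrix_vector_mult_diff_distrib y w matrix_vector_scale vec_scale_diff mult.commute)
      show "dotp (axis k 1) (y - y $ k *s w) = 0"
        by (simp add: dotp_def axis_def wk if_distrib[of "\<lambda>z. z * _"] cong: if_cong)
      show "mcoeff (axis k 1 $ i) {#} = (if i = k then 1 else 0)" for i
        by (simp add: axis_def mcoeff_1)
    qed
    then show ?thesis by (simp add: y_def)
  qed
  show thesis
  proof (rule that[OF eig _ wc])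
    show "mcoeff ((M \<gamma> *v w) $ k) {#} = d \<gamma> k" for \<gamma>
      by (simp add: matrix_vector_mult_def diag wc if_distrib cong: if_cong)
  qed
qed

lemma transposed: "closed_commuting_family (\<lambda>\<gamma>. transpose (M \<gamma>)) d x"
proof
  show "transpose (M \<gamma>) ** transpose (M \<delta>) = transpose (M \<delta>) ** transpose (M \<gamma>)" for \<gamma> \<delta>
    unfolding matrix_transpose_mul[symmetric] by (simp add: comm)
  show "mat_deriv \<delta> (transpose (M \<gamma>)) = mat_deriv \<gamma> (transpose (M \<delta>))" for \<gamma> \<delta>
    using closed[of \<delta> \<gamma>] by (simp add: mat_deriv_def transpose_def vec_eq_iff)
  show "mcoeff (transpose (M \<gamma>) $ i $ j) {#} = (if i = j then d \<gamma> i else 0)" for \<gamma> i j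
    by (simp add: transpose_def diag)
qed (rule sep)

end


text \<open>The covector \<open>l\<close> detects the obstruction to inverting the operators \<open>M \<gamma> - \<mu> \<gamma>\<close>, whose common
  kernel is spanned by \<open>w\<close>.\<close>

locale eigenpair = closed_commuting_family M d x
  for M :: "'n::finite \<Rightarrow> 'n mseries ^ 'n ^ 'n" and d x +
  fixes k :: 'n and \<mu> :: "'n \<Rightarrow> 'n mseries" and w l :: "'n mseries ^ 'n"
  assumes eig: "M \<gamma> *v w = \<mu> \<gamma> *s w" and left: "l v* M \<gamma> = \<mu> \<gamma> *s l"
    and lw: "dotp l w = 1"
    and wc: "mcoeff (w $ i) {#} = (if i = k then 1 else 0)"
    and lc: "mcoeff (l $ i) {#} = (if i = k then 1 else 0)"
    and \<mu>c: "mcoeff (\<mu> \<gamma>) {#} = d \<gamma> k"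
begin

definition Q :: "'n \<Rightarrow> 'n mseries ^ 'n \<Rightarrow> 'n mseries ^ 'n" where
  "Q \<gamma> u = M \<gamma> *v u - \<mu> \<gamma> *s u"

definition Q' :: "'n \<Rightarrow> 'n \<Rightarrow> 'n mseries ^ 'n \<Rightarrow> 'n mseries ^ 'n" where
  "Q' \<delta> \<gamma> u = mat_deriv \<delta> (M \<gamma>) *v u - mderiv \<delta> (\<mu> \<gamma>) *s u"

lemma Q_w [simp]: "Q \<gamma> w = 0" by (simp add: Q_def eig)

lemma Q_diff: "Q \<gamma> (u - v) = Q \<gamma> u - Q \<gamma> v"
  and Q_add: "Q \<gamma> (u + v) = Q \<gamma> u + Q \<gamma> v"
  and Q_scale: "Q \<gamma> (c *s u) = c *s Q \<gamma> u"
  by (simp_all add: Q_def matrix_vector_mult_diff_distrib matrix_vector_right_distrib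
      matrix_vector_scale vec_scale_diff mult.commute)

lemma Q_sum: "Q \<gamma> (\<Sum>i\<in>S. f i) = (\<Sum>i\<in>S. Q \<gamma> (f i))"
  by (induction S rule: infinite_finite_induct) (auto simp: Q_add, simp_all add: Q_def)

lemma Q_commute: "Q \<gamma> (Q \<delta> u) = Q \<delta> (Q \<gamma> u)"
  using comm[of \<gamma> \<delta>]
  by (simp add: Q_def matrix_vector_mult_diff_distrib matrix_vector_mul_assoc matrix_vector_scale
      vec_scale_diff mult.commute algebra_simps)

lemma l_Q [simp]: "dotp l (Q \<gamma> u) = 0"
  by (simp add: Q_def dotp_diff dotp_matrix left dotp_scale dotp_scale_left)

lemma vderiv_Q: "vderiv \<delta> (Q \<gamma> u) = Q' \<delta> \<gamma> u + Q \<gamma> (vderiv \<delta> u)"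
  by (simp add: Q_def Q'_def vderiv_diff vderiv_mult vderiv_scale algebra_simps)

lemma dl_Q: "dotp (vderiv \<delta> l) (Q \<gamma> u) = - dotp l (Q' \<delta> \<gamma> u)"
proof -
  have "0 = mderiv \<delta> (dotp l (Q \<gamma> u))" by simp
  also have "\<dots> = dotp (vderiv \<delta> l) (Q \<gamma> u) + dotp l (Q' \<delta> \<gamma> u)"
    unfolding mderiv_dotp vderiv_Q dotp_add by simp
  finally show ?thesis by (simp add: eq_neg_iff_add_eq_0)
qed

text \<open>The eigenvalue form is closed, because the flatness of the family forces the antisymmetric part
  of its derivative to act on \<open>w\<close> by an element of the image of the \<open>Q\<close>'s, which \<open>l\<close> kills.\<close>

lemma \<mu>_closed: "mderiv \<delta> (\<mu> \<gamma>) = mderiv \<gamma> (\<mu> \<delta>)"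
proof -
  have 1: "Q' \<delta> \<gamma> w + Q \<gamma> (vderiv \<delta> w) = 0" for \<gamma> \<delta>
    unfolding vderiv_Q[symmetric] by simp
  have 2: "dotp l (Q' \<delta> \<gamma> w) = 0" for \<gamma> \<delta>
    using arg_cong[OF 1[of \<delta> \<gamma>], of "dotp l"] by (simp add: dotp_add)
  have "dotp l (Q' \<delta> \<gamma> w - Q' \<gamma> \<delta> w) = 0" by (simp add: dotp_diff 2)
  moreover have "Q' \<delta> \<gamma> w - Q' \<gamma> \<delta> w = (mderiv \<gamma> (\<mu> \<delta>) - mderiv \<delta> (\<mu> \<gamma>)) *s w"
    by (simp add: Q'_def closed[of \<delta> \<gamma>] vec_eq_iff algebra_simps)
  ultimately have "(mderiv \<gamma> (\<mu> \<delta>) - mderiv \<delta> (\<mu> \<gamma>)) * dotp l w = 0" by (simp only: dotp_scale)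
  then show ?thesis by (simp add: lw)
qed

lemma Q'_sym: "Q' \<delta> \<gamma> u = Q' \<gamma> \<delta> u"
  by (simp add: Q'_def closed[of \<delta> \<gamma>] \<mu>_closed[of \<delta> \<gamma>])

definition \<mu>X :: "'n mseries" where "\<mu>X = (\<Sum>\<gamma>\<in>UNIV. mconst (x \<gamma>) * \<mu> \<gamma>)"

lemma \<mu>Xc: "mcoeff \<mu>X {#} = dX k"
  by (simp add: \<mu>X_def \<mu>c mcoeff_mconst)

lemma QX: "MX *v u - \<mu>X *s u = (\<Sum>\<gamma>\<in>UNIV. mconst (x \<gamma>) *s Q \<gamma> u)"
proof -
  have "\<mu>X *s u = (\<Sum>\<gamma>\<in>UNIV. mconst (x \<gamma>) *s (\<mu> \<gamma> *s u))"
    by (simp add: \<mu>X_def vec_eq_iff sum_distrib_right mult.assoc)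
  then show ?thesis by (simp add: MX_mult Q_def vec_scale_diff sum_subtractf)
qed

text \<open>Exactness of the Koszul complex of the operators \<open>Q\<close> in degree one, up to multiples of \<open>w\<close>. The
  equation is solved in the direction \<open>x\<close>, where \<open>l\<close> accounts for the row \<open>k\<close>. The defect in any other
  direction then lies in the kernel of \<open>l\<close> and of the operator in the direction \<open>x\<close>, so it vanishes.\<close>

lemma koszul:
  assumes sym: "\<And>\<gamma> \<delta>. Q \<delta> (y \<gamma>) = Q \<gamma> (y \<delta>)"
  obtains s where "\<And>\<gamma>. y \<gamma> = Q \<gamma> s + dotp l (y \<gamma>) *s w"
proof -
  define yX where "yX = (\<Sum>\<gamma>\<in>UNIV. mconst (x \<gamma>) *s y \<gamma>)"
  define b where "b = yX - dotp l yX *s w"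
  obtain s where s: "\<And>i. i \<noteq> k \<Longrightarrow> (MX *v s - \<mu>X *s s) $ i = b $ i"
    using shifted_solve[OF diagX sep \<mu>Xc] by blast
  define e where "e = (MX *v s - \<mu>X *s s) - b"
  have ei: "e $ i = 0" if "i \<noteq> k" for i
    using s[OF that] by (simp add: e_def)
  have l_QX: "dotp l (MX *v u - \<mu>X *s u) = 0" for u
  proof -
    have "dotp l (\<Sum>\<gamma>\<in>S. mconst (x \<gamma>) *s Q \<gamma> u) = 0" for S
      by (induction S rule: infinite_finite_induct) (auto simp: dotp_add dotp_scale)
    then show ?thesis unfolding QX .
  qed
  have "dotp l b = 0" by (simp add: b_def dotp_diff dotp_scale lw)
  then have "dotp l e = 0" unfolding e_def dotp_diff[of l _ b] l_QX by simp
  moreover have "dotp l e = l $ k * e $ k"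
    unfolding dotp_def by (subst sum.mono_neutral_right[of _ "{k}"]) (auto simp: ei)
  moreover obtain g where "l $ k * g = 1" using mseries_inverse[of "l $ k"] lc by auto
  ultimately have "e $ k = 0" by (metis mult.assoc mult.commute mult_1 mult_zero_right)
  then have "e = 0" using ei by (metis vec_eq_iff zero_index)
  then have QXs: "MX *v s - \<mu>X *s s = b" by (simp add: e_def)
  have "y \<gamma> - Q \<gamma> s - dotp l (y \<gamma>) *s w = 0" for \<gamma>
  proof (rule shifted_kernel[OF diagX sep \<mu>Xc _ _ lc])
    let ?u = "y \<gamma> - Q \<gamma> s - dotp l (y \<gamma>) *s w"
    have "MX *v ?u - \<mu>X *s ?u = (\<Sum>\<delta>\<in>UNIV. mconst (x \<delta>) *s Q \<gamma> (y \<delta> - Q \<delta> s))"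
      unfolding QX by (simp add: Q_diff Q_scale sym[of _ \<gamma>] Q_commute[of _ \<gamma>])
    also have "\<dots> = Q \<gamma> (yX - (MX *v s - \<mu>X *s s))"
      unfolding QX yX_def by (simp add: Q_sum[symmetric] Q_scale[symmetric] sum_subtractf[symmetric]
          vec_scale_diff)
    also have "\<dots> = 0" unfolding QXs b_def by (simp add: Q_diff Q_scale)
    finally show "MX *v ?u = \<mu>X *s ?u" by simp
    show "dotp l ?u = 0" by (simp add: dotp_diff dotp_scale lw)
  qed
  then have "y \<gamma> = Q \<gamma> s + dotp l (y \<gamma>) *s w" for \<gamma> by (metis diff_diff_eq eq_iff_diff_eq_0)
  then show thesis by (rule that)
qed

lemma l_dw: "dotp (vderiv \<delta> l) w = - dotp l (vderiv \<delta> w)"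
  using mderiv_dotp[of \<delta> l w] by (simp add: lw eq_neg_iff_add_eq_0)

lemma dw_sym: "Q \<delta> (vderiv \<gamma> w) = Q \<gamma> (vderiv \<delta> w)"
  using vderiv_Q[of \<delta> \<gamma> w] vderiv_Q[of \<gamma> \<delta> w] Q'_sym[of \<delta> \<gamma> w]
  by (metis Q_w add_left_cancel vderiv_zero)

text \<open>The form \<open>l \<cdot> dw\<close> is closed: by Koszul exactness its derivative is symmetric up to the product of two
  components of the form, which is symmetric as well. Rescaling \<open>w\<close> by the exponential of minus a
  primitive, and \<open>l\<close> inversely, removes it.\<close>

lemma parallel_normalisation:
  obtains w' l' where "eigenpair M d x k \<mu> w' l'" "\<And>\<gamma>. dotp l' (vderiv \<gamma> w') = 0"
proof -
  define \<omega> where "\<omega> \<gamma> = dotp l (vderiv \<gamma> w)" for \<gamma>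
  obtain s where s: "\<And>\<gamma>. vderiv \<gamma> w = Q \<gamma> s + \<omega> \<gamma> *s w"
    unfolding \<omega>_def by (rule koszul[of "\<lambda>\<gamma>. vderiv \<gamma> w"]) (auto intro: dw_sym)
  have "mderiv \<delta> (\<omega> \<gamma>) = mderiv \<gamma> (\<omega> \<delta>)" for \<gamma> \<delta>
  proof -
    have "dotp (vderiv \<delta> l) (vderiv \<gamma> w) = - dotp l (Q' \<delta> \<gamma> s) - \<omega> \<gamma> * \<omega> \<delta>" for \<gamma> \<delta>
      unfolding s[of \<gamma>] by (simp add: dotp_add dotp_scale dl_Q l_dw \<omega>_def)
    then show ?thesis
      by (simp add: \<omega>_def mderiv_dotp Q'_sym[of \<delta> \<gamma>] mult.commute vderiv_commute[of \<delta> \<gamma>])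
  qed
  then obtain \<phi> where \<phi>: "mcoeff \<phi> {#} = 0" "\<And>\<gamma>. mderiv \<gamma> \<phi> = \<omega> \<gamma>"
    using formal_poincare by metis
  define h h' where "h = mexp (- \<phi>)" and "h' = mexp \<phi>"
  have hh: "h * h' = 1" by (simp add: h_def h'_def mexp_uminus \<phi>)
  have dh: "mderiv \<gamma> h = - (h * \<omega> \<gamma>)" for \<gamma>
    by (simp add: h_def mderiv_mexp \<phi> mderiv_uminus)
  show thesis
  proof (rule that)
    show "eigenpair M d x k \<mu> (h *s w) (h' *s l)"
    proof
      show "dotp (h' *s l) (h *s w) = 1"
        using hh by (simp add: dotp_scale dotp_scale_left lw mult.commute)
    qed (simp_all add: matrix_vector_scale vector_matrix_scale eig left mult.commute wc lc \<mu>c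
        h_def h'_def \<phi>)
    show "dotp (h' *s l) (vderiv \<gamma> (h *s w)) = 0" for \<gamma>
      by (simp add: vderiv_scale dh dotp_add dotp_scale dotp_scale_left lw \<omega>_def[symmetric])
  qed
qed

end

lemma (in closed_commuting_family) eigenpair_exists:
  obtains \<mu> w l where "eigenpair M d x k \<mu> w l"
proof -
  obtain w \<mu> where w: "\<And>\<gamma>. M \<gamma> *v w = \<mu> \<gamma> *s w" "\<And>\<gamma>. mcoeff (\<mu> \<gamma>) {#} = d \<gamma> k"
    "\<And>i. mcoeff (w $ i) {#} = (if i = k then 1 else 0)" using joint_eigenvector by metis
  obtain l \<nu> where l: "\<And>\<gamma>. l v* M \<gamma> = \<nu> \<gamma> *s l"
    "\<And>i. mcoeff (l $ i) {#} = (if i = k then 1 else 0)"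
    using closed_commuting_family.joint_eigenvector[OF transposed]
    by (metis transpose_matrix_vector)
  have c: "mcoeff (dotp l w) {#} = 1"
    by (simp add: dotp_def w l if_distrib cong: if_cong)
  then obtain g where g: "dotp l w * g = 1" using mseries_inverse[of "dotp l w"] by auto
  have gc: "mcoeff g {#} = 1" using arg_cong[OF g, of "\<lambda>f. mcoeff f {#}"] c by (simp add: mcoeff_1)
  have "\<nu> \<gamma> = \<mu> \<gamma>" for \<gamma>
  proof -
    have "\<nu> \<gamma> * dotp l w = \<mu> \<gamma> * dotp l w"
      using dotp_matrix[of l "M \<gamma>" w] by (simp add: w l dotp_scale dotp_scale_left)
    then show ?thesis using g by (metis mult.assoc mult_1_right)
  qed
  then have "eigenpair M d x k \<mu> (g *s w) l"
    using w l g gc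
    by unfold_locales (simp_all add: matrix_vector_scale mult.commute dotp_scale)
  then show thesis by (rule that)
qed

text \<open>The coefficients of a formal solution \<open>exp (u / z) * (\<Sum>j. r j * z ^ j)\<close> of \<open>z \<partial>\<^sub>\<gamma> \<psi> = M \<gamma> \<psi>\<close>. Each step
  solves \<open>\<partial>\<^sub>\<gamma> (r j) = Q \<gamma> (r (j + 1))\<close> by Koszul exactness. The multiple of \<open>w\<close> that remains free in
  \<open>r (j + 1)\<close> is chosen, by the Poincare lemma, so that \<open>l\<close> kills the derivative of \<open>r (j + 1)\<close>, which
  is the solvability condition for the following step.\<close>

theorem (in closed_commuting_family) formal_asymptotic_solution:
  obtains u r where "mcoeff u {#} = 0" "\<And>\<gamma>. mcoeff (mderiv \<gamma> u) {#} = d \<gamma> k"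
    "\<And>i. mcoeff (r 0 $ i) {#} = (if i = k then 1 else 0)"
    "\<And>\<gamma>. M \<gamma> *v r 0 = mderiv \<gamma> u *s r 0"
    "\<And>\<gamma> j. vderiv \<gamma> (r j) = M \<gamma> *v r (Suc j) - mderiv \<gamma> u *s r (Suc j)"
proof -
  obtain \<mu> w l where "eigenpair M d x k \<mu> w l" by (rule eigenpair_exists)
  then obtain w l where "eigenpair M d x k \<mu> w l" and par: "\<And>\<gamma>. dotp l (vderiv \<gamma> w) = 0"
    using eigenpair.parallel_normalisation by blast
  then interpret eigenpair M d x k \<mu> w l by simp
  obtain u where u: "mcoeff u {#} = 0" "\<And>\<gamma>. mderiv \<gamma> u = \<mu> \<gamma>"
    using formal_poincare[OF \<mu>_closed] by metis
  define good where "good r \<longleftrightarrow> (\<forall>\<gamma> \<delta>. Q \<delta> (vderiv \<gamma> r) = Q \<gamma> (vderiv \<delta> r))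
    \<and> (\<forall>\<gamma>. dotp l (vderiv \<gamma> r) = 0)" for r
  have step: "\<exists>r'. good r' \<and> (\<forall>\<gamma>. vderiv \<gamma> r = Q \<gamma> r')" if r: "good r" for r
  proof -
    obtain s where s: "\<And>\<gamma>. vderiv \<gamma> r = Q \<gamma> s"
    proof (rule koszul[of "\<lambda>\<gamma>. vderiv \<gamma> r"])
      show "Q \<delta> (vderiv \<gamma> r) = Q \<gamma> (vderiv \<delta> r)" for \<gamma> \<delta> using r by (simp add: good_def)
    qed (use r that in \<open>auto simp: good_def\<close>)
    have sym: "Q \<delta> (vderiv \<gamma> t) = Q \<gamma> (vderiv \<delta> t)" if "\<And>\<gamma>. vderiv \<gamma> r = Q \<gamma> t" for t \<gamma> \<delta>
      using vderiv_Q[of \<gamma> \<delta> t] vderiv_Q[of \<delta> \<gamma> t] Q'_sym[of \<delta> \<gamma> t] vderiv_commute[of \<gamma> \<delta> r]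
      unfolding that[symmetric] by simp
    obtain s' where s': "\<And>\<gamma>. vderiv \<gamma> s = Q \<gamma> s' + dotp l (vderiv \<gamma> s) *s w"
      using koszul[of "\<lambda>\<gamma>. vderiv \<gamma> s"] sym[OF s] by metis
    have dl: "dotp (vderiv \<delta> l) (vderiv \<gamma> s) = - dotp l (Q' \<delta> \<gamma> s')" for \<gamma> \<delta>
      by (subst s') (simp add: dotp_add dotp_scale dl_Q l_dw par)
    have "mderiv \<delta> (- dotp l (vderiv \<gamma> s)) = mderiv \<gamma> (- dotp l (vderiv \<delta> s))" for \<gamma> \<delta>
      by (simp add: mderiv_uminus mderiv_dotp dl Q'_sym[of \<delta> \<gamma>] vderiv_commute[of \<delta> \<gamma>])
    then obtain a where a: "\<And>\<gamma>. mderiv \<gamma> a = - dotp l (vderiv \<gamma> s)"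
      using formal_poincare[of "\<lambda>\<gamma>. - dotp l (vderiv \<gamma> s)"] by metis
    have t: "vderiv \<gamma> r = Q \<gamma> (s + a *s w)" for \<gamma> by (simp add: s Q_add Q_scale)
    have "good (s + a *s w)"
      unfolding good_def
      using sym[OF t] by (simp add: vderiv_add vderiv_scale dotp_add dotp_scale a lw par)
    then show ?thesis using t by blast
  qed
  have "good w" by (simp add: good_def par dw_sym)
  then have "\<exists>r. r 0 = w \<and> (\<forall>n. good (r n) \<and> (\<forall>\<gamma>. vderiv \<gamma> (r n) = Q \<gamma> (r (Suc n))))"
    using dependent_nat_choice[of "\<lambda>n r. good r \<and> (n = 0 \<longrightarrow> r = w)"
        "\<lambda>n r r'. \<forall>\<gamma>. vderiv \<gamma> r = Q \<gamma> r'"] step by (metis nat.distinct(1))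
  then obtain r where "r 0 = w" "\<And>n \<gamma>. vderiv \<gamma> (r n) = Q \<gamma> (r (Suc n))" by blast
  then show thesis using u by (intro that[of u r]) (simp_all add: \<mu>c wc eig Q_def)
qed


section \<open>Loop operators\<close>

definition Msum :: "('i \<Rightarrow> 'v mseries ^ 'p ^ 'q) \<Rightarrow> 'v mseries ^ 'p ^ 'q" where
  "Msum g = (\<chi> i j. msum (\<lambda>n. g n $ i $ j))"

definition Lfin :: "('i \<Rightarrow> 'v mseries ^ 'p ^ 'q) \<Rightarrow> bool" where
  "Lfin g \<longleftrightarrow> (\<forall>i j. lfin (\<lambda>n. g n $ i $ j))"

definition Msubst :: "('u \<Rightarrow> 'v mseries) \<Rightarrow> 'u mseries ^ 'p ^ 'q \<Rightarrow> 'v mseries ^ 'p ^ 'q" where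
  "Msubst s M = (\<chi> i j. msubst s (M $ i $ j))"

definition smat :: "'a::comm_ring_1 \<Rightarrow> 'a ^ 'p ^ 'q \<Rightarrow> 'a ^ 'p ^ 'q" where
  "smat c M = (\<chi> i j. c * M $ i $ j)"

definition cmat :: "complex ^ 'p ^ 'q \<Rightarrow> 'v mseries ^ 'p ^ 'q" where
  "cmat M = (\<chi> i j. mconst (M $ i $ j))"

definition Deg :: "('n \<times> nat) mseries ^ 'p ^ 'q \<Rightarrow> int \<Rightarrow> bool" where
  "Deg M n \<longleftrightarrow> (\<forall>i j. deg_le (M $ i $ j) n)"

definition Ord :: "'v mseries ^ 'p ^ 'q \<Rightarrow> nat \<Rightarrow> bool" where
  "Ord M n \<longleftrightarrow> (\<forall>i j. ord_ge (M $ i $ j) n)"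

lemma matrix_mult_nth: "(A ** B) $ i $ j = (\<Sum>k\<in>UNIV. A $ i $ k * B $ k $ j)"
  by (simp add: matrix_matrix_mult_def)

lemma mat_eqI: "(\<And>i j. A $ i $ j = B $ i $ j) \<Longrightarrow> A = B"
  by (simp add: vec_eq_iff)

lemma matrix_zero_mult [simp]: "A ** 0 = 0"
  by (simp add: matrix_matrix_mult_def vec_eq_iff)

lemma matrix_distrib:
  "A ** (B + C) = A ** B + A ** (C :: 'a::ring_1 ^ 'p ^ 'q)"
  "(A' + B') ** C' = A' ** C' + B' ** (C' :: 'a::ring_1 ^ 'p ^ 'q)"
  "A ** (B - C) = A ** B - A ** C"
  "(A' - B') ** C' = A' ** C' - B' ** C'"
  by (simp_all add: matrix_matrix_mult_def vec_eq_iff algebra_simps sum.distrib sum_subtractf)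

lemma matrix_uminus_mult [simp]:
  "(- A) ** B = - (A ** (B :: 'a::ring_1 ^ 'p ^ 'q))" "A ** (- B) = - (A ** B)"
  by (simp_all add: matrix_matrix_mult_def vec_eq_iff sum_negf)

lemma matrix_sum_mult:
  "A ** (\<Sum>n\<in>S. f n) = (\<Sum>n\<in>S. A ** (f n :: 'a::ring_1 ^ 'p ^ 'q))"
  "(\<Sum>n\<in>S. g n) ** B = (\<Sum>n\<in>S. g n ** (B :: 'a::ring_1 ^ 'p ^ 'q))"
  by (induction S rule: infinite_finite_induct) (simp_all add: matrix_distrib)

lemma smat_mult: "smat c (A ** B) = smat c A ** B" "smat c (A ** B) = A ** smat c B"
  by (simp_all add: smat_def matrix_matrix_mult_def vec_eq_iff sum_distrib_left mult_ac)

lemma smat_add: "smat c (A + B) = smat c A + smat c B"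
  and smat_smat [simp]: "smat c (smat e A) = smat (c * e) A"
  and smat_one [simp]: "smat 1 A = A"
  and smat_zero [simp]: "smat c 0 = 0" "smat 0 A = 0"
  and smat_nth [simp]: "smat c A $ i $ j = c * A $ i $ j"
  by (simp_all add: smat_def vec_eq_iff algebra_simps)

lemma mat_deriv_nth [simp]: "mat_deriv x M $ i $ j = mderiv x (M $ i $ j)"
  by (simp add: mat_deriv_def)

lemma mat_deriv_mult: "mat_deriv x (A ** B) = mat_deriv x A ** B + A ** mat_deriv x B"
  by (simp add: vec_eq_iff matrix_mult_nth mderiv_sum mderiv_mult sum.distrib)

lemma mat_deriv_add: "mat_deriv x (A + B) = mat_deriv x A + mat_deriv x B"
  and mat_deriv_diff: "mat_deriv x (A - B) = mat_deriv x A - mat_deriv x B"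
  and mat_deriv_zero [simp]: "mat_deriv x 0 = 0"
  and mat_deriv_one [simp]: "mat_deriv x (mat 1) = 0"
  and mat_deriv_cmat [simp]: "mat_deriv x (cmat R) = 0"
  by (simp_all add: vec_eq_iff mderiv_add mderiv_diff mat_def cmat_def if_distrib cong: if_cong)

lemma mat_deriv_sum: "mat_deriv x (\<Sum>n\<in>S. f n) = (\<Sum>n\<in>S. mat_deriv x (f n))"
  by (induction S rule: infinite_finite_induct) (simp_all add: mat_deriv_add)

lemma Msum_nth [simp]: "Msum g $ i $ j = msum (\<lambda>n. g n $ i $ j)"
  by (simp add: Msum_def)

lemma Msum_zero [simp]: "Msum (\<lambda>_. 0) = 0"
  by (simp add: vec_eq_iff)

lemma Msum_finite: "finite S \<Longrightarrow> (\<And>n. n \<notin> S \<Longrightarrow> g n = 0) \<Longrightarrow> Msum g = sum g S"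
  by (simp add: vec_eq_iff msum_finite)

lemma Lfin_mult_left: "Lfin g \<Longrightarrow> Lfin (\<lambda>n. A ** g n)"
  and Lfin_mult_right: "Lfin h \<Longrightarrow> Lfin (\<lambda>n. h n ** B)"
  by (simp_all add: Lfin_def matrix_mult_nth lfin_sum lfin_mult_left lfin_mult_right)

lemma Lfin_add: "Lfin f \<Longrightarrow> Lfin g \<Longrightarrow> Lfin (\<lambda>n. f n + g n)"
  and Lfin_diff: "Lfin f \<Longrightarrow> Lfin g \<Longrightarrow> Lfin (\<lambda>n. f n - g n)"
  by (simp_all add: Lfin_def lfin_add lfin_diff)

lemma Lfin_comp_inj: "Lfin f \<Longrightarrow> inj h \<Longrightarrow> Lfin (\<lambda>n. f (h n))"
  unfolding Lfin_def using lfin_comp_inj[where g = "\<lambda>n. f n $ _ $ _"] by blast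

lemma Msum_add: "Lfin f \<Longrightarrow> Lfin g \<Longrightarrow> Msum (\<lambda>n. f n + g n) = Msum f + Msum g"
  and Msum_diff: "Lfin f \<Longrightarrow> Lfin g \<Longrightarrow> Msum (\<lambda>n. f n - g n) = Msum f - Msum g"
  and Msum_reindex: "bij h \<Longrightarrow> Msum (\<lambda>n. f (h n)) = Msum f"
  by (simp_all add: Lfin_def vec_eq_iff msum_add msum_diff msum_reindex[where g = "\<lambda>n. f n $ _ $ _"])

lemma Msum_mult_left: "Lfin g \<Longrightarrow> Msum (\<lambda>n. A ** g n) = A ** Msum g"
  and Msum_mult_right: "Lfin h \<Longrightarrow> Msum (\<lambda>n. h n ** B) = Msum h ** B"
  by (simp_all add: Lfin_def vec_eq_iff matrix_mult_nth msum_sum lfin_mult_left lfin_mult_right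
      msum_mult_left msum_mult_right)

lemma Msum_swap:
  assumes "Lfin (\<lambda>(i, j). g i j)"
  shows "Msum (\<lambda>i. Msum (g i)) = Msum (\<lambda>j. Msum (\<lambda>i. g i j))"
proof (rule mat_eqI)
  fix a b
  have "lfin (\<lambda>(i, j). g i j $ a $ b)"
    using assms by (simp add: Lfin_def case_prod_unfold)
  then show "Msum (\<lambda>i. Msum (g i)) $ a $ b = Msum (\<lambda>j. Msum (\<lambda>i. g i j)) $ a $ b"
    by (simp add: msum_swap)
qed

lemma mat_deriv_Msum: "Lfin g \<Longrightarrow> mat_deriv x (Msum g) = Msum (\<lambda>n. mat_deriv x (g n))"
  by (simp add: vec_eq_iff Lfin_def mderiv_msum)

lemma matrix_mult_coeffE:
  assumes "mcoeff ((A ** B) $ i $ j) m \<noteq> 0"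
  obtains a b k where "m = a + b" "mcoeff (A $ i $ k) a \<noteq> 0" "mcoeff (B $ k $ j) b \<noteq> 0"
proof -
  obtain k where "mcoeff (A $ i $ k * B $ k $ j) m \<noteq> 0"
    using assms unfolding matrix_mult_nth mcoeff_sum by (meson sum.neutral)
  then show thesis using that by (elim mcoeff_mult_nonzeroE) blast
qed

lemma Deg_mult: "Deg A r \<Longrightarrow> Deg B s \<Longrightarrow> r + s \<le> n \<Longrightarrow> Deg (A ** B) n"
  unfolding Deg_def matrix_mult_nth by (blast intro: deg_le_sum deg_le_mult)

lemma Ord_mult: "Ord A r \<Longrightarrow> Ord B s \<Longrightarrow> n \<le> r + s \<Longrightarrow> Ord (A ** B) n"
  unfolding Ord_def matrix_mult_nth by (blast intro: ord_ge_sum ord_ge_mult ord_ge_mono)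

lemma Deg_zero [simp]: "Deg 0 n" and Ord_zero [simp]: "Ord 0 r" and Ord_0 [simp]: "Ord A 0"
  by (simp_all add: Deg_def Ord_def)

lemma Deg_cmat: "0 \<le> n \<Longrightarrow> Deg (cmat R) n"
  by (simp add: Deg_def cmat_def deg_le_mconst)

lemma Deg_Msum: "(\<And>i. Deg (g i) n) \<Longrightarrow> Deg (Msum g) n"
  by (simp add: Deg_def deg_le_msum)

text \<open>Laurent series in \<open>z\<close>, infinite in both directions, with matrix coefficients; vectors are
  matrices with one column. Multiplication is convolution.\<close>

definition lconv :: "(int \<Rightarrow> 'v mseries ^ 'r ^ 'q) \<Rightarrow> (int \<Rightarrow> 'v mseries ^ 'p ^ 'r)
    \<Rightarrow> int \<Rightarrow> 'v mseries ^ 'p ^ 'q" (infixl "\<star>" 75) where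
  "(a \<star> b) k = Msum (\<lambda>n. a n ** b (k - n))"

definition lone :: "int \<Rightarrow> 'v mseries ^ 'n ^ 'n" where
  "lone k = (if k = 0 then mat 1 else 0)"

lemma lone_left [simp]: "lone \<star> b = b"
proof
  fix k
  have "(lone \<star> b) k = (\<Sum>n\<in>{0}. lone n ** b (k - n))"
    unfolding lconv_def by (rule Msum_finite) (auto simp: lone_def)
  then show "(lone \<star> b) k = b k" by (simp add: lone_def)
qed

text \<open>The class \<open>loop_op\<close> contains \<open>R(z)\<close> with constant coefficients and the series in \<open>1/z\<close>
  that come from a calibration; the class \<open>loop_vec\<close> contains the points of the cones. Monomials of
  degree \<open>- r\<close> have at least \<open>r\<close> factors, since no variable has a degree below \<open>-1\<close>. Hence
  coefficients at very negative powers of \<open>z\<close> have high order.\<close>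

definition loop_op :: "(int \<Rightarrow> ('n \<times> nat) mseries ^ 'p ^ 'q) \<Rightarrow> bool" where
  "loop_op a \<longleftrightarrow> (\<forall>n. Deg (a n) (min n 0))"

definition loop_vec :: "(int \<Rightarrow> ('n \<times> nat) mseries ^ 'p ^ 'q) \<Rightarrow> bool" where
  "loop_vec f \<longleftrightarrow> (\<forall>k. Deg (f k) (k - 1))"

lemma loop_op_coeff:
  assumes "loop_op a" "mcoeff (a n $ i $ j) m \<noteq> 0"
  shows "mon_deg m \<le> min n 0" "- int (size m) \<le> n"
proof -
  show "mon_deg m \<le> min n 0" using assms by (auto simp: loop_op_def Deg_def deg_le_def)
  then show "- int (size m) \<le> n" using mon_deg_ge[of m] by linarith
qed

lemma loop_vec_coeff:
  "loop_vec f \<Longrightarrow> mcoeff (f k $ i $ j) m \<noteq> 0 \<Longrightarrow> mon_deg m \<le> k - 1"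
  by (auto simp: loop_vec_def Deg_def deg_le_def)

lemma Lfin_op_op:
  assumes a: "loop_op a" and b: "loop_op b" shows "Lfin (\<lambda>n. a n ** b (k - n))"
  unfolding Lfin_def lfin_def
proof safe
  fix i j m
  have "{n. mcoeff ((a n ** b (k - n)) $ i $ j) m \<noteq> 0} \<subseteq> {- int (size m)..k + int (size m)}"
  proof
    fix n assume "n \<in> {n. mcoeff ((a n ** b (k - n)) $ i $ j) m \<noteq> 0}"
    then obtain m1 m2 l where "m = m1 + m2" "mcoeff (a n $ i $ l) m1 \<noteq> 0"
      "mcoeff (b (k - n) $ l $ j) m2 \<noteq> 0" by (auto elim: matrix_mult_coeffE)
    then show "n \<in> {- int (size m)..k + int (size m)}"
      using loop_op_coeff(2)[OF a] loop_op_coeff(2)[OF b] by fastforce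
  qed
  then show "finite {n. mcoeff ((a n ** b (k - n)) $ i $ j) m \<noteq> 0}" using finite_subset by blast
qed

text \<open>For a fixed monomial, its size bounds the exponents of both operators from below, and the
  degree of the vector bounds their sum from above.\<close>

lemma Lfin_op_op_vec:
  fixes f :: "int \<Rightarrow> ('n \<times> nat) mseries ^ 'p ^ 'q"
  assumes a: "loop_op a" and b: "loop_op b" and f: "loop_vec f"
  shows "Lfin (\<lambda>(p, q). a p ** b (q - p) ** f (k - q))"
  unfolding Lfin_def lfin_def
proof safe
  fix i j and m :: "('n \<times> nat) multiset"
  define N where "N = int (size m) + \<bar>k\<bar> + \<bar>mon_deg m\<bar> + 1"
  have "{(p, q). mcoeff ((a p ** b (q - p) ** f (k - q)) $ i $ j) m \<noteq> 0} \<subseteq> {-2*N..2*N} \<times> {-4*N..4*N}"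
  proof safe
    fix p q assume "mcoeff ((a p ** b (q - p) ** f (k - q)) $ i $ j) m \<noteq> 0"
    then obtain m1 m2 m3 l l' where m: "m = (m1 + m2) + m3" and 1: "mcoeff (a p $ i $ l) m1 \<noteq> 0"
      and 2: "mcoeff (b (q - p) $ l $ l') m2 \<noteq> 0" and 3: "mcoeff (f (k - q) $ l' $ j) m3 \<noteq> 0"
      by (elim matrix_mult_coeffE) metis
    have *: "mon_deg m \<le> min p 0 + min (q - p) 0 + (k - q - 1)"
      using loop_op_coeff(1)[OF a 1] loop_op_coeff(1)[OF b 2] loop_vec_coeff[OF f 3]
      unfolding m mon_deg_union by linarith
    have **: "- int (size m) \<le> p" "- int (size m) \<le> q - p"
      using loop_op_coeff(2)[OF a 1] loop_op_coeff(2)[OF b 2] unfolding m by simp_all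
    show "p \<in> {-2*N..2*N}" "q \<in> {-4*N..4*N}" using * ** unfolding N_def by auto
  qed
  moreover have "{x. mcoeff ((case x of (p, q) \<Rightarrow> a p ** b (q - p) ** f (k - q)) $ i $ j) m \<noteq> 0}
    = {(p, q). mcoeff ((a p ** b (q - p) ** f (k - q)) $ i $ j) m \<noteq> 0}" by auto
  ultimately show "finite {x. mcoeff ((case x of (p, q) \<Rightarrow> a p ** b (q - p) ** f (k - q)) $ i $ j) m \<noteq> 0}"
    using finite_subset by (metis (no_types, lifting) finite_SigmaI finite_atLeastAtMost_int)
qed

lemma loop_op_lone: "loop_op lone"
  by (auto simp: loop_op_def lone_def Deg_def mat_def intro: deg_le_1)

lemma Lfin_op_vec:
  assumes "loop_op a" "loop_vec f" shows "Lfin (\<lambda>n. a n ** f (k - n))"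
proof -
  have "Lfin (\<lambda>n. case (n, n) of (p, q) \<Rightarrow> a p ** lone (q - p) ** f (k - q))"
    by (rule Lfin_comp_inj[OF Lfin_op_op_vec[OF assms(1) loop_op_lone assms(2)]]) (simp add: inj_def)
  then show ?thesis by (simp add: lone_def)
qed

lemma lconv_assoc:
  assumes a: "loop_op a" and b: "loop_op b" and f: "loop_vec f"
  shows "a \<star> (b \<star> f) = (a \<star> b) \<star> f"
proof
  fix k
  have "(a \<star> (b \<star> f)) k = Msum (\<lambda>p. Msum (\<lambda>q. a p ** b (q - p) ** f (k - q)))"
    unfolding lconv_def
  proof (rule arg_cong[where f = Msum], rule ext)
    fix p
    have "a p ** Msum (\<lambda>n. b n ** f (k - p - n)) = Msum (\<lambda>n. a p ** (b n ** f (k - p - n)))"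
      by (rule Msum_mult_left[symmetric]) (rule Lfin_op_vec[OF b f])
    also have "\<dots> = Msum (\<lambda>q. a p ** (b (q - p) ** f (k - p - (q - p))))"
      by (rule Msum_reindex[symmetric, where h = "\<lambda>q. q - p"])
        (rule bij_betw_byWitness[where f' = "\<lambda>q. q + p"], auto)
    finally show "a p ** Msum (\<lambda>n. b n ** f (k - p - n))
        = Msum (\<lambda>q. a p ** b (q - p) ** f (k - q))"
      by (simp add: matrix_mul_assoc)
  qed
  also have "\<dots> = Msum (\<lambda>q. Msum (\<lambda>p. a p ** b (q - p) ** f (k - q)))"
    by (rule Msum_swap) (rule Lfin_op_op_vec[OF a b f])
  also have "\<dots> = ((a \<star> b) \<star> f) k"
    unfolding lconv_def
    by (rule arg_cong[where f = Msum], rule ext, rule Msum_mult_right[OF Lfin_op_op[OF a b]])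
  finally show "(a \<star> (b \<star> f)) k = ((a \<star> b) \<star> f) k" .
qed

lemma loop_vec_conv:
  assumes "loop_op a" "loop_vec f" shows "loop_vec (a \<star> f)"
  unfolding loop_vec_def lconv_def
proof safe
  fix k
  show "Deg (Msum (\<lambda>n. a n ** f (k - n))) (k - 1)"
  proof (rule Deg_Msum, rule Deg_mult)
    fix n show "Deg (a n) (min n 0)" "Deg (f (k - n)) (k - n - 1)"
      using assms by (simp_all add: loop_op_def loop_vec_def)
  qed simp
qed


section \<open>Calibrations\<close>

lemma cmat_mult: "cmat (A ** B) = cmat A ** cmat B"
  by (simp add: cmat_def vec_eq_iff matrix_mult_nth mconst_sum mconst_mult)

lemma cmat_one [simp]: "cmat (mat 1) = mat 1"
  by (simp add: cmat_def mat_def vec_eq_iff)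

context
  fixes s :: "'u::finite \<Rightarrow> 'v mseries"
  assumes s: "small s"
begin

lemma Msubst_mult: "Msubst s (A ** B) = Msubst s A ** Msubst s B"
  by (simp add: Msubst_def vec_eq_iff matrix_mult_nth msubst_sum msubst_mult s)

lemma Msubst_add: "Msubst s (A + B) = Msubst s A + Msubst s B"
  and Msubst_diff: "Msubst s (A - B) = Msubst s A - Msubst s B"
  and Msubst_smat_const: "Msubst s (smat (mconst c) A) = smat (mconst c) (Msubst s A)"
  by (simp_all add: Msubst_def vec_eq_iff msubst_add msubst_diff msubst_mult s)

lemma Msubst_sum: "Msubst s (\<Sum>n\<in>S. f n) = (\<Sum>n\<in>S. Msubst s (f n))"
  by (simp add: Msubst_def vec_eq_iff msubst_sum s)

lemma Ord_Msubst: "Ord A r \<Longrightarrow> Ord (Msubst s A) r"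
  by (simp add: Ord_def Msubst_def ord_ge_msubst s)

lemma mat_deriv_Msubst:
  "mat_deriv x (Msubst s A) = (\<Sum>\<gamma>\<in>UNIV. smat (mderiv x (s \<gamma>)) (Msubst s (mat_deriv \<gamma> A)))"
  by (simp add: vec_eq_iff Msubst_def mderiv_msubst s mult.commute)

end

lemma Msubst_one [simp]: "Msubst s (mat 1) = mat 1"
  and Msubst_zero [simp]: "Msubst s 0 = 0"
  and Msubst_cmat [simp]: "Msubst s (cmat A) = cmat A"
  by (simp_all add: Msubst_def mat_def cmat_def vec_eq_iff)

lemma Deg_Msubst:
  fixes s :: "'u::finite \<Rightarrow> ('n \<times> nat) mseries"
  shows "(\<And>x. deg_le (s x) (-1)) \<Longrightarrow> Ord A r \<Longrightarrow> - int r \<le> n \<Longrightarrow> Deg (Msubst s A) n"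
  unfolding Deg_def Ord_def Msubst_def by (auto intro: deg_le_msubst_neg)

text \<open>The defect \<open>T = X Y - 1\<close> satisfies \<open>T X = 0\<close> because \<open>Y X = 1\<close>, and \<open>X\<close> starts with the identity.\<close>

lemma series_inverse_swap:
  fixes X Y :: "nat \<Rightarrow> 'a::ring_1 ^ 'n ^ 'n::finite"
  assumes X0: "X 0 = mat 1"
    and YX: "\<And>n. (\<Sum>i\<le>n. Y i ** X (n - i)) = (if n = 0 then mat 1 else 0)"
  shows "(\<Sum>i\<le>n. X i ** Y (n - i)) = (if n = 0 then mat 1 else 0)"
proof -
  define T where "T n = (\<Sum>i\<le>n. X i ** Y (n - i)) - (if n = 0 then mat 1 else 0)" for n
  have conv: "(\<Sum>i\<le>n. T i ** X (n - i)) = 0" for n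
  proof -
    have "(\<Sum>i\<le>n. (\<Sum>j\<le>i. X j ** Y (i - j)) ** X (n - i))
        = (\<Sum>i\<le>n. \<Sum>j\<le>i. X j ** Y (i - j) ** X (n - i))"
      by (simp add: matrix_sum_mult)
    also have "\<dots> = (\<Sum>(i, j)\<in>(SIGMA i:{..n}. {..i}). X j ** Y (i - j) ** X (n - i))"
      by (rule sum.Sigma) auto
    also have "\<dots> = (\<Sum>(j, i)\<in>(SIGMA j:{..n}. {..n - j}). X j ** Y i ** X (n - j - i))"
      by (rule sum.reindex_bij_witness[where i = "\<lambda>(j, i). (i + j, j)" and j = "\<lambda>(i, j). (j, i - j)"]) auto
    also have "\<dots> = (\<Sum>j\<le>n. \<Sum>i\<le>n - j. X j ** Y i ** X (n - j - i))"
      by (rule sum.Sigma[symmetric]) auto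
    also have "\<dots> = (\<Sum>j\<le>n. X j ** (\<Sum>i\<le>n - j. Y i ** X (n - j - i)))"
      by (simp add: matrix_sum_mult matrix_mul_assoc)
    also have "\<dots> = (\<Sum>j\<le>n. if j = n then X j else 0)"
    proof (rule sum.cong[OF refl])
      fix j assume "j \<in> {..n}"
      then show "X j ** (\<Sum>i\<le>n - j. Y i ** X (n - j - i)) = (if j = n then X j else 0)"
        unfolding YX[of "n - j"] by simp
    qed
    finally have 1: "(\<Sum>i\<le>n. (\<Sum>j\<le>i. X j ** Y (i - j)) ** X (n - i)) = X n" by simp
    have "(\<Sum>i\<le>n. (if i = 0 then mat 1 else 0) ** X (n - i)) = (\<Sum>i\<le>n. if i = 0 then X n else 0)"
      by (rule sum.cong) auto
    then show ?thesis by (simp add: T_def matrix_distrib sum_subtractf 1)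
  qed
  have "T n = 0"
  proof (induction n rule: less_induct)
    case (less n)
    have "(\<Sum>i\<le>n. T i ** X (n - i)) = (\<Sum>i\<in>{n}. T i ** X (n - i))"
      by (rule sum.mono_neutral_right) (auto simp: less)
    then show ?case using conv[of n] by (simp add: X0)
  qed
  then show ?thesis by (simp add: T_def)
qed

lemma sum_atMost_last: "(\<Sum>i\<le>Suc n. f i) = (\<Sum>i\<le>n. f i) + (f (Suc n) :: 'a::comm_monoid_add)"
  by simp

locale calibrated =
  fixes F :: "'n::finite \<Rightarrow> 'n mseries" and A :: "complex ^ 'n"
    and \<Omega> \<Theta> :: "int \<Rightarrow> 'n \<Rightarrow> 'n \<Rightarrow> 'n mseries"
  assumes flat: "flat_F_manifold F A" and calib: "ancestor_calibration F A \<Omega>"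
    and dual: "dual_calibration \<Omega> \<Theta>"
begin

text \<open>With the signs of the duality absorbed into \<open>Oh\<close>, the series \<open>\<Sum>j. Th j * z ^ j\<close> and
  \<open>\<Sum>j. Oh j * z ^ j\<close> are inverse to each other.\<close>

definition Th :: "nat \<Rightarrow> 'n mseries ^ 'n ^ 'n" where
  "Th j = (\<chi> \<alpha> \<beta>. \<Theta> (int j - 1) \<alpha> \<beta>)"

definition Oh :: "nat \<Rightarrow> 'n mseries ^ 'n ^ 'n" where
  "Oh j = (\<chi> \<alpha> \<beta>. (-1) ^ j * \<Omega> (int j - 1) \<alpha> \<beta>)"

definition Cm :: "'n \<Rightarrow> 'n mseries ^ 'n ^ 'n" where
  "Cm \<gamma> = (\<chi> \<alpha> \<beta>. str_const F \<alpha> \<gamma> \<beta>)"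

lemma Cm_sym: "Cm \<gamma> $ \<alpha> $ \<beta> = Cm \<beta> $ \<alpha> $ \<gamma>"
  by (simp add: Cm_def str_const_def mderiv_commute)

lemma Cm_closed: "mat_deriv \<delta> (Cm \<gamma>) = mat_deriv \<gamma> (Cm \<delta>)"
  by (simp add: Cm_def str_const_def vec_eq_iff mderiv_commute)

lemma Cm_commute: "Cm \<beta> ** Cm \<gamma> = Cm \<gamma> ** Cm \<beta>"
  using flat by (simp add: flat_F_manifold_def vec_eq_iff matrix_mult_nth Cm_def)

lemma Cm_unit: "(\<Sum>\<mu>\<in>UNIV. smat (mconst (A $ \<mu>)) (Cm \<mu>)) = mat 1"
  using flat by (simp add: flat_F_manifold_def vec_eq_iff Cm_def mat_def)

lemma Th_0 [simp]: "Th 0 = mat 1" and Oh_0 [simp]: "Oh 0 = mat 1"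
  using dual calib
  by (simp_all add: Th_def Oh_def dual_calibration_def ancestor_calibration_def calibration_def
      mat_def vec_eq_iff)

lemma mat_deriv_Oh: "mat_deriv \<gamma> (Oh (Suc j)) = - (Oh j ** Cm \<gamma>)"
proof (rule mat_eqI)
  fix \<alpha> \<beta>
  have neg: "mderiv \<gamma> ((-1) ^ k * f) = (-1) ^ k * mderiv \<gamma> f" for k f
    by (cases "even k") (simp_all add: mderiv_uminus)
  have "mderiv \<gamma> (\<Omega> (int j) \<alpha> \<beta>) = (\<Sum>\<mu>\<in>UNIV. str_const F \<mu> \<gamma> \<beta> * \<Omega> (int j - 1) \<alpha> \<mu>)"
    using calib by (simp add: ancestor_calibration_def calibration_def)
  then show "mat_deriv \<gamma> (Oh (Suc j)) $ \<alpha> $ \<beta> = (- (Oh j ** Cm \<gamma>)) $ \<alpha> $ \<beta>"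
    by (simp add: Oh_def Cm_def matrix_mult_nth sum_distrib_left mult_ac mderiv_uminus neg
        flip: sum_negf)
qed

lemma Th_Oh: "(\<Sum>i\<le>n. Th i ** Oh (n - i)) = (if n = 0 then mat 1 else 0)"
proof (rule mat_eqI)
  fix \<alpha> \<beta>
  let ?s = "\<Sum>i\<le>n. (-1) ^ i * (\<Sum>\<mu>\<in>UNIV. \<Theta> (int i - 1) \<alpha> \<mu> * \<Omega> (int (n - i) - 1) \<mu> \<beta>)"
  have "(\<Sum>i\<le>n. Th i ** Oh (n - i)) $ \<alpha> $ \<beta> = (\<Sum>i\<le>n. (-1) ^ (n - i) *
      (\<Sum>\<mu>\<in>UNIV. \<Theta> (int i - 1) \<alpha> \<mu> * \<Omega> (int (n - i) - 1) \<mu> \<beta>))"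
    by (simp add: Th_def Oh_def matrix_mult_nth sum_distrib_left mult_ac)
  also have "\<dots> = (-1) ^ n * ?s"
    unfolding sum_distrib_left[of _ _ "{..n}"] mult.assoc[symmetric]
    by (rule sum.cong[OF refl], rule arg_cong2[where f = "(*)"])
      (auto simp: power_add[symmetric] minus_one_power_iff)
  also have "?s = (if n = 0 \<and> \<alpha> = \<beta> then 1 else 0)"
    using dual by (simp add: dual_calibration_def)
  finally show "(\<Sum>i\<le>n. Th i ** Oh (n - i)) $ \<alpha> $ \<beta> = (if n = 0 then mat 1 else 0) $ \<alpha> $ \<beta>"
    by (simp add: mat_def)
qed

lemma Oh_Th: "(\<Sum>i\<le>n. Oh i ** Th (n - i)) = (if n = 0 then mat 1 else 0)"
  by (rule series_inverse_swap) (simp_all add: Th_Oh)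

text \<open>Differentiating \<open>Th * Oh = 1\<close> determines the derivative of the last factor \<open>Th (n + 1)\<close> from those of
  the earlier ones.\<close>

lemma mat_deriv_Th: "mat_deriv \<gamma> (Th (Suc n)) = Cm \<gamma> ** Th n"
proof (induction n rule: less_induct)
  case (less n)
  have T: "(\<Sum>i\<le>Suc n. Th i ** mat_deriv \<gamma> (Oh (Suc n - i)))
      = - ((\<Sum>i\<le>n. Th i ** Oh (n - i)) ** Cm \<gamma>)"
    by (simp add: sum_atMost_last matrix_sum_mult sum_negf[symmetric] Suc_diff_le mat_deriv_Oh
        matrix_mul_assoc)
  have "(\<Sum>i\<le>Suc n. mat_deriv \<gamma> (Th i) ** Oh (Suc n - i))
      = (\<Sum>i\<le>n. mat_deriv \<gamma> (Th (Suc i)) ** Oh (n - i))"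
    unfolding sum.atMost_Suc_shift by simp
  also have "\<dots> = (\<Sum>i\<in>{..n} - {n}. mat_deriv \<gamma> (Th (Suc i)) ** Oh (n - i)) + mat_deriv \<gamma> (Th (Suc n))"
    by (subst sum.remove[of _ n]) auto
  also have "(\<Sum>i\<in>{..n} - {n}. mat_deriv \<gamma> (Th (Suc i)) ** Oh (n - i))
      = (\<Sum>i\<in>{..n} - {n}. Cm \<gamma> ** Th i ** Oh (n - i))"
    by (rule sum.cong) (use less in auto)
  also have "\<dots> = Cm \<gamma> ** (\<Sum>i\<le>n. Th i ** Oh (n - i)) - Cm \<gamma> ** Th n"
    by (subst (2) sum.remove[of _ n]) (simp_all add: matrix_distrib matrix_sum_mult matrix_mul_assoc)
  finally have 1: "(\<Sum>i\<le>Suc n. mat_deriv \<gamma> (Th i) ** Oh (Suc n - i))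
    = Cm \<gamma> ** (\<Sum>i\<le>n. Th i ** Oh (n - i)) - Cm \<gamma> ** Th n + mat_deriv \<gamma> (Th (Suc n))" .
  have "0 = mat_deriv \<gamma> (\<Sum>i\<le>Suc n. Th i ** Oh (Suc n - i))"
    unfolding Th_Oh by simp
  also have "\<dots> = mat_deriv \<gamma> (Th (Suc n)) - Cm \<gamma> ** Th n"
    unfolding mat_deriv_sum mat_deriv_mult sum.distrib T 1 unfolding Th_Oh by simp
  finally show ?case by (metis eq_iff_diff_eq_0)
qed

lemma Ord_Oh: "Ord (Oh j) j"
proof (induction j)
  case (Suc j)
  have "Ord (Oh j ** Cm \<gamma>) j" for \<gamma> by (rule Ord_mult[OF Suc Ord_0]) simp
  then have "Ord (mat_deriv \<gamma> (Oh (Suc j))) j" for \<gamma>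
    unfolding mat_deriv_Oh by (simp add: Ord_def)
  moreover have "mcoeff (Oh (Suc j) $ \<alpha> $ \<beta>) {#} = 0" for \<alpha> \<beta>
    using calib by (simp add: Oh_def ancestor_calibration_def)
  ultimately show ?case by (simp add: Ord_def ord_ge_Suc_iff_mderiv)
qed simp

lemma Ord_Th: "Ord (Th j) j"
proof (induction j rule: less_induct)
  case (less j)
  show ?case
  proof (cases "j = 0")
    case False
    have "(\<Sum>i\<le>j. Th i ** Oh (j - i)) = (\<Sum>i\<in>{..j} - {j}. Th i ** Oh (j - i)) + Th j"
      by (subst sum.remove[of _ j]) auto
    then have Th: "Th j = - (\<Sum>i\<in>{..j} - {j}. Th i ** Oh (j - i))"
      using False by (simp add: Th_Oh eq_neg_iff_add_eq_0 add.commute)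
    have "Ord (Th i ** Oh (j - i)) j" if "i \<in> {..j} - {j}" for i
      by (rule Ord_mult[OF less Ord_Oh]) (use that in auto)
    then show ?thesis unfolding Th Ord_def by (auto intro!: ord_ge_sum)
  qed simp
qed

lemma Omega2_conv:
  "(\<chi> \<alpha> \<beta>. Omega2 \<Omega> \<Theta> p q \<alpha> \<beta>) = smat (mconst ((-1) ^ (p + 1))) (\<Sum>i\<le>q. Oh (p + 1 + q - i) ** Th i)"
proof (rule mat_eqI)
  fix \<alpha> \<beta>
  have sgn: "(mconst ((-1) ^ k) :: 'n mseries) = (-1) ^ k" for k
    by (cases "even k") (simp_all add: mconst_uminus)
  have "(-1) ^ (q - i) * (\<Sum>\<mu>\<in>UNIV. \<Omega> (int p + int q - int i) \<alpha> \<mu> * \<Theta> (int i - 1) \<mu> \<beta>)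
      = (-1) ^ (p + 1) * (Oh (p + 1 + q - i) ** Th i) $ \<alpha> $ \<beta>" if "i \<le> q" for i
  proof -
    have e: "(-1) ^ (q - i) = (-1) ^ (p + 1) * ((-1) ^ (p + 1 + q - i) :: 'n mseries)"
      using that by (auto simp: power_add[symmetric] minus_one_power_iff)
    have "int (p + 1 + q - i) - 1 = int p + int q - int i" using that by simp
    then show ?thesis
      unfolding e by (simp only: Oh_def Th_def matrix_mult_nth vec_lambda_beta sum_distrib_left mult.assoc)
  qed
  then show "(\<chi> \<alpha> \<beta>. Omega2 \<Omega> \<Theta> p q \<alpha> \<beta>) $ \<alpha> $ \<beta>
      = smat (mconst ((-1) ^ (p + 1))) (\<Sum>i\<le>q. Oh (p + 1 + q - i) ** Th i) $ \<alpha> $ \<beta>"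
    unfolding Omega2_def smat_nth sgn by (simp add: sum_distrib_left)
qed

lemma Omega2_0: "(\<chi> \<alpha> \<beta>. Omega2 \<Omega> \<Theta> 0 q \<alpha> \<beta>) = Th (Suc q)"
proof -
  have "(\<Sum>i\<le>Suc q. Oh (Suc q - i) ** Th i) = (\<Sum>i\<le>Suc q. Oh i ** Th (Suc q - i))"
    by (rule sum.reindex_bij_witness[where i = "\<lambda>i. Suc q - i" and j = "\<lambda>i. Suc q - i"]) auto
  also have "\<dots> = 0" unfolding Oh_Th by simp
  finally have "(\<Sum>i\<le>q. Oh (Suc q - i) ** Th i) = - Th (Suc q)"
    unfolding sum_atMost_last by (simp add: eq_neg_iff_add_eq_0)
  then show ?thesis unfolding Omega2_conv
    by (simp add: vec_eq_iff mconst_uminus)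
qed

lemma Th_1_unit: "(\<Sum>\<beta>\<in>UNIV. Th (Suc 0) $ \<alpha> $ \<beta> * mconst (A $ \<beta>)) = mvar \<alpha>"
proof -
  have "Th 1 + Oh 1 = 0" using Th_Oh[of 1] by (simp add: add.commute)
  then have "Th (Suc 0) $ \<alpha> $ \<beta> = \<Omega> 0 \<alpha> \<beta>" for \<beta>
    by (simp add: vec_eq_iff Oh_def eq_neg_iff_add_eq_0)
  then show ?thesis using calib by (simp add: ancestor_calibration_def mult.commute)
qed


subsection \<open>The algebra on the tangent space at a formal point\<close>

text \<open>Multiplication by \<open>X\<close> in the algebra with the structure constants of \<open>F\<close> at the point \<open>V\<close>.\<close>

definition Cx :: "('n \<Rightarrow> 'v mseries) \<Rightarrow> 'v mseries ^ 1 ^ 'n \<Rightarrow> 'v mseries ^ 'n ^ 'n" where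
  "Cx V X = (\<Sum>\<gamma>\<in>UNIV. smat (X $ \<gamma> $ 1) (Msubst V (Cm \<gamma>)))"

definition Acol :: "'v mseries ^ 1 ^ 'n" where
  "Acol = (\<chi> \<alpha> _. mconst (A $ \<alpha>))"

definition dcol :: "'v \<Rightarrow> ('n \<Rightarrow> 'v mseries) \<Rightarrow> 'v mseries ^ 1 ^ 'n" where
  "dcol x V = (\<chi> \<alpha> _. mderiv x (V \<alpha>))"

lemma Cx_add: "Cx V (X + Y) = Cx V X + Cx V Y"
  and Cx_smat: "Cx V (smat c X) = smat c (Cx V X)"
  and Cx_zero [simp]: "Cx V 0 = 0"
  by (simp_all add: Cx_def vec_eq_iff algebra_simps sum.distrib sum_distrib_left)

lemma Cx_sum: "Cx V (\<Sum>i\<in>S. f i) = (\<Sum>i\<in>S. Cx V (f i))"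
  by (induction S rule: infinite_finite_induct) (simp_all add: Cx_add)

lemma Cx_swap: "Cx V X ** Y = Cx V Y ** X"
proof (rule mat_eqI)
  fix \<alpha> and j :: 1
  have j: "j = 1" by simp
  have "(Cx V X ** Y) $ \<alpha> $ j = (\<Sum>\<beta>\<in>UNIV. \<Sum>\<gamma>\<in>UNIV. X $ \<gamma> $ 1 * msubst V (Cm \<gamma> $ \<alpha> $ \<beta>) * Y $ \<beta> $ 1)"
    by (simp add: Cx_def matrix_mult_nth sum_distrib_right Msubst_def j)
  also have "\<dots> = (\<Sum>\<gamma>\<in>UNIV. \<Sum>\<beta>\<in>UNIV. X $ \<gamma> $ 1 * msubst V (Cm \<gamma> $ \<alpha> $ \<beta>) * Y $ \<beta> $ 1)"
    by (rule sum.swap)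
  also have "\<dots> = (Cx V Y ** X) $ \<alpha> $ j"
    by (simp add: Cx_def matrix_mult_nth sum_distrib_right Msubst_def j Cm_sym[of _ \<alpha>])
      (simp add: mult_ac)
  finally show "(Cx V X ** Y) $ \<alpha> $ j = (Cx V Y ** X) $ \<alpha> $ j" .
qed

lemma Cx_commute:
  assumes "small V" shows "Cx V X ** Cx V Y = Cx V Y ** Cx V X"
proof -
  have *: "Msubst V (Cm \<gamma>) ** Msubst V (Cm \<delta>) = Msubst V (Cm \<delta>) ** Msubst V (Cm \<gamma>)" for \<gamma> \<delta>
    unfolding Msubst_mult[OF assms, symmetric] by (simp add: Cm_commute)
  have "Cx V X ** Cx V Y = (\<Sum>\<gamma>\<in>UNIV. \<Sum>\<delta>\<in>UNIV.
      smat (X $ \<gamma> $ 1 * Y $ \<delta> $ 1) (Msubst V (Cm \<gamma>) ** Msubst V (Cm \<delta>)))" for X Y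
    unfolding Cx_def matrix_sum_mult(2) unfolding matrix_sum_mult(1)
    by (simp add: smat_mult[symmetric] mult.commute)
  note expand = this
  show ?thesis
    unfolding expand[of X Y] expand[of Y X]
    by (subst sum.swap) (simp add: * mult.commute)
qed

lemma Cx_unit:
  assumes "small V" shows "Cx V Acol = mat 1"
  unfolding Cx_def Acol_def
  by (simp add: Msubst_smat_const[OF assms, symmetric] Msubst_sum[OF assms, symmetric] Cm_unit)

text \<open>The inverse series \<open>th V\<close> and \<open>oh V\<close> in \<open>1/z\<close>, evaluated at the point \<open>V\<close>.\<close>

definition th :: "('n \<Rightarrow> 'v mseries) \<Rightarrow> int \<Rightarrow> 'v mseries ^ 'n ^ 'n" where
  "th V n = (if n \<le> 0 then Msubst V (Th (nat (- n))) else 0)"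

definition oh :: "('n \<Rightarrow> 'v mseries) \<Rightarrow> int \<Rightarrow> 'v mseries ^ 'n ^ 'n" where
  "oh V n = (if n \<le> 0 then Msubst V (Oh (nat (- n))) else 0)"

lemma mat_deriv_th:
  assumes "small V" shows "mat_deriv x (th V n) = Cx V (dcol x V) ** th V (n + 1)"
proof (cases "n < 0")
  case True
  then obtain j where n: "n = - int (Suc j)"
    by (metis negD)
  then have nat: "nat (- n) = Suc j" "nat (- (n + 1)) = j" "n + 1 \<le> 0" by auto
  show ?thesis using True
    by (simp only: th_def nat if_True less_imp_le)
      (simp add: mat_deriv_Msubst[OF assms] mat_deriv_Th Msubst_mult[OF assms] Cx_def dcol_def
        matrix_sum_mult smat_mult)
qed (auto simp: th_def)

end


section \<open>The topological solution and the cone\<close>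

lemma msum_nat_split:
  assumes "lfin g" shows "msum g = g 0 + msum (\<lambda>b. g (Suc b))"
proof -
  have l: "lfin (\<lambda>b. if b = 0 then g b else 0)"
    by (rule lfin_finite_support, rule finite_subset[of _ "{0}"]) auto
  have "lfin (\<lambda>b. g b - (if b = 0 then g b else 0))" by (rule lfin_diff[OF assms l])
  moreover have "g b - (if b = 0 then g b else 0) = (if b = 0 then 0 else g b)" for b by simp
  ultimately have r: "lfin (\<lambda>b. if b = 0 then 0 else g b)" by simp
  have "msum g = msum (\<lambda>b. (if b = 0 then g b else 0) + (if b = 0 then 0 else g b))"
    by (rule arg_cong[where f = msum]) auto
  also have "\<dots> = msum (\<lambda>b. if b = 0 then g b else 0) + msum (\<lambda>b. if b = 0 then 0 else g b)"
    by (rule msum_add[OF l r])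
  also have "msum (\<lambda>b. if b = 0 then g b else 0) = g 0"
    by (subst msum_finite[of "{0}"]) auto
  also have "msum (\<lambda>b. if b = 0 then 0 else g b) = msum (\<lambda>b. g (Suc b))"
    using msum_inj_support[of Suc "\<lambda>b. if b = 0 then 0 else g b"] by (auto simp: image_iff gr0_conv_Suc)
  finally show ?thesis .
qed

lemma admissible_mvar: "admissible (mvar :: 'n \<times> nat \<Rightarrow> ('n \<times> nat) mseries)"
  by (auto simp: admissible_def mcoeff_mvar intro: deg_le_mvar)

lemma Lfin_low:
  assumes "\<And>n. n > 0 \<Longrightarrow> a n = 0" "\<And>n. Ord (a n) (nat (- n))"
  shows "Lfin (\<lambda>n. a n ** q (k - n))"
  unfolding Lfin_def lfin_def
proof safe
  fix i j m
  have "{n. mcoeff ((a n ** q (k - n)) $ i $ j) m \<noteq> 0} \<subseteq> {- int (size m)..0}"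
  proof
    fix n assume n: "n \<in> {n. mcoeff ((a n ** q (k - n)) $ i $ j) m \<noteq> 0}"
    then have "n \<le> 0" using assms(1)[of n] by (cases "n > 0") auto
    moreover obtain m1 m2 l where "m = m1 + m2" "mcoeff (a n $ i $ l) m1 \<noteq> 0"
      using n by (auto elim: matrix_mult_coeffE)
    ultimately show "n \<in> {- int (size m)..0}"
      using assms(2)[of n] unfolding Ord_def ord_ge_def by (force simp: nat_le_iff)
  qed
  then show "finite {n. mcoeff ((a n ** q (k - n)) $ i $ j) m \<noteq> 0}" using finite_subset by blast
qed

context calibrated
begin

lemma th_pos: "n > 0 \<Longrightarrow> th V n = 0" and oh_pos: "n > 0 \<Longrightarrow> oh V n = 0"
  by (simp_all add: th_def oh_def)

lemma th_0 [simp]: "th V 0 = mat 1" and oh_0 [simp]: "oh V 0 = mat 1"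
  by (simp_all add: th_def oh_def)

lemma th_neg: "th V (- int j) = Msubst V (Th j)" and oh_neg: "oh V (- int j) = Msubst V (Oh j)"
  by (simp_all add: th_def oh_def)

lemma Ord_th: "small V \<Longrightarrow> Ord (th V n) (nat (- n))"
  by (auto simp: th_def intro!: Ord_Msubst Ord_Th)

lemma Lfin_th: "small V \<Longrightarrow> Lfin (\<lambda>n. th V n ** q (k - n))"
  by (rule Lfin_low) (auto simp: th_pos Ord_th)

lemma loop_op_th: "(\<And>\<alpha>. deg_le (V \<alpha>) (-1)) \<Longrightarrow> loop_op (th V)"
  and loop_op_oh: "(\<And>\<alpha>. deg_le (V \<alpha>) (-1)) \<Longrightarrow> loop_op (oh V)"
  by (auto simp: loop_op_def th_def oh_def intro!: Deg_Msubst[OF _ Ord_Th] Deg_Msubst[OF _ Ord_Oh])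

text \<open>The series \<open>th V\<close> solves the linear system of the flat connection, pulled back along \<open>V\<close>.\<close>

lemma mat_deriv_th_conv:
  assumes "small V"
  shows "mat_deriv x ((th V \<star> q) k)
    = Cx V (dcol x V) ** (th V \<star> q) (k + 1) + (th V \<star> (\<lambda>j. mat_deriv x (q j))) k"
proof -
  have lf: "Lfin (\<lambda>n. th V (n + 1) ** q (k - n))"
    using Lfin_comp_inj[OF Lfin_th[OF assms, where q = q and k = "k + 1"], of "\<lambda>n. n + 1"]
    by (simp add: inj_def)
  have "Msum (\<lambda>n. th V (n + 1) ** q (k - n)) = (th V \<star> q) (k + 1)"
  proof -
    have bij: "bij (\<lambda>n::int. n + 1)" by (rule bij_betw_byWitness[where f' = "\<lambda>n. n - 1"]) auto
    show ?thesis
      using Msum_reindex[OF bij, where f = "\<lambda>n. th V n ** q (k + 1 - n)"]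
      by (simp add: lconv_def)
  qed
  moreover have "mat_deriv x ((th V \<star> q) k) = Msum (\<lambda>n. Cx V (dcol x V) ** (th V (n + 1) ** q (k - n))
      + th V n ** mat_deriv x (q (k - n)))"
    unfolding lconv_def mat_deriv_Msum[OF Lfin_th[OF assms]] mat_deriv_mult mat_deriv_th[OF assms]
    by (simp add: matrix_mul_assoc)
  moreover have "\<dots> = Cx V (dcol x V) ** Msum (\<lambda>n. th V (n + 1) ** q (k - n))
      + Msum (\<lambda>n. th V n ** mat_deriv x (q (k - n)))"
    using Lfin_th[OF assms, where q = "\<lambda>j. mat_deriv x (q j)" and k = k]
    by (subst Msum_add) (simp_all add: Lfin_mult_left lf Msum_mult_left)
  ultimately show ?thesis by (simp add: lconv_def)
qed

text \<open>The nonnegative part of a formal point with coordinates \<open>\<tau>\<close>, with the dilaton shift.\<close>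

definition qcol :: "('n \<times> nat \<Rightarrow> 'v mseries) \<Rightarrow> int \<Rightarrow> 'v mseries ^ 1 ^ 'n" where
  "qcol \<tau> k = (if k < 0 then 0
    else (\<chi> \<beta> _. \<tau> (\<beta>, nat k) - mconst (if nat k = 1 then A $ \<beta> else 0)))"

text \<open>The Euler--Lagrange equation \<open>\<Sum>b. Th b * q b = 0\<close> at \<open>V\<close>, solved for the term \<open>V\<close> that the dilaton
  shift produces.\<close>

definition EL_rhs :: "('n \<times> nat \<Rightarrow> 'v mseries) \<Rightarrow> ('n \<Rightarrow> 'v mseries) \<Rightarrow> 'n \<Rightarrow> 'v mseries" where
  "EL_rhs \<tau> V \<alpha> = \<tau> (\<alpha>, 0)
     + msum (\<lambda>b. \<Sum>\<beta>\<in>UNIV. msubst V (Th (Suc b) $ \<alpha> $ \<beta>) * \<tau> (\<beta>, Suc b))"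

lemma ord_Th_entry: "ord_ge (Th j $ \<alpha> $ \<beta>) j"
  using Ord_Th by (simp add: Ord_def)

lemma lfin_EL: "small V \<Longrightarrow> lfin (\<lambda>b. \<Sum>\<beta>\<in>UNIV. msubst V (Th (Suc b) $ \<alpha> $ \<beta>) * q \<beta> b)"
  by (rule lfin_ord_nat, rule ord_ge_sum, rule ord_ge_mult1, rule ord_ge_msubst)
    (auto intro: ord_ge_mono[OF ord_Th_entry])

text \<open>The Euler--Lagrange equation as a fixed point equation; the dilaton shift contributes \<open>V\<close>
  itself because \<open>Th 1\<close> applied to the unit is the identity coordinate.\<close>

lemma EL_fixpoint:
  assumes "small V"
  shows "(th V \<star> qcol \<tau>) 0 $ \<alpha> $ 1 = EL_rhs \<tau> V \<alpha> - V \<alpha>"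
proof -
  let ?g = "\<lambda>b::nat. (Msubst V (Th b) ** qcol \<tau> (int b)) $ \<alpha> $ 1"
  let ?t = "\<lambda>b. \<Sum>\<beta>\<in>UNIV. msubst V (Th (Suc b) $ \<alpha> $ \<beta>) * \<tau> (\<beta>, Suc b)"
  let ?s = "\<lambda>b. \<Sum>\<beta>\<in>UNIV. msubst V (Th (Suc b) $ \<alpha> $ \<beta>) * mconst (if b = 0 then A $ \<beta> else 0)"
  have "msum (\<lambda>n. (th V n ** qcol \<tau> (0 - n)) $ \<alpha> $ 1)
      = msum (\<lambda>b. (th V (- int b) ** qcol \<tau> (0 - - int b)) $ \<alpha> $ 1)"
  proof (rule msum_inj_support[symmetric])
    fix n assume "n \<notin> range (\<lambda>b. - int b)"
    moreover have "n = - int (nat (- n))" if "n \<le> 0" using that by simp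
    ultimately have "n > 0" by (metis not_less rangeI)
    then show "(th V n ** qcol \<tau> (0 - n)) $ \<alpha> $ 1 = 0" by (simp add: th_pos)
  qed (simp add: inj_def)
  then have "(th V \<star> qcol \<tau>) 0 $ \<alpha> $ 1 = msum ?g"
    by (simp add: lconv_def th_neg)
  also have "lfin ?g"
  proof -
    have "Lfin (\<lambda>b. th V (- int b) ** qcol \<tau> (0 - - int b))"
      by (rule Lfin_comp_inj[OF Lfin_th[OF assms]]) (simp add: inj_def)
    then show ?thesis by (simp add: Lfin_def th_neg)
  qed
  then have "msum ?g = ?g 0 + msum (\<lambda>b. ?g (Suc b))" by (rule msum_nat_split)
  also have "?g 0 = \<tau> (\<alpha>, 0)" by (simp add: qcol_def)
  also have "(\<lambda>b. ?g (Suc b)) = (\<lambda>b. ?t b - ?s b)"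
    by (rule ext) (simp add: qcol_def matrix_mult_nth Msubst_def right_diff_distrib sum_subtractf nat_add_distrib)
  also have "msum (\<lambda>b. ?t b - ?s b) = msum ?t - msum ?s"
    by (rule msum_diff) (rule lfin_EL[OF assms])+
  also have "msum ?s = ?s 0" by (subst msum_finite[of "{0}"]) auto
  also have "?s 0 = msubst V (\<Sum>\<beta>\<in>UNIV. Th (Suc 0) $ \<alpha> $ \<beta> * mconst (A $ \<beta>))"
    using assms by (simp add: msubst_sum msubst_mult)
  also have "\<dots> = V \<alpha>" by (simp add: Th_1_unit)
  finally show ?thesis by (simp add: EL_rhs_def)
qed

text \<open>\<open>Th (b + 1)\<close> vanishes to order \<open>b + 1\<close>, so that its values at two nearby points agree to \<open>b\<close> more
  orders than the points. For \<open>b = 0\<close> the missing order comes from \<open>\<tau> (\<beta>, 1)\<close>.\<close>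

lemma EL_contraction:
  assumes \<tau>: "\<And>\<beta>. mcoeff (\<tau> (\<beta>, 1)) {#} = 0" and V: "small V" "small V'"
    and close: "\<And>\<alpha>. ord_ge (V \<alpha> - V' \<alpha>) n"
  shows "ord_ge (EL_rhs \<tau> V \<alpha> - EL_rhs \<tau> V' \<alpha>) (Suc n)"
proof -
  have "EL_rhs \<tau> V \<alpha> - EL_rhs \<tau> V' \<alpha> = msum (\<lambda>b. \<Sum>\<beta>\<in>UNIV.
      (msubst V (Th (Suc b) $ \<alpha> $ \<beta>) - msubst V' (Th (Suc b) $ \<alpha> $ \<beta>)) * \<tau> (\<beta>, Suc b))"
    by (simp add: EL_rhs_def msum_diff[symmetric] lfin_EL V left_diff_distrib sum_subtractf)
  moreover have "ord_ge ((msubst V (Th (Suc b) $ \<alpha> $ \<beta>) - msubst V' (Th (Suc b) $ \<alpha> $ \<beta>))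
      * \<tau> (\<beta>, Suc b)) (Suc n)" for b \<beta>
  proof (cases b)
    case 0
    have "ord_ge (msubst V (Th (Suc b) $ \<alpha> $ \<beta>) - msubst V' (Th (Suc b) $ \<alpha> $ \<beta>)) (n + b)"
      by (rule ord_ge_msubst_diff[OF V close ord_Th_entry])
    from ord_ge_mult[OF this, of "\<tau> (\<beta>, Suc b)" 1] show ?thesis
      using \<tau> 0 by (simp add: ord_ge_1_iff[simplified])
  next
    case (Suc b')
    have "ord_ge (msubst V (Th (Suc b) $ \<alpha> $ \<beta>) - msubst V' (Th (Suc b) $ \<alpha> $ \<beta>)) (n + b)"
      by (rule ord_ge_msubst_diff[OF V close ord_Th_entry])
    then show ?thesis using Suc by (auto intro: ord_ge_mult1 ord_ge_mono)
  qed
  ultimately show ?thesis by (auto intro!: ord_ge_msum ord_ge_sum)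
qed

lemma EL_unique:
  assumes "\<And>\<beta>. mcoeff (\<tau> (\<beta>, 1)) {#} = 0" "small V" "small V'"
    and "EL_rhs \<tau> V = V" "EL_rhs \<tau> V' = V'"
  shows "V = V'"
  by (rule contraction_unique[of V V' "EL_rhs \<tau>"]) (use assms EL_contraction in blast)+

lemma EL_deg_term:
  assumes V: "\<And>\<alpha>. deg_le (V \<alpha>) (-1)" and \<tau>: "admissible \<tau>"
  shows "deg_le (\<Sum>\<beta>\<in>UNIV. msubst V (Th (Suc b) $ \<alpha> $ \<beta>) * \<tau> (\<beta>, Suc b)) (-1)"
proof (rule deg_le_sum, rule deg_le_mult)
  fix \<beta>
  show "deg_le (msubst V (Th (Suc b) $ \<alpha> $ \<beta>)) (- int (Suc b))"
    by (rule deg_le_msubst_neg[OF V ord_Th_entry]) simp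
  show "deg_le (\<tau> (\<beta>, Suc b)) (int b)" using admissible_deg[OF \<tau>, of "(\<beta>, Suc b)"] by simp
qed simp

lemma EL_solution_deg:
  assumes \<tau>: "admissible \<tau>" and V: "small V" "EL_rhs \<tau> V = V"
  shows "deg_le (V \<alpha>) (-1)"
proof -
  have \<tau>1: "mcoeff (\<tau> (\<beta>, 1)) {#} = 0" for \<beta> using \<tau> by (simp add: admissible_def)
  obtain W where degW: "\<And>\<alpha>. deg_le (W \<alpha>) (-1)" and W: "EL_rhs \<tau> W = W"
  proof (rule deg_contraction_fixpoint[of "EL_rhs \<tau>"])
    show "deg_le (EL_rhs \<tau> W \<alpha>) (-1)" if "\<And>\<alpha>. deg_le (W \<alpha>) (-1)" for W \<alpha>
      unfolding EL_rhs_def using admissible_deg[OF \<tau>, of "(\<alpha>, 0)"] that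
      by (intro deg_le_add deg_le_msum EL_deg_term \<tau>) auto
  qed (rule EL_contraction[of \<tau>, OF \<tau>1], assumption+, blast)
  have "W = V" by (rule EL_unique[OF \<tau>1 small_of_deg[of W, OF degW] V(1) W V(2)])
  then show ?thesis using degW by simp
qed

lemma topological_small: "topological_solution A \<Omega> \<Theta> v \<Longrightarrow> small v"
  by (simp add: topological_solution_def small_def mcoeff_mvar)

text \<open>The differential equations for \<open>v\<close> turn into a linear homogeneous system for the left-hand side
  \<open>E\<close> of the Euler--Lagrange equation: its derivative along \<open>t\<^sub>d\<close> is the product of a tangent vector
  with its derivative along the unit. Since \<open>E\<close> vanishes for \<open>t\<^sub>1 = t\<^sub>2 = \<dots> = 0\<close>, it vanishes.\<close>

lemma topological_EL:
  assumes v: "topological_solution A \<Omega> \<Theta> v" shows "EL_rhs mvar v = v"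
proof -
  note sm [simp] = topological_small[OF v]
  define q where "q = (qcol mvar :: int \<Rightarrow> ('n \<times> nat) mseries ^ 1 ^ 'n)"
  define E where "E = (th v \<star> q) 0"
  define W where "W = (th v \<star> q) 1"
  \<comment> \<open>\<open>vA\<close> is the derivative of \<open>v\<close> along the unit; by the differential equations every other
    derivative of \<open>v\<close> is its product with a tangent vector \<open>\<theta>\<close>.\<close>
  define ecol where "ecol \<beta> = (\<chi> \<alpha> _. if \<alpha> = \<beta> then 1 else 0 :: ('n \<times> nat) mseries ^ 1 ^ 'n)" for \<beta> :: 'n
  define vA where "vA = (\<Sum>\<gamma>\<in>UNIV. smat (mconst (A $ \<gamma>)) (dcol (\<gamma>, 0) v))"
  define \<theta> where "\<theta> \<beta> d = th v (- int d) ** ecol \<beta>" for \<beta> d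
  have dv: "dcol (\<beta>, d) v = Cx v vA ** \<theta> \<beta> d" for \<beta> d
  proof (rule mat_eqI)
    fix \<alpha> and j :: 1
    have j: "j = 1" by simp
    have Om: "Omega2 \<Omega> \<Theta> 0 d \<alpha> \<beta> = Th (Suc d) $ \<alpha> $ \<beta>"
      unfolding Omega2_0[symmetric] by simp
    have e: "- int (Suc d) + 1 = - int d" by simp
    have "mderiv (\<gamma>, 0) (msubst v (Th (Suc d) $ \<alpha> $ \<beta>))
        = (Cx v (dcol (\<gamma>, 0) v) ** th v (- int d)) $ \<alpha> $ \<beta>" for \<gamma>
      using arg_cong[OF mat_deriv_th[OF sm, of "(\<gamma>, 0)" "- int (Suc d)", unfolded e th_neg[of v "Suc d"]],
          of "\<lambda>M. M $ \<alpha> $ \<beta>"]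
      by (simp add: Msubst_def)
    moreover have "mderiv (\<beta>, d) (v \<alpha>) = (\<Sum>\<gamma>\<in>UNIV. mconst (A $ \<gamma>) *
        mderiv (\<gamma>, 0) (msubst v (Omega2 \<Omega> \<Theta> 0 d \<alpha> \<beta>)))"
      using v unfolding topological_solution_def by blast
    ultimately have "mderiv (\<beta>, d) (v \<alpha>)
        = (\<Sum>\<gamma>\<in>UNIV. mconst (A $ \<gamma>) * (Cx v (dcol (\<gamma>, 0) v) ** th v (- int d)) $ \<alpha> $ \<beta>)"
      by (simp only: Om)
    also have "\<dots> = (Cx v vA ** th v (- int d)) $ \<alpha> $ \<beta>"
      by (simp add: vA_def Cx_sum Cx_smat matrix_sum_mult smat_mult[symmetric])
    also have "\<dots> = (Cx v vA ** \<theta> \<beta> d) $ \<alpha> $ 1"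
      unfolding \<theta>_def matrix_mul_assoc
      by (subst (2) matrix_mult_nth) (simp add: ecol_def if_distrib cong: if_cong)
    finally show "dcol (\<beta>, d) v $ \<alpha> $ j = (Cx v vA ** \<theta> \<beta> d) $ \<alpha> $ j"
      by (simp add: dcol_def j)
  qed
  have dq: "mat_deriv (\<beta>, d) (q j) = (if j = int d then ecol \<beta> else 0)" for \<beta> d j
    by (auto simp: q_def qcol_def vec_eq_iff mderiv_diff mderiv_mvar ecol_def)
  have thdq: "(th v \<star> (\<lambda>j. mat_deriv (\<beta>, d) (q j))) 0 = \<theta> \<beta> d" for \<beta> d
  proof -
    have "(th v \<star> (\<lambda>j. mat_deriv (\<beta>, d) (q j))) 0
        = (\<Sum>n\<in>{- int d}. th v n ** mat_deriv (\<beta>, d) (q (0 - n)))"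
      unfolding lconv_def by (rule Msum_finite) (auto simp: dq)
    then show ?thesis by (simp add: dq \<theta>_def)
  qed
  have dE: "mat_deriv (\<beta>, d) E = Cx v (dcol (\<beta>, d) v) ** W + \<theta> \<beta> d" for \<beta> d
    unfolding E_def mat_deriv_th_conv[OF sm] thdq by (simp add: W_def)
  define G where "G = (\<Sum>\<gamma>\<in>UNIV. smat (mconst (A $ \<gamma>)) (mat_deriv (\<gamma>, 0) E))"
  have G: "G = Cx v vA ** W + Acol"
  proof -
    have "Acol = (\<Sum>\<gamma>\<in>UNIV. smat (mconst (A $ \<gamma>)) (ecol \<gamma>))"
      by (simp add: vec_eq_iff Acol_def ecol_def if_distrib cong: if_cong)
    then show ?thesis
      by (simp add: G_def dE smat_add sum.distrib vA_def Cx_sum Cx_smat matrix_sum_mult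
          smat_mult[symmetric] \<theta>_def)
  qed
  have key: "mat_deriv (\<beta>, d) E = Cx v (\<theta> \<beta> d) ** G" for \<beta> d
  proof -
    let ?\<theta> = "\<theta> \<beta> d"
    have "Cx v (Cx v vA ** ?\<theta>) ** W = Cx v W ** (Cx v vA ** ?\<theta>)" by (rule Cx_swap)
    also have "\<dots> = Cx v vA ** (Cx v W ** ?\<theta>)"
      by (simp add: matrix_mul_assoc Cx_commute[OF sm])
    also have "\<dots> = Cx v ?\<theta> ** (Cx v vA ** W)"
      by (simp only: Cx_swap[of v W] matrix_mul_assoc Cx_commute[OF sm, of vA])
    finally have "Cx v (Cx v vA ** ?\<theta>) ** W = Cx v ?\<theta> ** (Cx v vA ** W)" .
    moreover have "Cx v ?\<theta> ** Acol = ?\<theta>" by (simp add: Cx_swap[of v ?\<theta>] Cx_unit)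
    ultimately show ?thesis by (simp add: dE dv G matrix_distrib)
  qed
  have E: "E $ \<alpha> $ 1 = EL_rhs mvar v \<alpha> - v \<alpha>" for \<alpha>
    unfolding E_def q_def by (rule EL_fixpoint[OF sm])
  have "mcoeff (E $ \<alpha> $ 1) m = 0" for \<alpha> m
  proof (induction "size (filter_mset (\<lambda>x. snd x \<noteq> 0) m)" arbitrary: \<alpha> m rule: less_induct)
    case (less m)
    show ?case
    proof (cases "\<forall>x\<in>#m. snd x = 0")
      case True
      have "mcoeff (msum (\<lambda>b. \<Sum>\<beta>\<in>UNIV. msubst v (Th (Suc b) $ \<alpha> $ \<beta>) * mvar (\<beta>, Suc b))) m = 0"
      proof -
        have "(\<beta>, Suc b) \<notin># m" for \<beta> b using True by force
        then show ?thesis by (simp add: mcoeff_msum mcoeff_mult_mvar)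
      qed
      then show ?thesis using v True by (simp add: E EL_rhs_def topological_solution_def)
    next
      case False
      then obtain \<beta> d m' where m: "m = add_mset (\<beta>, d) m'" and d: "d \<noteq> 0"
        by (metis multi_member_split prod.collapse)
      have Gz: "mcoeff (G $ i $ j) b = 0" if "b \<subseteq># m'" for i b and j :: 1
      proof -
        have "mcoeff (E $ i $ 1) (add_mset (\<gamma>, 0) b) = 0" for \<gamma>
        proof (rule less)
          have "size (filter_mset (\<lambda>x. snd x \<noteq> 0) b) \<le> size (filter_mset (\<lambda>x. snd x \<noteq> 0) m')"
            using that by (intro size_mset_mono multiset_filter_mono)
          then show "size (filter_mset (\<lambda>x. snd x \<noteq> 0) (add_mset (\<gamma>, 0) b))
            < size (filter_mset (\<lambda>x. snd x \<noteq> 0) m)" using d by (simp add: m)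
        qed
        moreover have j: "j = 1" by simp
        ultimately show ?thesis unfolding j by (simp add: G_def mcoeff_mderiv)
      qed
      have "mcoeff ((Cx v (\<theta> \<beta> d) ** G) $ \<alpha> $ 1) m' = 0"
      proof (rule ccontr)
        assume "mcoeff ((Cx v (\<theta> \<beta> d) ** G) $ \<alpha> $ 1) m' \<noteq> 0"
        then obtain a b k where "m' = a + b" "mcoeff (G $ k $ 1) b \<noteq> 0"
          by (rule matrix_mult_coeffE)
        then show False using Gz[of b k 1] by simp
      qed
      then have "mcoeff (mderiv (\<beta>, d) (E $ \<alpha> $ 1)) m' = 0"
        unfolding key[symmetric] by simp
      then show ?thesis unfolding m by (simp add: mcoeff_mderiv del: of_nat_Suc)
    qed
  qed
  then have "E $ \<alpha> $ 1 = 0" for \<alpha> by (intro mseries_eqI) simp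
  then show ?thesis unfolding E by auto
qed

end


definition lp :: "'n::finite loop_point \<Rightarrow> int \<Rightarrow> ('n \<times> nat) mseries ^ 1 ^ 'n" where
  "lp f k = (\<chi> \<alpha> _. f k \<alpha>)"

text \<open>The points near \<open>q = - A z\<close> on which \<open>G_plus\<close> acts: the degree bound covers the
  coordinates \<open>p\<close> as well.\<close>

definition in_domain :: "complex ^ 'n \<Rightarrow> 'n loop_point \<Rightarrow> bool" where
  "in_domain A f \<longleftrightarrow> (\<forall>k \<alpha>. deg_le (f k \<alpha>) (k - 1)) \<and> (\<forall>\<alpha>. mcoeff (f 1 \<alpha>) {#} = - A $ \<alpha>)"

lemma loop_vec_lp: "in_domain A f \<Longrightarrow> loop_vec (lp f)"
  by (simp add: in_domain_def loop_vec_def Deg_def lp_def)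

lemma near_base_admissible: "near_base A f \<longleftrightarrow> admissible (t_coord A f)"
  by (simp add: near_base_def admissible_def)

lemma t_coord_eq: "t_coord A f (\<beta>, b) = f (int b) \<beta> + mconst (if b = 1 then A $ \<beta> else 0)"
  by (simp add: t_coord_def q_coord_def)

lemma in_domain_iff:
  "in_domain A f \<longleftrightarrow> near_base A f \<and> (\<forall>a \<alpha>. deg_le (p_coord f a \<alpha>) (- int a - 2))"
proof -
  have p: "deg_le (p_coord f a \<alpha>) n \<longleftrightarrow> deg_le (f (- int a - 1) \<alpha>) n" for a \<alpha> n
    by (cases "even a") (simp_all add: p_coord_def)
  have q: "deg_le (t_coord A f (\<beta>, b)) (int b - 1) \<longleftrightarrow> deg_le (f (int b) \<beta>) (int b - 1)" for \<beta> b
  proof -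
    have m: "deg_le (mconst (if b = 1 then A $ \<beta> else 0)) (int b - 1)"
      by (cases "b = 1") (auto intro: deg_le_mconst)
    show ?thesis
      unfolding t_coord_eq
      using deg_le_diff[OF _ m, of "f (int b) \<beta> + mconst (if b = 1 then A $ \<beta> else 0)"]
        deg_le_add[OF _ m, of "f (int b) \<beta>"] by auto
  qed
  have all: "(\<forall>k::int. P k) \<longleftrightarrow> (\<forall>b::nat. P (int b)) \<and> (\<forall>a::nat. P (- int a - 1))" for P
  proof safe
    fix k assume *: "\<forall>b::nat. P (int b)" "\<forall>a::nat. P (- int a - 1)"
    show "P k"
    proof (cases "k \<ge> 0")
      case True then show ?thesis using spec[OF *(1), of "nat k"] by simp
    next
      case False then show ?thesis using spec[OF *(2), of "nat (- k - 1)"] by simp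
    qed
  qed auto
  have c: "mcoeff (t_coord A f (\<beta>, 1)) {#} = 0 \<longleftrightarrow> mcoeff (f 1 \<beta>) {#} = - A $ \<beta>" for \<beta>
    by (simp add: t_coord_eq mcoeff_mconst eq_neg_iff_add_eq_0)
  have e: "- int a - 1 - 1 = - int a - 2" for a by simp
  show ?thesis
    unfolding in_domain_def near_base_def p q c all e by auto
qed

lemma lconv_inverse:
  fixes V :: "'u::finite \<Rightarrow> 'v mseries" and X Y :: "nat \<Rightarrow> 'u mseries ^ 'n ^ 'n"
  assumes V: "small V" and XY: "\<And>n. (\<Sum>i\<le>n. X i ** Y (n - i)) = (if n = 0 then mat 1 else 0)"
  shows "(\<lambda>n. if n \<le> 0 then Msubst V (X (nat (- n))) else 0)
    \<star> (\<lambda>n. if n \<le> 0 then Msubst V (Y (nat (- n))) else 0) = lone"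
    (is "?x \<star> ?y = _")
proof
  fix k :: int
  have "(?x \<star> ?y) k = (\<Sum>n\<in>{k..0}. ?x n ** ?y (k - n))"
    unfolding lconv_def by (rule Msum_finite) auto
  also have "\<dots> = lone k"
  proof (cases "k \<le> 0")
    case True
    have "(\<Sum>n\<in>{k..0}. ?x n ** ?y (k - n)) = (\<Sum>i\<le>nat (- k). Msubst V (X i ** Y (nat (- k) - i)))"
      by (rule sum.reindex_bij_witness[where i = "\<lambda>i. - int i" and j = "\<lambda>n. nat (- n)"])
        (use True in \<open>auto simp: Msubst_mult[OF V] nat_diff_distrib[symmetric]\<close>)
    then show ?thesis using True by (simp add: Msubst_sum[OF V, symmetric] XY lone_def)
  qed (simp add: lone_def)
  finally show "(?x \<star> ?y) k = lone k" .
qed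

context calibrated
begin

lemma qcol_t_coord: "k \<ge> 0 \<Longrightarrow> qcol (t_coord A f) k = lp f k"
  by (simp add: qcol_def lp_def t_coord_eq vec_eq_iff)

lemma th_oh:
  assumes "small V" shows "th V \<star> oh V = lone" and "oh V \<star> th V = lone"
  unfolding th_def[abs_def] oh_def[abs_def]
  by (rule lconv_inverse[OF assms], rule Th_Oh, rule lconv_inverse[OF assms], rule Oh_Th)

text \<open>The values of the descendant potentials, as a function of the coordinates \<open>\<tau>\<close> and of the value
  \<open>V\<close> of the topological solution.\<close>

definition p_value :: "('n \<times> nat \<Rightarrow> 'v mseries) \<Rightarrow> ('n \<Rightarrow> 'v mseries) \<Rightarrow> nat \<Rightarrow> 'n \<Rightarrow> 'v mseries" where
  "p_value \<tau> V a \<alpha> = msum (\<lambda>b. \<Sum>\<beta>\<in>UNIV. msubst V (Omega2 \<Omega> \<Theta> a b \<alpha> \<beta>) *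
     (\<tau> (\<beta>, b) - mconst (if b = 1 then A $ \<beta> else 0)))"

lemma descendant_potential_eq: "descendant_potential A \<Omega> \<Theta> v a \<alpha> = p_value mvar v a \<alpha>"
  by (simp add: descendant_potential_def p_value_def)

lemma ord_Omega2: "ord_ge (Omega2 \<Omega> \<Theta> a b \<alpha> \<beta>) (a + b + 1)"
proof -
  have "Ord (Oh (a + 1 + b - i) ** Th i) (a + b + 1)" if "i \<le> b" for i
    by (rule Ord_mult[OF Ord_Oh Ord_Th]) (use that in simp)
  then have "Ord (\<Sum>i\<le>b. Oh (a + 1 + b - i) ** Th i) (a + b + 1)"
    unfolding Ord_def by (auto intro!: ord_ge_sum)
  then have "Ord (\<chi> \<alpha> \<beta>. Omega2 \<Omega> \<Theta> a b \<alpha> \<beta>) (a + b + 1)"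
    unfolding Omega2_conv by (simp add: Ord_def ord_ge_mult2)
  then show ?thesis by (simp add: Ord_def)
qed

lemma p_value_term_deg:
  assumes "admissible \<tau>" "\<And>\<alpha>. deg_le (V \<alpha>) (-1)"
  shows "deg_le (\<Sum>\<beta>\<in>UNIV. msubst V (Omega2 \<Omega> \<Theta> a b \<alpha> \<beta>) *
     (\<tau> (\<beta>, b) - mconst (if b = 1 then A $ \<beta> else 0))) (- int a - 2)"
proof (rule deg_le_sum, rule deg_le_mult)
  fix \<beta>
  show "deg_le (msubst V (Omega2 \<Omega> \<Theta> a b \<alpha> \<beta>)) (- int (a + b + 1))"
    by (rule deg_le_msubst_neg[OF assms(2) ord_Omega2]) simp
  show "deg_le (\<tau> (\<beta>, b) - mconst (if b = 1 then A $ \<beta> else 0)) (int b - 1)"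
    using admissible_deg[OF assms(1), of "(\<beta>, b)"] by (intro deg_le_diff) (auto intro: deg_le_mconst)
qed simp

lemma p_value_deg:
  "admissible \<tau> \<Longrightarrow> (\<And>\<alpha>. deg_le (V \<alpha>) (-1)) \<Longrightarrow> deg_le (p_value \<tau> V a \<alpha>) (- int a - 2)"
  unfolding p_value_def by (rule deg_le_msum) (rule p_value_term_deg)

text \<open>Substitution of the coordinates of a formal point is multiplicative and continuous on series of
  bounded degree, and it composes with evaluation at \<open>v\<close> because \<open>v\<close> has degree at most \<open>-1\<close>.\<close>

lemma substitute_solution:
  assumes \<tau>: "admissible \<tau>" and v: "\<And>\<alpha>. deg_le (v \<alpha>) (-1)" "EL_rhs mvar v = v"
  defines "V \<equiv> \<lambda>\<alpha>. msubst \<tau> (v \<alpha>)"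
  shows "EL_rhs \<tau> V = V" and "msubst \<tau> (p_value mvar v a \<alpha>) = p_value \<tau> V a \<alpha>"
proof -
  have small: "small v" by (rule small_of_deg) (rule v)
  have comp: "msubst \<tau> (msubst v f) = msubst V f" for f
    unfolding V_def by (rule msubst_msubst[OF \<tau> v(1)])
  have ok: "sub_ok \<tau> (msubst v f)" for f
    by (rule sub_ok_admissible[OF \<tau> deg_le_msubst_neg[OF v(1) ord_ge_0, where n = 0]]) simp
  have ok2: "sub_ok \<tau> (msubst v f * (mvar x - mconst c))" "sub_ok \<tau> (msubst v f * mvar x)" for f x c
    by (intro sub_ok_mult sub_ok_diff ok sub_ok_simple)+
  show "EL_rhs \<tau> V = V"
  proof
    fix \<alpha>
    let ?t = "\<lambda>b. \<Sum>\<beta>\<in>UNIV. msubst v (Th (Suc b) $ \<alpha> $ \<beta>) * mvar (\<beta>, Suc b)"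
    have deg: "deg_le (?t b) (-1)" for b by (rule EL_deg_term[OF v(1) admissible_mvar])
    have "V \<alpha> = msubst \<tau> (EL_rhs mvar v \<alpha>)" by (simp add: V_def v(2))
    also have "\<dots> = msubst \<tau> (mvar (\<alpha>, 0)) + msubst \<tau> (msum ?t)"
      unfolding EL_rhs_def
      by (rule msubst_add[OF sub_ok_simple(4) sub_ok_admissible[OF \<tau> deg_le_msum[OF deg]]])
    also have "msubst \<tau> (msum ?t) = msum (\<lambda>b. msubst \<tau> (?t b))"
      by (rule msubst_msum_admissible[OF \<tau> deg lfin_EL[OF small]])
    finally show "EL_rhs \<tau> V \<alpha> = V \<alpha>"
      by (simp add: EL_rhs_def msubst_sum ok2 msubst_mult ok comp)
  qed
  let ?t = "\<lambda>b. \<Sum>\<beta>\<in>UNIV. msubst v (Omega2 \<Omega> \<Theta> a b \<alpha> \<beta>) *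
     (mvar (\<beta>, b) - mconst (if b = 1 then A $ \<beta> else 0))"
  have "lfin ?t"
    by (rule lfin_ord_nat, rule ord_ge_sum, rule ord_ge_mult1, rule ord_ge_msubst[OF small])
      (rule ord_ge_mono[OF ord_Omega2], simp)
  then have "msubst \<tau> (msum ?t) = msum (\<lambda>b. msubst \<tau> (?t b))"
    by (rule msubst_msum_admissible[OF \<tau> p_value_term_deg[OF admissible_mvar v(1)]])
  then show "msubst \<tau> (p_value mvar v a \<alpha>) = p_value \<tau> V a \<alpha>"
    by (simp add: p_value_def msubst_sum ok2 msubst_mult ok comp msubst_diff sub_ok_diff)
qed

definition trunc :: "(int \<Rightarrow> 'v mseries ^ 1 ^ 'n) \<Rightarrow> int \<Rightarrow> 'v mseries ^ 1 ^ 'n" where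
  "trunc g k = (if k < 0 then 0 else g k)"

text \<open>The double series \<open>Omega2\<close> packages the operation that transports the nonnegative part of a
  point by \<open>th V\<close>, discards negative powers, and transports back.\<close>

lemma p_value_trunc:
  fixes V :: "'n \<Rightarrow> 'b mseries"
  assumes V: "small V"
  shows "(oh V \<star> trunc (th V \<star> qcol \<tau>)) (- int a - 1) $ \<alpha> $ 1 = (-1) ^ (a + 1) * p_value \<tau> V a \<alpha>"
proof -
  let ?q = "qcol \<tau>" and ?k = "- int a - 1"
  let ?G = "\<lambda>n b. if ?k - n < 0 then 0 else oh V n ** th V (?k - n - b) ** ?q b"
  have inner: "oh V n ** trunc (th V \<star> ?q) (?k - n) = Msum (?G n)" for n
  proof (cases "?k - n < 0")
    case False
    have bij: "bij (\<lambda>b. ?k - n - b)" by (rule bij_betw_byWitness[where f' = "\<lambda>b. ?k - n - b"]) auto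
    have "(th V \<star> ?q) (?k - n) = Msum (\<lambda>b. th V (?k - n - b) ** ?q b)"
      using Msum_reindex[OF bij, where f = "\<lambda>m. th V m ** ?q (?k - n - m)"]
      by (simp add: lconv_def)
    moreover have "Lfin (\<lambda>b. th V (?k - n - b) ** ?q b)"
      using Lfin_comp_inj[OF Lfin_th[OF V, where q = ?q and k = "?k - n"] bij_is_inj[OF bij]] by simp
    ultimately show ?thesis using False
      by (simp add: trunc_def Msum_mult_left[symmetric] matrix_mul_assoc)
  qed (simp add: trunc_def)
  have G0: "?G n b = 0" if "b < 0 \<or> n > 0 \<or> ?k - n < 0 \<or> ?k - n - b > 0" for n b
    using that by (auto simp: oh_pos th_pos qcol_def)
  have lfG: "Lfin (\<lambda>(n, b). ?G n b)"
    unfolding Lfin_def lfin_def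
  proof safe
    fix i j m
    let ?S = "{p. mcoeff ((case p of (n, b) \<Rightarrow> ?G n b) $ i $ j) m \<noteq> 0}"
    have "?S \<subseteq> {- int (size m)..0} \<times> {0..int (size m)}"
    proof
      fix p assume p: "p \<in> ?S"
      obtain n b where nb: "p = (n, b)" by (cases p)
      have nz: "mcoeff (?G n b $ i $ j) m \<noteq> 0" using p by (simp add: nb)
      then have "?G n b \<noteq> 0" by auto
      then have 1: "b \<ge> 0" "n \<le> 0" "?k - n \<ge> 0" "?k - n - b \<le> 0"
        using G0[of b n] by (meson not_le)+
      have "mcoeff ((oh V n ** th V (?k - n - b) ** ?q b) $ i $ j) m \<noteq> 0"
        using nz 1 by (simp split: if_splits)
      then obtain m1 m2 m3 l l' where m: "m = (m1 + m2) + m3" and 2: "mcoeff (oh V n $ i $ l) m1 \<noteq> 0"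
        and 3: "mcoeff (th V (?k - n - b) $ l $ l') m2 \<noteq> 0"
        by (elim matrix_mult_coeffE) metis
      have "Ord (oh V n) (nat (- n))" by (auto simp: oh_def intro!: Ord_Msubst[OF V] Ord_Oh)
      then have "nat (- n) \<le> size m1" using 2 by (auto simp: Ord_def ord_ge_def)
      moreover have "nat (- (?k - n - b)) \<le> size m2"
        using Ord_th[OF V, of "?k - n - b"] 3 unfolding Ord_def ord_ge_def by blast
      ultimately show "p \<in> {- int (size m)..0} \<times> {0..int (size m)}"
        using 1 by (simp add: nb m) linarith
    qed
    then show "finite ?S" by (rule finite_subset) simp
  qed
  have inner2: "Msum (\<lambda>n. ?G n (int b))
      = Msubst V (\<Sum>i\<le>b. Oh (a + 1 + b - i) ** Th i) ** ?q (int b)" for b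
  proof -
    have "Msum (\<lambda>n. ?G n (int b)) = (\<Sum>n\<in>{?k - int b..?k}. ?G n (int b))"
      by (rule Msum_finite, simp) (rule G0, auto)
    also have "\<dots> = (\<Sum>i\<le>b. Msubst V (Oh (a + 1 + b - i)) ** Msubst V (Th i) ** ?q (int b))"
    proof (rule sum.reindex_bij_witness[where i = "\<lambda>i. ?k - int b + int i" and j = "\<lambda>n. nat (n - ?k + int b)"])
      fix n assume n: "n \<in> {?k - int b..?k}"
      define i where "i = nat (n - ?k + int b)"
      have i: "i \<le> b" "n = - int (a + 1 + b - i)" "?k - n - int b = - int i" "\<not> ?k - n < 0"
        using n by (auto simp: i_def)
      have "Msubst V (Oh (a + 1 + b - i)) ** Msubst V (Th i) ** ?q (int b) = ?G n (int b)"
        unfolding i(3) using i(4) by (simp only: i(2) oh_neg th_neg if_False)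
      then show "Msubst V (Oh (a + 1 + b - nat (n - ?k + int b))) ** Msubst V (Th (nat (n - ?k + int b)))
          ** ?q (int b) = ?G n (int b)" by (simp only: i_def)
    qed auto
    finally show ?thesis by (simp add: Msubst_sum[OF V] Msubst_mult[OF V] matrix_sum_mult)
  qed
  have "(oh V \<star> trunc (th V \<star> ?q)) ?k = Msum (\<lambda>n. Msum (?G n))"
    unfolding lconv_def[of "oh V"] inner ..
  also have "\<dots> = Msum (\<lambda>b. Msum (\<lambda>n. ?G n b))" by (rule Msum_swap[OF lfG])
  finally have "(oh V \<star> trunc (th V \<star> ?q)) ?k $ \<alpha> $ 1 = msum (\<lambda>b. Msum (\<lambda>n. ?G n b) $ \<alpha> $ 1)"
    by simp
  also have "\<dots> = msum (\<lambda>b. Msum (\<lambda>n. ?G n (int b)) $ \<alpha> $ 1)"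
  proof (rule msum_inj_support[symmetric])
    fix b :: int assume "b \<notin> range int"
    then have "b < 0" by (metis nonneg_int_cases not_le rangeI)
    then have "?G n b = 0" for n by (intro G0) simp
    then have "Msum (\<lambda>n. ?G n b) = 0" by (simp only: Msum_zero)
    then show "Msum (\<lambda>n. ?G n b) $ \<alpha> $ 1 = 0" by simp
  qed simp
  also have "\<dots> = msum (\<lambda>b. mconst ((-1) ^ (a + 1)) * (\<Sum>\<beta>\<in>UNIV. msubst V (Omega2 \<Omega> \<Theta> a b \<alpha> \<beta>) *
     (\<tau> (\<beta>, b) - mconst (if b = 1 then A $ \<beta> else 0))))"
  proof (rule arg_cong[where f = msum], rule ext)
    fix b
    let ?M = "\<Sum>i\<le>b. Oh (a + 1 + b - i) ** Th i"
    have sq: "mconst ((-1) ^ (a + 1)) * (mconst ((-1) ^ (a + 1)) * x) = x" for x :: "'b mseries"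
      by (simp add: mult.assoc[symmetric] mconst_mult[symmetric] power_add[symmetric] mult_2[symmetric])
    have "Msubst V (\<chi> \<alpha> \<beta>. Omega2 \<Omega> \<Theta> a b \<alpha> \<beta>) = smat (mconst ((-1) ^ (a + 1))) (Msubst V ?M)"
      unfolding Omega2_conv by (rule Msubst_smat_const[OF V])
    then have "msubst V (Omega2 \<Omega> \<Theta> a b \<alpha> \<beta>) = mconst ((-1) ^ (a + 1)) * Msubst V ?M $ \<alpha> $ \<beta>" for \<beta>
      by (simp add: Msubst_def vec_eq_iff)
    then show "Msum (\<lambda>n. ?G n (int b)) $ \<alpha> $ 1 = mconst ((-1) ^ (a + 1)) *
      (\<Sum>\<beta>\<in>UNIV. msubst V (Omega2 \<Omega> \<Theta> a b \<alpha> \<beta>) * (\<tau> (\<beta>, b) - mconst (if b = 1 then A $ \<beta> else 0)))"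
      unfolding inner2 by (simp only: matrix_mult_nth sum_distrib_left mult.assoc sq) (simp add: qcol_def)
  qed
  also have "\<dots> = mconst ((-1) ^ (a + 1)) * p_value \<tau> V a \<alpha>"
    unfolding p_value_def
    by (rule msum_mult_left, rule lfin_ord_nat, rule ord_ge_sum, rule ord_ge_mult1,
        rule ord_ge_msubst[OF V], rule ord_ge_mono[OF ord_Omega2]) simp
  also have "mconst ((-1) ^ (a + 1)) = ((-1) ^ (a + 1) :: 'b mseries)"
    by (cases "even a") (simp_all add: mconst_uminus)
  finally show ?thesis .
qed

lemma loop_vec_trunc: "loop_vec g \<Longrightarrow> loop_vec (trunc g)"
  by (simp add: loop_vec_def trunc_def)

lemma conv_nonneg:
  assumes "\<And>n. n > 0 \<Longrightarrow> a n = 0" "\<And>j. j \<ge> 0 \<Longrightarrow> f j = g j" "k \<ge> 0"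
  shows "(a \<star> f) k = (a \<star> g) k"
proof -
  have "a n ** f (k - n) = a n ** g (k - n)" for n
    using assms by (cases "n > 0") simp_all
  then show ?thesis by (simp add: lconv_def)
qed

text \<open>If \<open>th V \<star> lp f\<close> has no coefficients at nonpositive powers of \<open>z\<close>, it is the truncation of \<open>th V\<close>
  applied to the nonnegative part of \<open>f\<close>, and \<open>oh V\<close> takes it back to \<open>f\<close>; the coefficients at negative
  powers are then the values of the potentials. The coefficient at \<open>z ^ 0\<close> is the Euler--Lagrange
  equation, by which \<open>V\<close> is the value of the topological solution. The converse runs the same way.\<close>

theorem cone_iff:
  assumes v: "topological_solution A \<Omega> \<Theta> v"
  shows "f \<in> graph_cone A (descendant_potential A \<Omega> \<Theta> v) \<longleftrightarrow>
    in_domain A f \<and> (\<exists>V. (\<forall>\<alpha>. deg_le (V \<alpha>) (-1)) \<and> (\<forall>k\<le>0. (th V \<star> lp f) k = 0))"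
proof -
  let ?\<tau> = "t_coord A f"
  note EL = topological_EL[OF v]
  have vdeg: "deg_le (v \<alpha>) (-1)" for \<alpha>
    by (rule EL_solution_deg[OF admissible_mvar topological_small[OF v] EL])
  define W where "W = (\<lambda>\<alpha>. msubst ?\<tau> (v \<alpha>))"
  have sgn: "(-1) ^ (a + 1) * ((-1) ^ (a + 1) * x) = (x :: ('n \<times> nat) mseries)" for a x
    by (simp add: mult.assoc[symmetric] power_add[symmetric] mult_2[symmetric])
  have in_cone: "f \<in> graph_cone A (descendant_potential A \<Omega> \<Theta> v) \<longleftrightarrow>
      near_base A f \<and> (\<forall>a \<alpha>. p_coord f a \<alpha> = p_value ?\<tau> W a \<alpha>)"
    using substitute_solution(2)[OF _ vdeg EL, of ?\<tau>]
    by (auto simp: graph_cone_def descendant_potential_eq near_base_admissible W_def)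
  have W: "(\<forall>\<alpha>. deg_le (W \<alpha>) (-1))" "EL_rhs ?\<tau> W = W" if "near_base A f"
    using substitute_solution(1)[OF _ vdeg EL, of ?\<tau>] that deg_le_msubst vdeg
    by (auto simp: near_base_admissible W_def)
  have p_entry: "lp f (- int a - 1) $ \<alpha> $ j = (-1) ^ (a + 1) * p_coord f a \<alpha>" for a \<alpha> j
    unfolding p_coord_def sgn by (simp add: lp_def)
  show ?thesis
  proof (intro iffI)
    assume "f \<in> graph_cone A (descendant_potential A \<Omega> \<Theta> v)"
    then have nb: "near_base A f" and p: "\<And>a \<alpha>. p_coord f a \<alpha> = p_value ?\<tau> W a \<alpha>"
      unfolding in_cone by auto
    have \<tau>: "admissible ?\<tau>" using nb by (simp add: near_base_admissible)
    have Wdeg: "\<And>\<alpha>. deg_le (W \<alpha>) (-1)" using W[OF nb] by simp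
    have small: "small W" by (rule small_of_deg) (rule Wdeg)
    have dom: "in_domain A f"
      unfolding in_domain_iff p using nb p_value_deg[of ?\<tau> W, OF \<tau> Wdeg] by blast
    define g where "g = th W \<star> qcol ?\<tau>"
    have qvec: "loop_vec (qcol ?\<tau>)"
      unfolding loop_vec_def
    proof
      fix k show "Deg (qcol ?\<tau> k) (k - 1)"
        using loop_vec_lp[OF dom] qcol_t_coord[of k f]
        by (cases "k < 0") (simp add: qcol_def, simp add: loop_vec_def)
    qed
    have gvec: "loop_vec (trunc g)" unfolding g_def
      by (intro loop_vec_trunc loop_vec_conv loop_op_th Wdeg qvec)
    have g0: "g 0 = 0"
    proof (rule mat_eqI)
      fix \<alpha> and j :: 1
      have j: "j = 1" by simp
      show "g 0 $ \<alpha> $ j = 0 $ \<alpha> $ j" unfolding j using EL_fixpoint[OF small, of ?\<tau> \<alpha>] W(2)[OF nb] by (simp add: g_def)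
    qed
    have lp: "oh W \<star> trunc g = lp f"
    proof
      fix k
      show "(oh W \<star> trunc g) k = lp f k"
      proof (cases "k \<ge> 0")
        case True
        have "(oh W \<star> trunc g) k = (oh W \<star> g) k"
          by (rule conv_nonneg) (use True in \<open>auto simp: oh_pos trunc_def\<close>)
        also have "\<dots> = qcol ?\<tau> k"
          unfolding g_def by (simp add: lconv_assoc loop_op_oh loop_op_th Wdeg qvec th_oh[OF small])
        finally show ?thesis using qcol_t_coord[OF True] by simp
      next
        case False
        then obtain a where k: "k = - int a - 1" by (metis add_diff_cancel_left' int_cases minus_diff_eq diff_minus_eq_add negD not_le of_nat_Suc uminus_add_conv_diff)
        show ?thesis
        proof (rule mat_eqI)
          fix \<alpha> and j :: 1
          have j: "j = 1" by simp
          show "(oh W \<star> trunc g) k $ \<alpha> $ j = lp f k $ \<alpha> $ j"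
            unfolding k p_entry p j using p_value_trunc[OF small, of ?\<tau> a \<alpha>] by (simp add: g_def)
        qed
      qed
    qed
    have "th W \<star> lp f = trunc g"
      unfolding lp[symmetric]
      by (simp add: lconv_assoc loop_op_oh loop_op_th Wdeg gvec th_oh[OF small])
    then have "\<forall>k\<le>0. (th W \<star> lp f) k = 0" using g0 by (auto simp: trunc_def le_less)
    then show "in_domain A f \<and> (\<exists>V. (\<forall>\<alpha>. deg_le (V \<alpha>) (-1)) \<and> (\<forall>k\<le>0. (th V \<star> lp f) k = 0))"
      using dom Wdeg by blast
  next
    assume "in_domain A f \<and> (\<exists>V. (\<forall>\<alpha>. deg_le (V \<alpha>) (-1)) \<and> (\<forall>k\<le>0. (th V \<star> lp f) k = 0))"
    then obtain V where dom: "in_domain A f" and Vdeg: "\<And>\<alpha>. deg_le (V \<alpha>) (-1)"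
      and V0: "\<And>k. k \<le> 0 \<Longrightarrow> (th V \<star> lp f) k = 0" by blast
    have nb: "near_base A f" using dom by (simp add: in_domain_iff)
    have \<tau>: "admissible ?\<tau>" using nb by (simp add: near_base_admissible)
    have small: "small V" by (rule small_of_deg) (rule Vdeg)
    have g: "(th V \<star> qcol ?\<tau>) k = (th V \<star> lp f) k" if "k \<ge> 0" for k
      by (rule conv_nonneg) (use that in \<open>auto simp: th_pos qcol_t_coord\<close>)
    have "EL_rhs ?\<tau> V = V"
      using EL_fixpoint[OF small, of ?\<tau>] g[of 0] V0[of 0] by auto
    then have VW: "V = W"
      using EL_unique[OF _ small small_of_deg[of W]] W[OF nb] \<tau> by (auto simp: admissible_def)
    have "th V \<star> lp f = trunc (th V \<star> qcol ?\<tau>)"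
      using g V0 by (auto simp: trunc_def fun_eq_iff)
    then have "oh V \<star> trunc (th V \<star> qcol ?\<tau>) = oh V \<star> (th V \<star> lp f)" by simp
    also have "\<dots> = lp f"
      by (simp add: lconv_assoc loop_op_oh loop_op_th Vdeg loop_vec_lp[OF dom] th_oh[OF small])
    finally have lp: "oh V \<star> trunc (th V \<star> qcol ?\<tau>) = lp f" .
    have "p_coord f a \<alpha> = p_value ?\<tau> V a \<alpha>" for a \<alpha>
    proof -
      have "(-1) ^ (a + 1) * p_coord f a \<alpha> = (-1) ^ (a + 1) * p_value ?\<tau> V a \<alpha>"
        using p_value_trunc[OF small, of ?\<tau> a \<alpha>] unfolding lp p_entry .
      then show ?thesis using sgn by metis
    qed
    then show "f \<in> graph_cone A (descendant_potential A \<Omega> \<Theta> v)"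
      unfolding in_cone using nb VW by simp
  qed
qed

end


section \<open>Canonical coordinates and the canonical frame\<close>

definition cst :: "'v mseries ^ 'p ^ 'q \<Rightarrow> complex ^ 'p ^ 'q" where
  "cst M = (\<chi> i j. mcoeff (M $ i $ j) {#})"

lemma cst_mult: "cst (A ** B) = cst A ** cst B"
  by (simp add: cst_def vec_eq_iff matrix_mult_nth)

lemma cst_cmat [simp]: "cst (cmat A) = A"
  by (simp add: cst_def cmat_def vec_eq_iff mcoeff_mconst)

lemma cmat_nth: "cmat A $ i $ j = mconst (A $ i $ j)"
  by (simp add: cmat_def)

lemma cst_one [simp]: "cst (mat 1) = mat 1" and cst_zero [simp]: "cst 0 = 0"
  and cst_diff: "cst (A - B) = cst A - cst B"
  by (auto simp: cst_def mat_def vec_eq_iff mcoeff_1)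

lemma cst_Msubst [simp]: "small (s :: 'u::finite \<Rightarrow> _) \<Longrightarrow> cst (Msubst s A) = cst A"
  by (simp add: cst_def Msubst_def vec_eq_iff)

context calibrated
begin

definition c0 :: "'n \<Rightarrow> complex ^ 'n ^ 'n" where "c0 \<gamma> = cst (Cm \<gamma>)"

text \<open>Multiplication by the vector \<open>\<partial>U/\<partial>t\<^sup>\<gamma>\<close> in the algebra at the origin.\<close>

definition Kc :: "('n \<Rightarrow> 'n mseries) \<Rightarrow> 'n \<Rightarrow> 'n mseries ^ 'n ^ 'n" where
  "Kc U \<gamma> = (\<Sum>\<delta>\<in>UNIV. smat (mderiv \<gamma> (U \<delta>)) (cmat (c0 \<delta>)))"

text \<open>In the basis of idempotents at the origin the structure matrices \<open>Cm \<gamma>\<close> form a closed commuting family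
  that is diagonal at the origin. Its formal asymptotic solutions \<open>exp (u k / z) * r k\<close>, one for each
  idempotent, are the columns of the frame, and the \<open>u k\<close> are the canonical coordinates. Since \<open>Kc U\<close> is
  the diagonal matrix of the \<open>\<partial>\<^sub>\<gamma> (u k)\<close> in that basis, transforming back to the flat basis yields a
  gauge transformation \<open>Rv\<close> from the constant part, in the coordinates \<open>U\<close>, to \<open>F\<close>.\<close>

lemma canonical_frame:
  assumes ss: "semisimple_at_origin F"
  obtains U Rv where "small U"
    "\<And>\<alpha> \<gamma>. mcoeff (mderiv \<gamma> (U \<alpha>)) {#} = (if \<alpha> = \<gamma> then 1 else 0)"
    "cst (Rv 0) = mat 1" "\<And>\<gamma>. Cm \<gamma> ** Rv 0 = Rv 0 ** Kc U \<gamma>"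
    "\<And>\<gamma> j. mat_deriv \<gamma> (Rv j) = Cm \<gamma> ** Rv (Suc j) - Rv (Suc j) ** Kc U \<gamma>"
proof -
  obtain \<pi> :: "'n \<Rightarrow> complex ^ 'n" where span: "vec.span (range \<pi>) = UNIV"
    and idem: "\<And>k l. origin_mult F (\<pi> k) (\<pi> l) = (if k = l then \<pi> k else 0)"
    using ss unfolding semisimple_at_origin_def by blast
  define P where "P = (\<chi> \<alpha> k. \<pi> k $ \<alpha>)"
  have "columns P = range \<pi>"
    by (auto simp: columns_def column_def P_def image_iff vec_eq_iff)
  then obtain Pi where P1: "P ** Pi = mat 1"
    using span matrix_right_invertible_span_columns[of P] by auto
  have P2: "Pi ** P = mat 1" using P1 matrix_left_right_inverse by blast
  have cP1: "cmat P ** cmat Pi = mat 1" and cP2: "cmat Pi ** cmat P = mat 1"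
    unfolding cmat_mult[symmetric] P1 P2 by simp_all
  \<comment> \<open>Multiplication by a coordinate vector at the origin is diagonal in the idempotents, with the
    coordinates of that vector as eigenvalues.\<close>
  have c0_P: "(c0 \<delta> ** P) $ \<alpha> $ k = Pi $ k $ \<delta> * P $ \<alpha> $ k" for \<delta> \<alpha> k
  proof -
    have *: "(\<Sum>\<gamma>\<in>UNIV. P $ \<gamma> $ l * (c0 \<gamma> ** P) $ \<alpha> $ k) = (if l = k then P $ \<alpha> $ k else 0)" for l
    proof -
      have "(\<Sum>\<gamma>\<in>UNIV. P $ \<gamma> $ l * (c0 \<gamma> ** P) $ \<alpha> $ k) = origin_mult F (\<pi> l) (\<pi> k) $ \<alpha>"
        by (simp add: origin_mult_def P_def c0_def cst_def Cm_def matrix_mult_nth sum_distrib_left mult_ac)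
      then show ?thesis by (simp add: idem P_def)
    qed
    have "(c0 \<delta> ** P) $ \<alpha> $ k = (\<Sum>\<gamma>\<in>UNIV. (P ** Pi) $ \<gamma> $ \<delta> * (c0 \<gamma> ** P) $ \<alpha> $ k)"
      by (simp add: P1 mat_def if_distrib[of "\<lambda>x. x * _"] cong: if_cong)
    also have "\<dots> = (\<Sum>\<gamma>\<in>UNIV. \<Sum>l\<in>UNIV. Pi $ l $ \<delta> * (P $ \<gamma> $ l * (c0 \<gamma> ** P) $ \<alpha> $ k))"
      by (simp add: matrix_mult_nth[of P Pi] sum_distrib_right sum_distrib_left mult_ac)
    also have "\<dots> = (\<Sum>l\<in>UNIV. Pi $ l $ \<delta> * (\<Sum>\<gamma>\<in>UNIV. P $ \<gamma> $ l * (c0 \<gamma> ** P) $ \<alpha> $ k))"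
      by (subst sum.swap) (simp add: sum_distrib_left)
    finally show ?thesis by (simp add: * if_distrib cong: if_cong)
  qed
  \<comment> \<open>Any distinct numbers serve as eigenvalues of a generic direction \<open>x\<close>.\<close>
  define n where "n k = (of_nat (to_nat (k :: 'n)) :: complex)" for k
  define x where "x = (\<lambda>\<gamma>. \<Sum>l\<in>UNIV. P $ \<gamma> $ l * n l)"
  define M where "M \<gamma> = cmat Pi ** Cm \<gamma> ** cmat P" for \<gamma>
  interpret M: closed_commuting_family M "\<lambda>\<gamma> k. Pi $ k $ \<gamma>" x
  proof
    have MM: "M \<gamma> ** M \<delta> = cmat Pi ** (Cm \<gamma> ** Cm \<delta>) ** cmat P" for \<gamma> \<delta>
    proof -
      have "M \<gamma> ** M \<delta> = cmat Pi ** Cm \<gamma> ** (cmat P ** cmat Pi) ** Cm \<delta> ** cmat P"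
        by (simp add: M_def matrix_mul_assoc)
      then show ?thesis unfolding cP1 by (simp add: matrix_mul_assoc)
    qed
    show "M \<gamma> ** M \<delta> = M \<delta> ** M \<gamma>" for \<gamma> \<delta> unfolding MM Cm_commute[of \<gamma>] ..
    show "mat_deriv \<delta> (M \<gamma>) = mat_deriv \<gamma> (M \<delta>)" for \<gamma> \<delta>
      by (simp add: M_def mat_deriv_mult Cm_closed[of \<delta>])
    show "mcoeff (M \<gamma> $ i $ j) {#} = (if i = j then Pi $ i $ \<gamma> else 0)" for \<gamma> i j
    proof -
      have "mcoeff (M \<gamma> $ i $ j) {#} = cst (M \<gamma>) $ i $ j" by (simp add: cst_def)
      also have "\<dots> = (Pi ** (c0 \<gamma> ** P)) $ i $ j"
        by (simp add: M_def cst_mult c0_def matrix_mul_assoc)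
      also have "\<dots> = Pi $ j $ \<gamma> * (Pi ** P) $ i $ j"
        by (subst (1 2) matrix_mult_nth) (simp add: c0_P sum_distrib_left mult_ac)
      finally show ?thesis by (simp add: P2 mat_def)
    qed
    have "(\<Sum>\<gamma>\<in>UNIV. x \<gamma> * Pi $ k $ \<gamma>) = n k" for k
    proof -
      have "(\<Sum>\<gamma>\<in>UNIV. x \<gamma> * Pi $ k $ \<gamma>) = (\<Sum>\<gamma>\<in>UNIV. \<Sum>l\<in>UNIV. Pi $ k $ \<gamma> * P $ \<gamma> $ l * n l)"
        by (simp add: x_def sum_distrib_right sum_distrib_left mult_ac)
      also have "\<dots> = (\<Sum>l\<in>UNIV. (Pi ** P) $ k $ l * n l)"
        by (subst sum.swap) (simp add: matrix_mult_nth sum_distrib_right)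
      finally show ?thesis by (simp add: P2 mat_def if_distrib[of "\<lambda>x. x * _"] cong: if_cong)
    qed
    then show "inj (\<lambda>k. \<Sum>\<gamma>\<in>UNIV. x \<gamma> * Pi $ k $ \<gamma>)" by (auto simp: n_def inj_def)
  qed
  have "\<exists>u r. mcoeff u {#} = 0 \<and> (\<forall>\<gamma>. mcoeff (mderiv \<gamma> u) {#} = Pi $ k $ \<gamma>)
    \<and> (\<forall>i. mcoeff (r 0 $ i) {#} = (if i = k then 1 else 0))
    \<and> (\<forall>\<gamma>. M \<gamma> *v r 0 = mderiv \<gamma> u *s r 0)
    \<and> (\<forall>\<gamma> j. vderiv \<gamma> (r j) = M \<gamma> *v r (Suc j) - mderiv \<gamma> u *s r (Suc j))" for k
    by (rule M.formal_asymptotic_solution[of k]) blast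
  then obtain u r where u0: "\<And>k. mcoeff (u k) {#} = 0"
    and du: "\<And>k \<gamma>. mcoeff (mderiv \<gamma> (u k)) {#} = Pi $ k $ \<gamma>"
    and r0: "\<And>k i. mcoeff (r k 0 $ i) {#} = (if i = k then 1 else 0)"
    and Mr: "\<And>k \<gamma>. M \<gamma> *v r k 0 = mderiv \<gamma> (u k) *s r k 0"
    and dr: "\<And>k \<gamma> j. vderiv \<gamma> (r k j) = M \<gamma> *v r k (Suc j) - mderiv \<gamma> (u k) *s r k (Suc j)"
    by metis
  define U where "U \<alpha> = (\<Sum>k\<in>UNIV. mconst (P $ \<alpha> $ k) * u k)" for \<alpha>
  define Rh where "Rh j = (\<chi> i k. r k j $ i)" for j
  define D where "D \<gamma> = (\<chi> i k. if i = k then mderiv \<gamma> (u k) else 0)" for \<gamma>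
  define Rv where "Rv j = cmat P ** Rh j ** cmat Pi" for j
  have RhD: "(Rh j ** D \<gamma>) $ i $ k = mderiv \<gamma> (u k) * r k j $ i" for j \<gamma> i k
    by (simp add: matrix_mult_nth Rh_def D_def if_distrib mult.commute cong: if_cong)
  have MRh: "(M \<gamma> ** Rh j) $ i $ k = (M \<gamma> *v r k j) $ i" for \<gamma> j i k
    by (simp add: matrix_mult_nth Rh_def matrix_vector_mult_def)
  have dU: "mderiv \<gamma> (U \<alpha>) = (\<Sum>k\<in>UNIV. mconst (P $ \<alpha> $ k) * mderiv \<gamma> (u k))" for \<gamma> \<alpha>
    by (simp add: U_def mderiv_sum mderiv_mconst_mult)
  have KP: "Kc U \<gamma> ** cmat P = cmat P ** D \<gamma>" for \<gamma>
  proof (rule mat_eqI)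
    fix \<alpha> k
    have e: "cmat (c0 \<delta>) ** cmat P = cmat (c0 \<delta> ** P)" for \<delta> by (simp add: cmat_mult)
    have "(Kc U \<gamma> ** cmat P) $ \<alpha> $ k = (\<Sum>\<delta>\<in>UNIV. mderiv \<gamma> (U \<delta>) * (cmat (c0 \<delta>) ** cmat P) $ \<alpha> $ k)"
      by (simp add: Kc_def matrix_sum_mult smat_mult[symmetric])
    also have "\<dots> = (\<Sum>\<delta>\<in>UNIV. mderiv \<gamma> (U \<delta>) * mconst (Pi $ k $ \<delta>)) * mconst (P $ \<alpha> $ k)"
      unfolding e cmat_nth by (simp add: c0_P mconst_mult sum_distrib_left mult_ac)
    also have "(\<Sum>\<delta>\<in>UNIV. mderiv \<gamma> (U \<delta>) * mconst (Pi $ k $ \<delta>))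
        = (\<Sum>\<delta>\<in>UNIV. \<Sum>l\<in>UNIV. mconst (Pi $ k $ \<delta> * P $ \<delta> $ l) * mderiv \<gamma> (u l))"
      by (simp add: dU sum_distrib_right sum_distrib_left mconst_mult mult_ac)
    also have "\<dots> = (\<Sum>l\<in>UNIV. mconst ((Pi ** P) $ k $ l) * mderiv \<gamma> (u l))"
      by (subst sum.swap) (simp add: matrix_mult_nth mconst_sum sum_distrib_right)
    also have "\<dots> = mderiv \<gamma> (u k)"
      by (simp add: P2 mat_def if_distrib[of mconst] if_distrib[of "\<lambda>x. x * _"] cong: if_cong)
    also have "mderiv \<gamma> (u k) * mconst (P $ \<alpha> $ k) = (cmat P ** D \<gamma>) $ \<alpha> $ k"
      by (simp add: matrix_mult_nth D_def cmat_def if_distrib mult.commute cong: if_cong)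
    finally show "(Kc U \<gamma> ** cmat P) $ \<alpha> $ k = (cmat P ** D \<gamma>) $ \<alpha> $ k" .
  qed
  have PiK: "cmat Pi ** Kc U \<gamma> = D \<gamma> ** cmat Pi" for \<gamma>
  proof -
    have "cmat Pi ** Kc U \<gamma> = cmat Pi ** (Kc U \<gamma> ** cmat P) ** cmat Pi"
      by (simp add: matrix_mul_assoc[symmetric] cP1)
    also have "\<dots> = D \<gamma> ** cmat Pi" unfolding KP by (simp add: matrix_mul_assoc cP2)
    finally show ?thesis .
  qed
  have PM: "Cm \<gamma> ** cmat P = cmat P ** M \<gamma>" for \<gamma>
    by (simp add: M_def matrix_mul_assoc cP1)
  have CRv: "Cm \<gamma> ** Rv j = cmat P ** (M \<gamma> ** Rh j) ** cmat Pi" for \<gamma> j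
    by (simp add: Rv_def matrix_mul_assoc PM)
  have RvK: "Rv j ** Kc U \<gamma> = cmat P ** (Rh j ** D \<gamma>) ** cmat Pi" for \<gamma> j
    by (simp add: Rv_def matrix_mul_assoc[symmetric] PiK)
  show thesis
  proof (rule that[of U Rv])
    show "small U" by (simp add: small_def U_def u0)
    show "mcoeff (mderiv \<gamma> (U \<alpha>)) {#} = (if \<alpha> = \<gamma> then 1 else 0)" for \<alpha> \<gamma>
    proof -
      have "mcoeff (mderiv \<gamma> (U \<alpha>)) {#} = (P ** Pi) $ \<alpha> $ \<gamma>" by (simp add: dU du matrix_mult_nth mcoeff_mconst)
      then show ?thesis by (simp add: P1 mat_def)
    qed
    have "cst (Rh 0) = mat 1" by (simp add: cst_def Rh_def r0 mat_def vec_eq_iff)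
    then show "cst (Rv 0) = mat 1" by (simp add: Rv_def cst_mult P1)
    have "M \<gamma> ** Rh 0 = Rh 0 ** D \<gamma>" for \<gamma>
      by (rule mat_eqI) (simp add: RhD MRh Mr)
    then show "Cm \<gamma> ** Rv 0 = Rv 0 ** Kc U \<gamma>" for \<gamma> by (simp add: CRv RvK)
    have "mat_deriv \<gamma> (Rh j) = M \<gamma> ** Rh (Suc j) - Rh (Suc j) ** D \<gamma>" for \<gamma> j
    proof (rule mat_eqI)
      fix i k
      show "mat_deriv \<gamma> (Rh j) $ i $ k = (M \<gamma> ** Rh (Suc j) - Rh (Suc j) ** D \<gamma>) $ i $ k"
        using arg_cong[OF dr[of \<gamma> k j], of "\<lambda>v. v $ i"]
        by (simp add: RhD MRh) (simp add: Rh_def vderiv_def)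
    qed
    then show "mat_deriv \<gamma> (Rv j) = Cm \<gamma> ** Rv (Suc j) - Rv (Suc j) ** Kc U \<gamma>" for \<gamma> j
      unfolding CRv RvK by (simp add: Rv_def mat_deriv_mult matrix_distrib)
  qed
qed

end

text \<open>The change between flat and canonical coordinates is tangent to the identity, hence invertible
  on formal points.\<close>

lemma formal_inverse_function:
  fixes U :: "'n::finite \<Rightarrow> 'n mseries" and W :: "'n \<Rightarrow> ('n \<times> nat) mseries"
  assumes U: "small U" "\<And>\<alpha> \<gamma>. mcoeff (mderiv \<gamma> (U \<alpha>)) {#} = (if \<alpha> = \<gamma> then 1 else 0)"
    and W: "\<And>\<alpha>. deg_le (W \<alpha>) (-1)"
  obtains V where "\<And>\<alpha>. deg_le (V \<alpha>) (-1)" "\<And>\<alpha>. msubst V (U \<alpha>) = W \<alpha>"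
proof -
  define H where "H \<alpha> = U \<alpha> - mvar \<alpha>" for \<alpha>
  have H: "ord_ge (H \<alpha>) (Suc (Suc 0))" for \<alpha>
    unfolding ord_ge_Suc_iff_mderiv using U
    by (auto simp: H_def small_def mcoeff_mvar mderiv_diff mderiv_mvar mcoeff_1)
  define T where "T V \<alpha> = W \<alpha> - msubst V (H \<alpha>)" for V \<alpha>
  obtain V where Vdeg: "\<And>\<alpha>. deg_le (V \<alpha>) (-1)" and V: "T V = V"
  proof (rule deg_contraction_fixpoint[of T])
    show "deg_le (T V \<alpha>) (-1)" if "\<And>\<alpha>. deg_le (V \<alpha>) (-1)" for V \<alpha>
      unfolding T_def using H[of \<alpha>] that by (intro deg_le_diff W deg_le_msubst_neg) auto
    show "ord_ge (T f \<alpha> - T g \<alpha>) (Suc n)"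
      if "small f" "small g" "\<And>i. ord_ge (f i - g i) n" for f g n \<alpha>
    proof -
      have "ord_ge (- (msubst f (H \<alpha>) - msubst g (H \<alpha>))) (n + Suc 0)"
        unfolding ord_ge_uminus by (rule ord_ge_msubst_diff[OF that H])
      then show ?thesis by (simp add: T_def)
    qed
  qed blast
  have "small V" by (rule small_of_deg) (rule Vdeg)
  then have "msubst V (U \<alpha>) = msubst V (H \<alpha>) + V \<alpha>" for \<alpha>
    by (simp add: H_def msubst_diff)
  moreover have "V \<alpha> = W \<alpha> - msubst V (H \<alpha>)" for \<alpha> using fun_cong[OF V, of \<alpha>] by (simp add: T_def)
  ultimately have "msubst V (U \<alpha>) = W \<alpha>" for \<alpha> by (metis add.commute diff_add_cancel)
  then show thesis using that Vdeg by blast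
qed

text \<open>The system expresses each order of \<open>D k\<close> by the preceding order of \<open>D (k + 1)\<close>.\<close>

lemma flat_section_unique:
  assumes d: "\<And>x k. mat_deriv x (D k) = X x ** D (k + 1)" and c: "\<And>k::int. cst (D k) = 0"
  shows "D k = 0"
proof -
  have "Ord (D k) n" for n k
  proof (induction n arbitrary: k)
    case (Suc n)
    have "Ord (mat_deriv x (D k)) n" for x
      unfolding d by (rule Ord_mult[OF Ord_0 Suc]) simp
    then show ?case using c[of k] by (simp add: Ord_def ord_ge_Suc_iff_mderiv cst_def vec_eq_iff)
  qed simp
  then have "D k $ i $ j = 0" for i j by (intro ord_ge_all_eq_0) (simp add: Ord_def)
  then show ?thesis by (simp add: vec_eq_iff)
qed

lemma Lfin_op_mid_op:
  assumes a: "loop_op a" and b: "loop_op b" shows "Lfin (\<lambda>n. a n ** X ** b (k - n))"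
  unfolding Lfin_def lfin_def
proof safe
  fix i j m
  have "{n. mcoeff ((a n ** X ** b (k - n)) $ i $ j) m \<noteq> 0} \<subseteq> {- int (size m)..k + int (size m)}"
  proof
    fix n assume "n \<in> {n. mcoeff ((a n ** X ** b (k - n)) $ i $ j) m \<noteq> 0}"
    then obtain m1 m2 m3 l l' where "m = (m1 + m2) + m3" "mcoeff (a n $ i $ l) m1 \<noteq> 0"
      "mcoeff (b (k - n) $ l' $ j) m3 \<noteq> 0" by (elim CollectE matrix_mult_coeffE) metis
    then show "n \<in> {- int (size m)..k + int (size m)}"
      using loop_op_coeff(2)[OF a] loop_op_coeff(2)[OF b] by fastforce
  qed
  then show "finite {n. mcoeff ((a n ** X ** b (k - n)) $ i $ j) m \<noteq> 0}" using finite_subset by blast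
qed

lemma cst_conv_right:
  assumes "\<And>n. n \<noteq> 0 \<Longrightarrow> cst (b n) = 0" shows "cst ((a \<star> b) k) = cst (a k) ** cst (b 0)"
proof (rule mat_eqI)
  fix i j
  have "cst ((a \<star> b) k) $ i $ j = (\<Sum>n\<in>{k}. mcoeff ((a n ** b (k - n)) $ i $ j) {#})"
    unfolding lconv_def cst_def vec_lambda_beta Msum_nth
  proof (rule mcoeff_msum_superset)
    fix n assume "n \<notin> {k}"
    then have "cst (a n ** b (k - n)) = 0" unfolding cst_mult using assms[of "k - n"] by simp
    then show "mcoeff ((a n ** b (k - n)) $ i $ j) {#} = 0" by (simp add: cst_def vec_eq_iff)
  qed simp
  also have "\<dots> = cst (a k ** b 0) $ i $ j" by (simp add: cst_def)
  finally show "cst ((a \<star> b) k) $ i $ j = (cst (a k) ** cst (b 0)) $ i $ j" by (simp add: cst_mult)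
qed

lemma cst_conv_left:
  assumes "\<And>n. n \<noteq> 0 \<Longrightarrow> cst (a n) = 0" shows "cst ((a \<star> b) k) = cst (a 0) ** cst (b k)"
proof (rule mat_eqI)
  fix i j
  have "cst ((a \<star> b) k) $ i $ j = (\<Sum>n\<in>{0}. mcoeff ((a n ** b (k - n)) $ i $ j) {#})"
    unfolding lconv_def cst_def vec_lambda_beta Msum_nth
  proof (rule mcoeff_msum_superset)
    fix n :: int assume "n \<notin> {0}"
    then have "cst (a n ** b (k - n)) = 0" unfolding cst_mult using assms[of n] by simp
    then show "mcoeff ((a n ** b (k - n)) $ i $ j) {#} = 0" by (simp add: cst_def vec_eq_iff)
  qed simp
  also have "\<dots> = cst (a 0 ** b k) $ i $ j" by (simp add: cst_def)
  finally show "cst ((a \<star> b) k) $ i $ j = (cst (a 0) ** cst (b k)) $ i $ j" by (simp add: cst_mult)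
qed

definition zser :: "(nat \<Rightarrow> 'v mseries ^ 'p ^ 'q) \<Rightarrow> int \<Rightarrow> 'v mseries ^ 'p ^ 'q" where
  "zser R k = (if k < 0 then 0 else R (nat k))"

lemma (in calibrated) cst_th:
  assumes "small V" "n \<noteq> 0" shows "cst (th V n) = 0"
proof (cases "n < 0")
  case True
  then have "1 \<le> nat (- n)" by simp
  then have "Ord (th V n) 1" using Ord_th[OF assms(1), of n] ord_ge_mono
    unfolding Ord_def by blast
  then show ?thesis by (simp add: Ord_def cst_def ord_ge_1_iff[simplified] vec_eq_iff)
qed (use assms in \<open>simp add: th_pos\<close>)


section \<open>The group element\<close>

text \<open>The frame of \<open>F\<close> at \<open>V\<close> and the frame of its constant part at the canonical coordinates of
  \<open>V\<close> differ by \<open>R(z)\<close> on one side and by a series in nonnegative powers of \<open>z\<close> on the other,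
  since both products solve the same linear system and agree at the origin.\<close>

lemma frame_comparison:
  fixes U :: "'n::finite \<Rightarrow> 'n mseries" and V :: "'n \<Rightarrow> ('n \<times> nat) mseries"
  assumes cal: "calibrated F A \<Omega> \<Theta>" and cal0: "calibrated F0 A \<Omega>0 \<Theta>0"
    and const: "\<And>\<gamma>. calibrated.Cm F0 \<gamma> = cmat (calibrated.c0 F \<gamma>)"
    and U: "small U" and V: "\<And>\<alpha>. deg_le (V \<alpha>) (-1)"
    and Rv0: "\<And>\<gamma>. calibrated.Cm F \<gamma> ** Rv 0 = Rv 0 ** calibrated.Kc F U \<gamma>"
    and dRv: "\<And>\<gamma> j. mat_deriv \<gamma> (Rv j) = calibrated.Cm F \<gamma> ** Rv (Suc j)
        - Rv (Suc j) ** calibrated.Kc F U \<gamma>"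
  shows "calibrated.th \<Theta> V \<star> zser (\<lambda>j. cmat (cst (Rv j)))
    = zser (\<lambda>j. Msubst V (Rv j)) \<star> calibrated.th \<Theta>0 (\<lambda>\<alpha>. msubst V (U \<alpha>))"
proof -
  interpret C: calibrated F A \<Omega> \<Theta> by (rule cal)
  interpret C0: calibrated F0 A \<Omega>0 \<Theta>0 by (rule cal0)
  define W where "W = (\<lambda>\<alpha>. msubst V (U \<alpha>))"
  have smV: "small V" by (rule small_of_deg) (rule V)
  have Wdeg: "deg_le (W \<alpha>) (-1)" for \<alpha>
    unfolding W_def using U by (intro deg_le_msubst_neg[OF V]) (auto simp: ord_ge_1_iff[simplified] small_def)
  have smW: "small W" by (rule small_of_deg) (rule Wdeg)
  define R where "R = (zser (\<lambda>j. cmat (cst (Rv j))) :: int \<Rightarrow> ('n \<times> nat) mseries ^ 'n ^ 'n)"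
  define RV where "RV = zser (\<lambda>j. Msubst V (Rv j))"
  have opRV: "loop_op RV"
    unfolding loop_op_def RV_def zser_def by (auto intro!: Deg_Msubst[OF V Ord_0])
  have opW: "loop_op (C0.th W)" by (rule C0.loop_op_th) (rule Wdeg)
  let ?X = "\<lambda>x. C.Cx V (C.dcol x V)" and ?K = "\<lambda>x. C0.Cx W (C0.dcol x W)"
  have K: "?K x = (\<Sum>\<gamma>\<in>UNIV. smat (mderiv x (V \<gamma>)) (Msubst V (C.Kc U \<gamma>)))" for x
  proof (rule mat_eqI)
    fix i j :: 'n
    have e: "Msubst V (cmat B) $ i $ j = cmat B $ i $ j" for B by simp
    have "?K x $ i $ j = (\<Sum>\<delta>\<in>UNIV. mderiv x (W \<delta>) * cmat (C.c0 \<delta>) $ i $ j)"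
      by (simp add: C0.Cx_def C0.dcol_def const)
    also have "\<dots> = (\<Sum>\<delta>\<in>UNIV. \<Sum>\<gamma>\<in>UNIV. mderiv x (V \<gamma>) * (msubst V (mderiv \<gamma> (U \<delta>)) * cmat (C.c0 \<delta>) $ i $ j))"
      by (simp add: W_def mderiv_msubst smV sum_distrib_right sum_distrib_left mult_ac)
    also have "\<dots> = (\<Sum>\<gamma>\<in>UNIV. \<Sum>\<delta>\<in>UNIV. mderiv x (V \<gamma>) * (msubst V (mderiv \<gamma> (U \<delta>)) * cmat (C.c0 \<delta>) $ i $ j))"
      by (rule sum.swap)
    also have "\<dots> = (\<Sum>\<gamma>\<in>UNIV. smat (mderiv x (V \<gamma>)) (Msubst V (C.Kc U \<gamma>))) $ i $ j"
      by (simp add: C.Kc_def Msubst_sum[OF smV] sum_distrib_left)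
        (simp add: Msubst_def msubst_mult smV cmat_def)
    finally show "?K x $ i $ j = (\<Sum>\<gamma>\<in>UNIV. smat (mderiv x (V \<gamma>)) (Msubst V (C.Kc U \<gamma>))) $ i $ j" .
  qed
  have dRV: "mat_deriv x (RV n) = ?X x ** RV (n + 1) - RV (n + 1) ** ?K x" for x n
  proof -
    have X: "?X x ** Msubst V B - Msubst V B ** ?K x
        = (\<Sum>\<gamma>\<in>UNIV. smat (mderiv x (V \<gamma>)) (Msubst V (C.Cm \<gamma> ** B - B ** C.Kc U \<gamma>)))" for B
      unfolding K by (simp add: C.Cx_def C.dcol_def matrix_sum_mult smat_mult[symmetric]
          Msubst_diff[OF smV] Msubst_mult[OF smV] vec_eq_iff sum_subtractf right_diff_distrib)
    consider "n \<ge> 0" | "n = -1" | "n < -1" by linarith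
    then show ?thesis
    proof cases
      case 1
      then have "nat (n + 1) = Suc (nat n)" by simp
      then show ?thesis using 1
        by (simp add: RV_def zser_def X mat_deriv_Msubst[OF smV] dRv)
    next
      case 2
      then show ?thesis using X[of "Rv 0"] by (simp add: RV_def zser_def Rv0)
    next
      case 3
      then show ?thesis by (simp add: RV_def zser_def)
    qed
  qed
  define Y where "Y = C.th V \<star> R"
  define Z where "Z = RV \<star> C0.th W"
  have dR: "mat_deriv x (R j) = 0" for x j by (simp add: R_def zser_def)
  have dY: "mat_deriv x (Y k) = ?X x ** Y (k + 1)" for x k
    unfolding Y_def C.mat_deriv_th_conv[OF smV] dR by (simp add: lconv_def)
  have dZ: "mat_deriv x (Z k) = ?X x ** Z (k + 1)" for x k
  proof -
    let ?B = "\<lambda>n. RV n ** ?K x ** C0.th W (k + 1 - n)"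
    have bij: "bij (\<lambda>n::int. n + 1)" by (rule bij_betw_byWitness[where f' = "\<lambda>n. n - 1"]) auto
    have inj: "inj (\<lambda>n::int. n + 1)" using bij by (rule bij_is_inj)
    have lfB: "Lfin ?B" by (rule Lfin_op_mid_op[OF opRV opW])
    have lfB': "Lfin (\<lambda>n. ?B (n + 1))" by (rule Lfin_comp_inj[OF lfB inj])
    have lf: "Lfin (\<lambda>n. RV n ** C0.th W (k + 1 - n))" by (rule Lfin_op_op[OF opRV opW])
    have lf': "Lfin (\<lambda>n. RV (n + 1) ** C0.th W (k + 1 - (n + 1)))" by (rule Lfin_comp_inj[OF lf inj])
    have "mat_deriv x (Z k) = Msum (\<lambda>n. mat_deriv x (RV n ** C0.th W (k - n)))"
      unfolding Z_def lconv_def by (rule mat_deriv_Msum[OF Lfin_op_op[OF opRV opW]])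
    also have "\<dots> = Msum (\<lambda>n. (?X x ** (RV (n + 1) ** C0.th W (k + 1 - (n + 1))) - ?B (n + 1)) + ?B n)"
      by (simp add: mat_deriv_mult dRV C0.mat_deriv_th[OF smW] matrix_distrib matrix_mul_assoc
          algebra_simps)
    also have "\<dots> = (?X x ** Msum (\<lambda>n. RV (n + 1) ** C0.th W (k + 1 - (n + 1))) - Msum (\<lambda>n. ?B (n + 1)))
        + Msum ?B"
      by (simp only: Msum_add Msum_diff Lfin_diff Lfin_mult_left lf' lfB lfB' Msum_mult_left)
    also have "Msum (\<lambda>n. ?B (n + 1)) = Msum ?B" by (rule Msum_reindex[OF bij])
    also have "Msum (\<lambda>n. RV (n + 1) ** C0.th W (k + 1 - (n + 1))) = Z (k + 1)"
      unfolding Z_def lconv_def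
      by (rule Msum_reindex[OF bij, where f = "\<lambda>n. RV n ** C0.th W (k + 1 - n)"])
    finally show ?thesis by simp
  qed
  have cR: "cst (R k) = cst (RV k)" for k by (simp add: R_def RV_def zser_def smV)
  have cYZ: "cst (Y k) = cst (Z k)" for k
    unfolding Y_def Z_def
    by (simp add: cst_conv_left C.cst_th[OF smV] cst_conv_right C0.cst_th[OF smW] cR)
  have "Y k - Z k = 0" for k
    by (rule flat_section_unique[where D = "\<lambda>k. Y k - Z k" and X = ?X])
      (simp_all add: mat_deriv_diff dY dZ matrix_distrib cst_diff cYZ)
  then have "Y = Z" by (auto simp: fun_eq_iff)
  then show ?thesis by (simp add: Y_def Z_def R_def RV_def W_def)
qed


lemma lp_eq_iff: "lp f = lp g \<longleftrightarrow> f = g"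
  by (auto simp: lp_def fun_eq_iff vec_eq_iff)

lemma loop_op_zser_cmat: "loop_op (zser (\<lambda>j. cmat (R j)))"
  unfolding loop_op_def zser_def by (auto intro: Deg_cmat)

lemma lp_loop_act: "lp (loop_act R f) = zser (\<lambda>j. cmat (R j)) \<star> lp f"
proof
  fix k
  show "lp (loop_act R f) k = (zser (\<lambda>j. cmat (R j)) \<star> lp f) k"
  proof (rule mat_eqI)
    fix \<alpha> and j :: 1
    let ?g = "\<lambda>n. (zser (\<lambda>j. cmat (R j)) n ** lp f (k - n)) $ \<alpha> $ j"
    have "msum ?g = msum (\<lambda>i. ?g (int i))"
    proof (rule msum_inj_support[symmetric])
      fix n :: int assume "n \<notin> range int"
      then have "n < 0" by (metis nonneg_int_cases not_le rangeI)
      then show "?g n = 0" by (simp add: zser_def)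
    qed simp
    also have "\<dots> = loop_act R f k \<alpha>"
      unfolding loop_act_def by (simp add: zser_def matrix_mult_nth cmat_nth lp_def)
    finally show "lp (loop_act R f) k $ \<alpha> $ j = (zser (\<lambda>j. cmat (R j)) \<star> lp f) k $ \<alpha> $ j"
      by (simp add: lconv_def lp_def)
  qed
qed

lemma in_domain_loop_act:
  assumes R: "R 0 = mat 1" and f: "in_domain A f" shows "in_domain A (loop_act R f)"
proof -
  have deg: "loop_vec (lp (loop_act R f))"
    unfolding lp_loop_act by (rule loop_vec_conv[OF loop_op_zser_cmat loop_vec_lp[OF f]])
  have "mcoeff (loop_act R f 1 \<alpha>) {#} = - A $ \<alpha>" for \<alpha>
  proof -
    have low: "mcoeff (f (1 - int i) \<mu>) {#} = 0" if "i \<noteq> 0" for i \<mu>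
    proof -
      have "deg_le (f (1 - int i) \<mu>) (1 - int i - 1)" using f unfolding in_domain_def by blast
      then show ?thesis using that deg_leD by fastforce
    qed
    have "mcoeff (loop_act R f 1 \<alpha>) {#}
        = (\<Sum>i\<in>{0}. mcoeff (\<Sum>\<mu>\<in>UNIV. mconst (R i $ \<alpha> $ \<mu>) * f (1 - int i) \<mu>) {#})"
      unfolding loop_act_def by (rule mcoeff_msum_superset) (auto simp: low)
    also have "\<dots> = - A $ \<alpha>"
      using f by (simp add: R mat_def in_domain_def if_distrib[of mconst] if_distrib[of "\<lambda>x. x * _"]
          if_distrib[of "\<lambda>x. mcoeff x _"] cong: if_cong)
    finally show ?thesis .
  qed
  then show ?thesis using deg by (simp add: in_domain_def loop_vec_def Deg_def lp_def)
qed

fun series_inverse :: "(nat \<Rightarrow> 'a::ring_1 ^ 'n ^ 'n) \<Rightarrow> nat \<Rightarrow> 'a ^ 'n ^ 'n" where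
  "series_inverse R 0 = mat 1"
| "series_inverse R (Suc n) = - (\<Sum>i\<le>n. R (Suc i) ** series_inverse R (n - i))"

lemma series_inverse_right:
  assumes "R 0 = mat 1"
  shows "(\<Sum>i\<le>n. R i ** series_inverse R (n - i)) = (if n = 0 then mat 1 else 0)"
proof (cases n)
  case (Suc m)
  then show ?thesis by (simp add: sum.atMost_Suc_shift assms del: sum.atMost_Suc)
qed (simp add: assms)

lemma zser_inverse:
  assumes RS: "\<And>n. (\<Sum>i\<le>n. R i ** S (n - i)) = (if n = 0 then mat 1 else 0)"
  shows "zser (\<lambda>j. cmat (R j)) \<star> zser (\<lambda>j. cmat (S j)) = lone"
proof
  fix k :: int
  let ?g = "\<lambda>n. zser (\<lambda>j. cmat (R j)) n ** zser (\<lambda>j. cmat (S j)) (k - n)"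
  have "Msum ?g = (\<Sum>n\<in>{0..k}. ?g n)"
    by (rule Msum_finite) (auto simp: zser_def)
  also have "\<dots> = lone k"
  proof (cases "k < 0")
    case False
    have "(\<Sum>n\<in>{0..k}. ?g n) = (\<Sum>i\<le>nat k. cmat (R i ** S (nat k - i)))"
      by (rule sum.reindex_bij_witness[where i = int and j = nat])
        (use False in \<open>auto simp: zser_def cmat_mult nat_diff_distrib\<close>)
    also have "\<dots> = cmat (\<Sum>i\<le>nat k. R i ** S (nat k - i))"
      by (simp add: vec_eq_iff cmat_nth mconst_sum)
    also have "\<dots> = lone k" unfolding RS using False by (auto simp: lone_def cmat_def vec_eq_iff mat_def)
    finally show ?thesis .
  qed (simp add: lone_def)
  finally show "(zser (\<lambda>j. cmat (R j)) \<star> zser (\<lambda>j. cmat (S j))) k = lone k" by (simp add: lconv_def)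
qed

text \<open>Since \<open>B 0\<close> is the identity at the origin, the coefficient of a monomial in \<open>(B \<star> h) k\<close> is that in
  \<open>h k\<close> plus contributions of proper submonomials and of lower powers of \<open>z\<close>. Induction over both is
  possible because, for a fixed monomial, the degree bounds the power of \<open>z\<close> from below.\<close>

lemma zser_reflects_vanishing:
  fixes h :: "int \<Rightarrow> ('n \<times> nat) mseries ^ 1 ^ 'n::finite"
  assumes B: "loop_op (zser B)" and B0: "cst (B 0) = mat 1" and h: "loop_vec h"
    and Bh: "\<And>k. k \<le> 0 \<Longrightarrow> (zser B \<star> h) k = 0"
  shows "k \<le> 0 \<Longrightarrow> h k = 0"
proof -
  have "mcoeff (h k $ i $ j) m = 0" if "k \<le> 0" for k i j m
    using that
  proof (induction m arbitrary: k i j rule: measure_induct_rule[where f = size])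
    case (less m)
    note small = less.IH
    show ?case using less.prems
    proof (induction "nat (k - mon_deg m)" arbitrary: k i j rule: less_induct)
      case (less k)
      show ?case
      proof (cases "k \<le> mon_deg m")
        case True
        then show ?thesis using loop_vec_coeff[OF h, of k i j m] by fastforce
      next
        case False
        let ?g = "\<lambda>n. (zser B n ** h (k - n)) $ i $ j"
        have g: "mcoeff (?g n) m = 0" if "n \<noteq> 0" for n
        proof (cases "n < 0")
          case n: False
          show ?thesis
          proof (rule ccontr)
            assume "mcoeff (?g n) m \<noteq> 0"
            then obtain a b l where m: "m = a + b" and nz: "mcoeff (h (k - n) $ l $ j) b \<noteq> 0"
              by (rule matrix_mult_coeffE)
            have kn: "k - n \<le> 0" "k - n < k" using n that less.prems by auto
            show False
            proof (cases "a = {#}")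
              case True
              have "mcoeff (h (k - n) $ l $ j) m = 0"
                by (rule less.hyps) (use kn False in auto)
              then show False using nz m True by simp
            next
              case False
              then have "size b < size m" using m by (simp add: nonempty_has_size)
              then show False using small[of b "k - n"] kn nz by simp
            qed
          qed
        qed (simp add: zser_def)
        have "0 = mcoeff ((zser B \<star> h) k $ i $ j) m" using Bh[OF less.prems] by simp
        also have "\<dots> = (\<Sum>n\<in>{0}. mcoeff (?g n) m)"
          unfolding lconv_def Msum_nth by (rule mcoeff_msum_superset) (use g in auto)
        also have "\<dots> = mcoeff (((mat 1 + (B 0 - mat 1)) ** h k) $ i $ j) m"
          by (simp add: zser_def)
        also have "\<dots> = mcoeff (h k $ i $ j) m + mcoeff (((B 0 - mat 1) ** h k) $ i $ j) m"
          unfolding matrix_distrib(2) by simp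
        also have "mcoeff (((B 0 - mat 1) ** h k) $ i $ j) m = 0"
        proof (rule ccontr)
          assume "mcoeff (((B 0 - mat 1) ** h k) $ i $ j) m \<noteq> 0"
          then obtain a b l where m: "m = a + b" and a: "mcoeff ((B 0 - mat 1) $ i $ l) a \<noteq> 0"
            and nz: "mcoeff (h k $ l $ j) b \<noteq> 0"
            by (rule matrix_mult_coeffE)
          have "cst (B 0 - mat 1) = 0" by (simp add: cst_diff B0)
          then have "a \<noteq> {#}" using a by (auto simp: cst_def vec_eq_iff)
          then have "size b < size m" using m by (simp add: nonempty_has_size)
          then show False using small[of b k] less.prems nz by simp
        qed
        finally show ?thesis by simp
      qed
    qed
  qed
  then show "k \<le> 0 \<Longrightarrow> h k = 0" by (auto simp: vec_eq_iff intro: mseries_eqI)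
qed

theorem theorem2p13:
  fixes F F0 :: "'n::finite \<Rightarrow> 'n mseries"
    and A :: "complex ^ 'n"
    and C C_const :: "'n loop_point set"
  assumes "flat_F_manifold F A"
    and "semisimple_at_origin F"
    and "ancestor_cone F A C"
    and "constant_part F A F0"
    and "ancestor_cone F0 A C_const"
  shows "\<exists>R\<in>G_plus. C = loop_act R ` C_const"
proof -
  obtain \<Omega> \<Theta> v where cal: "calibrated F A \<Omega> \<Theta>" and v: "topological_solution A \<Omega> \<Theta> v"
    and C: "C = graph_cone A (descendant_potential A \<Omega> \<Theta> v)"
    using assms(1,3) unfolding ancestor_cone_def ancestor_potentials_def calibrated_def by blast
  obtain \<Omega>0 \<Theta>0 v0 where cal0: "calibrated F0 A \<Omega>0 \<Theta>0" and v0: "topological_solution A \<Omega>0 \<Theta>0 v0"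
    and C0: "C_const = graph_cone A (descendant_potential A \<Omega>0 \<Theta>0 v0)"
    using assms(4,5) unfolding ancestor_cone_def ancestor_potentials_def calibrated_def constant_part_def
    by blast
  interpret C: calibrated F A \<Omega> \<Theta> by (rule cal)
  interpret C0: calibrated F0 A \<Omega>0 \<Theta>0 by (rule cal0)
  have const: "C0.Cm \<gamma> = cmat (C.c0 \<gamma>)" for \<gamma>
    using assms(4) by (simp add: constant_part_def C0.Cm_def C.c0_def C.Cm_def cst_def cmat_def vec_eq_iff)
  obtain U Rv where U: "small U" "\<And>\<alpha> \<gamma>. mcoeff (mderiv \<gamma> (U \<alpha>)) {#} = (if \<alpha> = \<gamma> then 1 else 0)"
    and Rv: "cst (Rv 0) = mat 1" "\<And>\<gamma>. C.Cm \<gamma> ** Rv 0 = Rv 0 ** C.Kc U \<gamma>"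
    "\<And>\<gamma> j. mat_deriv \<gamma> (Rv j) = C.Cm \<gamma> ** Rv (Suc j) - Rv (Suc j) ** C.Kc U \<gamma>"
    using C.canonical_frame[OF assms(2)] by blast
  define R where "R j = cst (Rv j)" for j
  have R0: "R 0 = mat 1" by (simp add: R_def Rv)
  let ?R = "zser (\<lambda>j. cmat (R j)) :: int \<Rightarrow> ('n \<times> nat) mseries ^ 'n ^ 'n"
  let ?RV = "\<lambda>V. zser (\<lambda>j. Msubst V (Rv j)) :: int \<Rightarrow> ('n \<times> nat) mseries ^ 'n ^ 'n"
  let ?W = "\<lambda>V \<alpha>. msubst V (U \<alpha>)"
  have Wdeg: "deg_le (?W V \<alpha>) (-1)" if "\<And>\<alpha>. deg_le (V \<alpha>) (-1)" for V :: "'n \<Rightarrow> ('n \<times> nat) mseries" and \<alpha>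
    using U(1) by (intro deg_le_msubst_neg[OF that]) (auto simp: ord_ge_1_iff[simplified] small_def)
  have opRV: "loop_op (?RV V)" if "\<And>\<alpha>. deg_le (V \<alpha>) (-1)" for V
    unfolding loop_op_def zser_def using that by (auto intro!: Deg_Msubst[OF _ Ord_0])
  have compare: "C.th V \<star> lp (loop_act R f) = ?RV V \<star> (C0.th (?W V) \<star> lp f)"
    if V: "\<And>\<alpha>. deg_le (V \<alpha>) (-1)" and f: "in_domain A f" for V f
  proof -
    have "C.th V \<star> lp (loop_act R f) = (C.th V \<star> ?R) \<star> lp f"
      unfolding lp_loop_act
      by (rule lconv_assoc[OF C.loop_op_th[OF V] loop_op_zser_cmat loop_vec_lp[OF f]])
    also have "C.th V \<star> ?R = ?RV V \<star> C0.th (?W V)"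
      unfolding R_def by (rule frame_comparison[OF cal cal0 const U(1) V Rv(2,3)])
    also have "\<dots> \<star> lp f = ?RV V \<star> (C0.th (?W V) \<star> lp f)"
      by (rule lconv_assoc[OF opRV[OF V] C0.loop_op_th[OF Wdeg[OF V]] loop_vec_lp[OF f], symmetric])
    finally show ?thesis .
  qed
  have memC: "f \<in> C \<longleftrightarrow> in_domain A f \<and> (\<exists>V. (\<forall>\<alpha>. deg_le (V \<alpha>) (-1)) \<and> (\<forall>k\<le>0. (C.th V \<star> lp f) k = 0))"
    for f unfolding C by (rule C.cone_iff[OF v])
  have memC0: "f \<in> C_const \<longleftrightarrow> in_domain A f \<and> (\<exists>V. (\<forall>\<alpha>. deg_le (V \<alpha>) (-1)) \<and> (\<forall>k\<le>0. (C0.th V \<star> lp f) k = 0))"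
    for f unfolding C0 by (rule C0.cone_iff[OF v0])
  \<comment> \<open>The factor \<open>?RV V\<close> has only nonnegative powers of \<open>z\<close>, so it preserves the vanishing that
    characterises the cones.\<close>
  have fwd: "loop_act R f \<in> C" if fC: "f \<in> C_const" for f
  proof -
    obtain W where f: "in_domain A f" and W: "\<And>\<alpha>. deg_le (W \<alpha>) (-1)"
      and z: "\<And>k. k \<le> 0 \<Longrightarrow> (C0.th W \<star> lp f) k = 0"
      using fC unfolding memC0 by auto
    obtain V where V: "\<And>\<alpha>. deg_le (V \<alpha>) (-1)" and VW: "\<And>\<alpha>. msubst V (U \<alpha>) = W \<alpha>"
      using formal_inverse_function[of U W, OF U W] by blast
    have "(C.th V \<star> lp (loop_act R f)) k = 0" if "k \<le> 0" for k
    proof -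
      have "?RV V n ** (C0.th W \<star> lp f) (k - n) = 0" for n
        using z[of "k - n"] that by (cases "n < 0") (simp_all add: zser_def)
      then show ?thesis unfolding compare[OF V f] VW by (simp add: lconv_def)
    qed
    then show ?thesis
      unfolding memC using in_domain_loop_act[of R A f, OF R0 f] V by auto
  qed
  define S where "S = series_inverse R"
  have S0: "S 0 = mat 1" and RS: "\<And>n. (\<Sum>i\<le>n. R i ** S (n - i)) = (if n = 0 then mat 1 else 0)"
    unfolding S_def by (simp_all add: series_inverse_right[of R, OF R0])
  have bwd: "\<exists>f\<in>C_const. g = loop_act R f" if gC: "g \<in> C" for g
  proof -
    obtain V where g: "in_domain A g" and V: "\<And>\<alpha>. deg_le (V \<alpha>) (-1)"
      and z: "\<And>k. k \<le> 0 \<Longrightarrow> (C.th V \<star> lp g) k = 0"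
      using gC unfolding memC by auto
    define f where "f = loop_act S g"
    have f: "in_domain A f" unfolding f_def by (rule in_domain_loop_act[of S A g, OF S0 g])
    have "lp (loop_act R f) = lp g"
      unfolding f_def lp_loop_act
      by (simp add: lconv_assoc loop_op_zser_cmat loop_vec_lp[OF g] zser_inverse[OF RS])
    then have Rf: "g = loop_act R f" by (simp add: lp_eq_iff)
    have smV: "small V" by (rule small_of_deg) (rule V)
    have "(C0.th (?W V) \<star> lp f) k = 0" if "k \<le> 0" for k
    proof (rule zser_reflects_vanishing[OF opRV[OF V] _ _ _ that])
      show "cst (Msubst V (Rv 0)) = mat 1" by (simp add: smV Rv)
      show "loop_vec (C0.th (?W V) \<star> lp f)"
        by (rule loop_vec_conv[OF C0.loop_op_th[OF Wdeg[OF V]] loop_vec_lp[OF f]])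
      show "(?RV V \<star> (C0.th (?W V) \<star> lp f)) k = 0" if "k \<le> 0" for k
        using z[OF that] unfolding compare[OF V f, symmetric] Rf[symmetric] .
    qed
    then have "f \<in> C_const" unfolding memC0 using f Wdeg[OF V]
      by (intro conjI exI[of _ "?W V"]) auto
    then show ?thesis using Rf by blast
  qed
  have "C = loop_act R ` C_const" using fwd bwd by blast
  then show ?thesis using R0 by (auto simp: G_plus_def)
qed

end
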